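(* Let $k$ be a finite field with algebraic closure $\overline{k}$, let $\mathcal{E}$ be an elliptic curve in Weierstrass form defined over $k$, let $\varphi:\mathcal{E}\to\mathcal{E}$ be a separable endomorphism of odd degree defined over $k$, and let $P\in\mathcal{E}(\overline{k})$ be a point (other than the point at infinity, so that its $x$-coordinate $x_P\in\overline{k}$ is defined). Suppose that the subgroup $\ker(\varphi\circ\varphi)$ of $\mathcal{E}(\overline{k})$ is cyclic and that all its points are $k(P)$-rational. Denote by $S\in k(x)$ the $x$-coordinate map of $\varphi$ and by $f\in k[x]$ the minimal polynomial of $x_P$ over $k$. If $T_S(f)$ is irreducible over $k$, then all polynomials in the family $I_S(f)=\left(T_S^n(f)\right)_{n\geq 0}$ are irreducible over $k$.
   Context: For a point $R$ of an elliptic curve defined over $k$, with coordinates in $\overline{k}$, $k(R)$ denotes the field of definition of $R$ over $k$ (the extension of $k$ generated by the coordinates of $R$, equal to $k$ if $R$ is the point at infinity). A point is $k(P)$-rational if its field of definition is contained in $k(P)$. The $x$-coordinate map of $\varphi$ is the rational fraction $S\in k(x)$ such that $x(\varphi(R))=S(x(R))$ for points $R$ of $\mathcal{E}$; it exists because $\varphi$ commutes with the involution $R\mapsto -R$. For a rational fraction $S\in k(x)$ and a polynomial $g\in k[x]$, the $S$-transform of $g$ is the polynomial $T_S(g)=\operatorname{numerator}(g(S(x)))\in k[x]$, i.e. the numerator of the rational fraction $g(S(x))$ written in lowest terms (well defined up to a nonzero constant factor, which does not affect irreducibility). $T_S^n=T_S\circ\cdots\circ T_S$ denotes the composition of $n$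 copies of $T_S$, with $T_S^0(f)=f$. *)

theory Defs
  imports
    "HOL-Algebra.Algebraic_Closure_Type"
    "HOL-Algebra.Elementary_Groups"
    "HOL-Algebra.Embedded_Algebras"
    "HOL-Algebra.Generated_Fields"
begin

section \<open>Weierstrass curves and their points\<close>

text \<open>
  The base field is a type \<open>'a\<close> and its algebraic closure is the type \<open>'a alg_closure\<close>,
  with embedding \<^const>\<open>to_ac\<close>. A curve is given by the coefficients of
  $y^2 + a_1 x y + a_3 y = x^3 + a_2 x^2 + a_4 x + a_6$.
\<close>

datatype 'a weierstrass =
  Weierstrass (wa1: 'a) (wa2: 'a) (wa3: 'a) (wa4: 'a) (wa6: 'a)

datatype 'b ec_point = Infinity | Affine 'b 'b

definition on_weierstrass :: "'b::field weierstrass \<Rightarrow> 'b \<Rightarrow> 'b \<Rightarrow> bool" where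
  "on_weierstrass W x y \<longleftrightarrow>
     y^2 + wa1 W * x * y + wa3 W * y = x^3 + wa2 W * x^2 + wa4 W * x + wa6 W"

definition curve_points :: "'b::field weierstrass \<Rightarrow> 'b ec_point set" where
  "curve_points W = insert Infinity {Affine x y | x y. on_weierstrass W x y}"

abbreviation base_change :: "'a::field weierstrass \<Rightarrow> 'a alg_closure weierstrass" where
  "base_change E \<equiv> map_weierstrass to_ac E"

text \<open>
  Smoothness: the partial derivatives of the Weierstrass equation have no common zero on the
  curve over the algebraic closure. The point at infinity of a Weierstrass cubic is always
  smooth, so that only affine points have to be considered.
\<close>

definition elliptic_curve :: "'a::field weierstrass \<Rightarrow> bool" where
  "elliptic_curve E \<longleftrightarrow>
     (let W = base_change E in
      \<forall>x y. on_weierstrass W x y \<longrightarrow>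
        wa1 W * y - 3 * x^2 - 2 * wa2 W * x - wa4 W \<noteq> 0 \<or>
        2 * y + wa1 W * x + wa3 W \<noteq> 0)"


section \<open>The chord and tangent group law\<close>

fun ec_add :: "'b::field weierstrass \<Rightarrow> 'b ec_point \<Rightarrow> 'b ec_point \<Rightarrow> 'b ec_point" where
  "ec_add W Infinity Q = Q"
| "ec_add W P Infinity = P"
| "ec_add W (Affine x1 y1) (Affine x2 y2) =
    (if x1 = x2 \<and> y1 + y2 + wa1 W * x2 + wa3 W = 0 then Infinity
     else
       let l = (if x1 = x2
                then (3 * x1^2 + 2 * wa2 W * x1 + wa4 W - wa1 W * y1) / (2 * y1 + wa1 W * x1 + wa3 W)
                else (y2 - y1) / (x2 - x1));
           v = y1 - l * x1;
           x3 = l^2 + wa1 W * l - wa2 W - x1 - x2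
       in Affine x3 (- (l + wa1 W) * x3 - v - wa3 W))"

text \<open>The group of points over the algebraic closure of the base field.\<close>

definition ec_group :: "'a::field weierstrass \<Rightarrow> 'a alg_closure ec_point monoid" where
  "ec_group E = \<lparr>carrier = curve_points (base_change E),
                 monoid.mult = ec_add (base_change E), one = Infinity\<rparr>"


section \<open>Endomorphisms defined over the base field\<close>

text \<open>
  Value at $(u, v, w)$ of the form $\sum c_{ij} u^i v^j w^{d-i-j}$ of degree $d$ with
  coefficients in the base field.
\<close>

definition form_eval ::
  "nat \<Rightarrow> (nat \<Rightarrow> nat \<Rightarrow> 'a::field) \<Rightarrow> 'a alg_closure \<times> 'a alg_closure \<times> 'a alg_closure \<Rightarrow> 'a alg_closure"
where
  "form_eval d c = (\<lambda>(u, v, w). \<Sum>i\<le>d. \<Sum>j\<le>d - i. to_ac (c i j) * u^i * v^j * w^(d - i - j))"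

fun proj_coords :: "'b::field ec_point \<Rightarrow> 'b \<times> 'b \<times> 'b" where
  "proj_coords Infinity = (0, 1, 0)"
| "proj_coords (Affine x y) = (x, y, 1)"

text \<open>
  A morphism of projective curves over the base field: around every geometric point the map is
  given by three forms of equal degree over the base field without common zero at that point.
\<close>

definition curve_morphism ::
  "'a::field weierstrass \<Rightarrow> ('a alg_closure ec_point \<Rightarrow> 'a alg_closure ec_point) \<Rightarrow> bool"
where
  "curve_morphism E \<phi> \<longleftrightarrow>
     \<phi> \<in> curve_points (base_change E) \<rightarrow> curve_points (base_change E) \<and>
     (\<forall>R \<in> curve_points (base_change E). \<exists>d c0 c1 c2.
        let F = (\<lambda>Q. (form_eval d c0 (proj_coords Q),
                       form_eval d c1 (proj_coords Q),
                       form_eval d c2 (proj_coords Q)))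
        in F R \<noteq> (0, 0, 0) \<and>
           (\<forall>Q \<in> curve_points (base_change E). F Q \<noteq> (0, 0, 0) \<longrightarrow>
              (\<exists>s u v w. proj_coords (\<phi> Q) = (u, v, w) \<and> F Q = (s * u, s * v, s * w))))"

definition ec_endomorphism ::
  "'a::field weierstrass \<Rightarrow> ('a alg_closure ec_point \<Rightarrow> 'a alg_closure ec_point) \<Rightarrow> bool"
where
  "ec_endomorphism E \<phi> \<longleftrightarrow> curve_morphism E \<phi> \<and> \<phi> \<in> hom (ec_group E) (ec_group E)"


section \<open>Function field, degree and separability\<close>

text \<open>
  The function field of the curve over the base field $k$ is realised as the subfield
  $k(x)(\eta)$ of an algebraic closure of $k(x)$, where $\eta$ is a root of the Weierstrass
  equation. This equation is irreducible over $k(x)$, so that the choice of the root is immaterial.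
\<close>

type_synonym 'a ff = "'a poly fract alg_closure"

definition ff_const :: "'a::field \<Rightarrow> 'a ff" where
  "ff_const c = to_ac (Fract [:c:] 1)"

definition ff_x :: "'a::field ff" where
  "ff_x = to_ac (Fract [:0, 1:] 1)"

definition ff_y :: "'a::field weierstrass \<Rightarrow> 'a ff" where
  "ff_y E = (SOME y. on_weierstrass (map_weierstrass ff_const E) ff_x y)"

definition function_field :: "'a::field weierstrass \<Rightarrow> 'a ff set" where
  "function_field E = generate_field ring_of_type_algebra (insert (ff_y E) (range to_ac))"

text \<open>Evaluation of a polynomial in $k[x][y]$ after mapping its coefficients by \<open>e\<close>.\<close>

definition eval2 :: "('a::field \<Rightarrow> 'b::field) \<Rightarrow> 'a poly poly \<Rightarrow> 'b \<Rightarrow> 'b \<Rightarrow> 'b" where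
  "eval2 e A u v = poly (map_poly (\<lambda>c. poly (map_poly e c) u) A) v"

text \<open>
  The rational function \<open>h\<close> is regular at the affine point \<open>(u, v)\<close> of the curve, with value \<open>w\<close>.
\<close>

definition has_value ::
  "'a::field weierstrass \<Rightarrow> 'a ff \<Rightarrow> 'a alg_closure \<Rightarrow> 'a alg_closure \<Rightarrow> 'a alg_closure \<Rightarrow> bool"
where
  "has_value E h u v w \<longleftrightarrow>
     (\<exists>A B. h = eval2 ff_const A ff_x (ff_y E) / eval2 ff_const B ff_x (ff_y E) \<and>
            eval2 to_ac B u v \<noteq> 0 \<and> w = eval2 to_ac A u v / eval2 to_ac B u v)"

text \<open>
  The relation \<open>h = g \<circ> \<phi>\<close> between rational functions, i.e. equality at all but finitely many
  geometric points.
\<close>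

definition is_pullback ::
  "'a::field weierstrass \<Rightarrow> ('a alg_closure ec_point \<Rightarrow> 'a alg_closure ec_point) \<Rightarrow> 'a ff \<Rightarrow> 'a ff \<Rightarrow> bool"
where
  "is_pullback E \<phi> g h \<longleftrightarrow>
     finite {R \<in> curve_points (base_change E).
       \<not> (\<exists>u v u' v' w. R = Affine u v \<and> \<phi> R = Affine u' v' \<and>
                         has_value E g u' v' w \<and> has_value E h u v w)}"

text \<open>For nonconstant \<open>\<phi>\<close> this is the subfield $\varphi^* k(E)$ of $k(E)$.\<close>

definition pullback_field ::
  "'a::field weierstrass \<Rightarrow> ('a alg_closure ec_point \<Rightarrow> 'a alg_closure ec_point) \<Rightarrow> 'a ff set"
where
  "pullback_field E \<phi> = {h \<in> function_field E. \<exists>g \<in> function_field E. is_pullback E \<phi> g h}"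

definition is_minimal_polynomial :: "'b::field set \<Rightarrow> 'b \<Rightarrow> 'b poly \<Rightarrow> bool" where
  "is_minimal_polynomial K a p \<longleftrightarrow>
     lead_coeff p = 1 \<and> set (coeffs p) \<subseteq> K \<and> poly p a = 0 \<and>
     (\<forall>q. q \<noteq> 0 \<and> set (coeffs q) \<subseteq> K \<and> poly q a = 0 \<longrightarrow> degree p \<le> degree q)"

text \<open>
  In an algebraically closed field \<^const>\<open>rsquarefree\<close> says that all roots in an algebraic
  closure of the subfield are simple.
\<close>

definition separable_extension :: "'b::alg_closed_field set \<Rightarrow> 'b set \<Rightarrow> bool" where
  "separable_extension L K \<longleftrightarrow> (\<forall>a \<in> K. \<exists>p. is_minimal_polynomial L a p \<and> rsquarefree p)"

definition nonzero_endomorphism ::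
  "'a::field weierstrass \<Rightarrow> ('a alg_closure ec_point \<Rightarrow> 'a alg_closure ec_point) \<Rightarrow> bool"
where
  "nonzero_endomorphism E \<phi> \<longleftrightarrow> (\<exists>R \<in> curve_points (base_change E). \<phi> R \<noteq> Infinity)"

text \<open>By convention the zero endomorphism has degree 0 and is not separable.\<close>

definition endo_degree ::
  "'a::field weierstrass \<Rightarrow> ('a alg_closure ec_point \<Rightarrow> 'a alg_closure ec_point) \<Rightarrow> nat"
where
  "endo_degree E \<phi> =
     (if nonzero_endomorphism E \<phi>
      then ring.dim ring_of_type_algebra (pullback_field E \<phi>) (function_field E) else 0)"

definition endo_separable ::
  "'a::field weierstrass \<Rightarrow> ('a alg_closure ec_point \<Rightarrow> 'a alg_closure ec_point) \<Rightarrow> bool"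
where
  "endo_separable E \<phi> \<longleftrightarrow>
     nonzero_endomorphism E \<phi> \<and> separable_extension (pullback_field E \<phi>) (function_field E)"


section \<open>Field of definition of a point\<close>

fun field_of_definition :: "'a::field alg_closure ec_point \<Rightarrow> 'a alg_closure set" where
  "field_of_definition Infinity = range to_ac"
| "field_of_definition (Affine x y) = generate_field ring_of_type_algebra (range to_ac \<union> {x, y})"


section \<open>Rational fractions in one variable\<close>

text \<open>Lowest terms, normalised by a monic denominator.\<close>

definition lowest_terms :: "'a::field poly fract \<Rightarrow> 'a poly \<times> 'a poly" where
  "lowest_terms S =
     (THE pq. S = Fract (fst pq) (snd pq) \<and> coprime (fst pq) (snd pq) \<and> lead_coeff (snd pq) = 1)"

definition numerator :: "'a::field poly fract \<Rightarrow> 'a poly" where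
  "numerator S = fst (lowest_terms S)"

definition denominator :: "'a::field poly fract \<Rightarrow> 'a poly" where
  "denominator S = snd (lowest_terms S)"

text \<open>
  A rational fraction as a map on the projective line over the algebraic closure, with
  \<^const>\<open>None\<close> the point at infinity. Since the denominator is monic, the value at infinity
  is the coefficient of the numerator at its degree, unless the numerator has larger degree.
\<close>

fun fract_eval :: "'a::field poly fract \<Rightarrow> 'a alg_closure option \<Rightarrow> 'a alg_closure option" where
  "fract_eval S None =
    (if degree (numerator S) > degree (denominator S) then None
     else Some (to_ac (coeff (numerator S) (degree (denominator S)))))"
| "fract_eval S (Some t) =
    (if poly (map_poly to_ac (denominator S)) t = 0 then None
     else Some (poly (map_poly to_ac (numerator S)) t / poly (map_poly to_ac (denominator S)) t))"

fun x_coord :: "'b ec_point \<Rightarrow> 'b option" where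
  "x_coord Infinity = None"
| "x_coord (Affine x y) = Some x"

definition is_x_coordinate_map ::
  "'a::field weierstrass \<Rightarrow> ('a alg_closure ec_point \<Rightarrow> 'a alg_closure ec_point) \<Rightarrow> 'a poly fract \<Rightarrow> bool"
where
  "is_x_coordinate_map E \<phi> S \<longleftrightarrow>
     (\<forall>R \<in> curve_points (base_change E). x_coord (\<phi> R) = fract_eval S (x_coord R))"

text \<open>The polynomial $T_S(g)$: the numerator of $g(S(x))$.\<close>

definition S_transform :: "'a::field poly fract \<Rightarrow> 'a poly \<Rightarrow> 'a poly" where
  "S_transform S g = numerator (poly (map_poly (\<lambda>c. Fract [:c:] 1) g) S)"

end

theory Submission
  imports Defs
begin

text \<open>
  Over a finite field $k$ irreducibility is a property of Frobenius orbits: a polynomial of degree $N$ is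
  irreducible if and only if it has a root with exactly $N$ conjugates (\<open>irreducible_root\<close>,
  \<open>irreducibleI_period\<close>). Let $m$ be the degree of $S$ and $e$ the degree of $f$, and let
  $P = Q_0, Q_1, Q_2, \dots$ be points with $\varphi(Q_{n+1}) = Q_n$. Then $T_S^n(f)$ has degree $m^n e$, and the
  abscissa $x_n$ of $Q_n$ is a root of it. It has to be shown that $x_n$ has $m^n e$ conjugates.

  The idea is to follow the points $Q_n$ under $\sigma = \pi^{2e}$, where $\pi$ is the Frobenius map on points.
  As $\pi^e$ fixes $x_P$, it fixes $P$ up to sign, so that $\sigma$ fixes $P$ and therefore every point of
  $\ker\varphi^2$. Irreducibility of $T_S(f)$ says that $x_1$ has $me$ conjugates; for odd $m$ this means that
  $\sigma$ translates $Q_1$ by a point of order $m$, which generates $\ker\varphi$. This property climbs the tower: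
  if $\sigma^{m^n}$ translates $Q_{n+1}$ by a generator $t$ of $\ker\varphi$, then it translates $Q_{n+2}$ by
  some $s \in \ker\varphi^2$ with $\varphi(s) = t$, and since it fixes $s$, its $m$-th power translates
  $Q_{n+2}$ by $ms$. As $\ker\varphi^2$ is cyclic, $ms$ is again a generator of $\ker\varphi$
  (\<open>order_m_pow\<close>, \<open>tower_orbits\<close>). So $Q_n$ has $m^n$ images under the powers of $\sigma$. In passing
  to the abscissa at most a factor 2 is lost, and none is because $m$ is odd.

  Three facts about elliptic curves support this argument.

  \<^item> The points form a commutative group. A point is sent to the class of its ideal in the coordinate
    ring. Chords and tangents show that sums go to products (\<open>same_class_ec_add\<close>), and the map is injective
    (\<open>same_class_point_idealD\<close>) because the norm of a function is a polynomial in $x$ whose degree is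
    never 1. Associativity is inherited from the multiplication of ideals.

  \<^item> The kernel of $\varphi$ has $m$ elements (\<open>card_kernel_eq_degree\<close>). This is a count of the points in a
    generic fibre, where $S(x) = c$ has $m$ simple roots. The derivative of $S$ is not zero, since otherwise
    $T_S(f)$ would have derivative zero, while irreducible polynomials over a finite field have simple roots.

  \<^item> The number $m$ is odd (\<open>odd_degree_numerator\<close>). Indeed $[k(E) : k(S)] = 2m$, and the pullback
    field $\varphi^* k(E)$ is of degree at most 2 over $k(S)$, because $k(E)$ is generated over $k(x)$ by the single
    quadratic element $y$. If $[k(E) : \varphi^* k(E)]$ is odd, it must be equal to $m$.
\<close>

section \<open>Field embeddings and polynomials\<close>

locale field_embedding =
  fixes h :: "'a::field \<Rightarrow> 'b::field"
  assumes hom_1: "h 1 = 1"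
    and hom_add: "h (x + y) = h x + h y"
    and hom_mult: "h (x * y) = h x * h y"
begin

lemma hom_0: "h 0 = 0"
  using hom_add[of 0 0] by (metis add_0 add_right_cancel)

lemma hom_minus: "h (- x) = - h x"
  using hom_add[of x "- x"] hom_0 by (simp add: eq_neg_iff_add_eq_0 add.commute)

lemma hom_diff: "h (x - y) = h x - h y"
  using hom_add[of x "- y"] hom_minus by simp

lemma hom_eq_0_iff: "h x = 0 \<longleftrightarrow> x = 0"
proof
  assume "h x = 0"
  then have "x * inverse x \<noteq> 1" using hom_mult[of x "inverse x"] hom_1 by auto
  then show "x = 0" by (meson right_inverse)
qed (simp add: hom_0)

lemma hom_eq_iff: "h x = h y \<longleftrightarrow> x = y"
  using hom_eq_0_iff[of "x - y"] by (simp add: hom_diff)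

lemma hom_inverse: "h (inverse x) = inverse (h x)"
proof (cases "x = 0")
  case False
  then have "h x * h (inverse x) = 1" using hom_mult[of x "inverse x"] hom_1 by simp
  then show ?thesis by (metis inverse_unique)
qed (simp add: hom_0)

lemma hom_divide: "h (x / y) = h x / h y"
  by (simp add: divide_inverse hom_mult hom_inverse)

lemma hom_power: "h (x ^ n) = h x ^ n"
  by (induction n) (simp_all add: hom_1 hom_mult)

lemma hom_of_nat: "h (of_nat n) = of_nat n"
  by (induction n) (simp_all add: hom_1 hom_add hom_0)

lemma hom_numeral: "h (numeral n) = numeral n"
  using hom_of_nat[of "numeral n"] by simp

lemma hom_sum: "h (sum f A) = (\<Sum>x\<in>A. h (f x))"
  by (induction A rule: infinite_finite_induct) (simp_all add: hom_0 hom_add)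

lemma map_poly_add: "map_poly h (p + q) = map_poly h p + map_poly h q"
  by (rule poly_eqI) (simp add: coeff_map_poly hom_0 hom_add)

lemma map_poly_diff: "map_poly h (p - q) = map_poly h p - map_poly h q"
  by (rule poly_eqI) (simp add: coeff_map_poly hom_0 hom_diff)

lemma map_poly_smult': "map_poly h (smult c p) = smult (h c) (map_poly h p)"
  by (rule poly_eqI) (simp add: coeff_map_poly hom_0 hom_mult)

lemma map_poly_mult: "map_poly h (p * q) = map_poly h p * map_poly h q"
  by (rule poly_eqI) (simp add: coeff_map_poly hom_0 hom_mult coeff_mult hom_sum)

lemma map_poly_power: "map_poly h (p ^ n) = map_poly h p ^ n"
  by (induction n) (simp_all add: map_poly_mult hom_1)

lemma map_poly_sum: "map_poly h (sum f A) = (\<Sum>x\<in>A. map_poly h (f x))"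
  by (induction A rule: infinite_finite_induct) (simp_all add: map_poly_add)

lemma map_poly_pderiv: "map_poly h (pderiv p) = pderiv (map_poly h p)"
  by (rule poly_eqI)
     (simp add: coeff_map_poly coeff_pderiv hom_0 hom_mult hom_of_nat hom_add hom_1)

lemma degree_map_poly_hom: "degree (map_poly h p) = degree p"
  by (cases "p = 0") (simp_all add: map_poly_degree_eq hom_eq_0_iff)

lemma map_poly_hom_eq_0_iff: "map_poly h p = 0 \<longleftrightarrow> p = 0"
  by (auto simp: poly_eq_iff coeff_map_poly hom_0 hom_eq_0_iff)

lemma poly_map_poly_hom: "poly (map_poly h p) (h x) = h (poly p x)"
  by (induction p) (simp_all add: hom_0 map_poly_pCons hom_add hom_mult)

end

interpretation to_ac: field_embedding to_ac
  by standard simp_all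


section \<open>The function field of a Weierstrass curve\<close>

definition ff_poly :: "'b::field poly \<Rightarrow> 'b ff" where
  "ff_poly p = to_ac (Fract p 1)"

lemma ff_poly_0 [simp]: "ff_poly 0 = 0"
  by (simp add: ff_poly_def fract_collapse)

lemma ff_poly_1 [simp]: "ff_poly 1 = 1"
  by (simp add: ff_poly_def fract_collapse)

lemma ff_poly_add [simp]: "ff_poly (p + q) = ff_poly p + ff_poly q"
  by (simp add: ff_poly_def flip: to_ac_add)

lemma ff_poly_minus [simp]: "ff_poly (- p) = - ff_poly p"
  by (simp add: ff_poly_def flip: to_ac_minus)

lemma ff_poly_diff [simp]: "ff_poly (p - q) = ff_poly p - ff_poly q"
  by (simp add: ff_poly_def flip: to_ac_diff)

lemma ff_poly_mult [simp]: "ff_poly (p * q) = ff_poly p * ff_poly q"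
  by (simp add: ff_poly_def flip: to_ac_mult)

lemma ff_poly_power [simp]: "ff_poly (p ^ n) = ff_poly p ^ n"
  by (induction n) simp_all

lemma ff_poly_eq_iff [simp]: "ff_poly p = ff_poly q \<longleftrightarrow> p = q"
  by (simp add: ff_poly_def eq_fract)

lemma ff_poly_eq_0_iff [simp]: "ff_poly p = 0 \<longleftrightarrow> p = 0"
  using ff_poly_eq_iff[of p 0] by (simp del: ff_poly_eq_iff)

lemma ff_x_eq: "ff_x = ff_poly [:0, 1:]"
  by (simp add: ff_x_def ff_poly_def)

lemma ff_const_eq: "ff_const c = ff_poly [:c:]"
  by (simp add: ff_const_def ff_poly_def)

interpretation ff_const: field_embedding ff_const
  by standard (simp_all add: ff_const_eq one_pCons[symmetric] flip: ff_poly_add ff_poly_mult ff_poly_1)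

lemma poly_ff_const_ff_x: "poly (map_poly ff_const c) ff_x = ff_poly c"
proof (induction c)
  case (pCons a p)
  have "ff_poly (pCons a p) = ff_const a + ff_x * ff_poly p"
    by (simp add: ff_const_eq ff_x_eq flip: ff_poly_add ff_poly_mult)
  then show ?case using pCons by (simp add: map_poly_pCons ff_const.hom_0)
qed simp

lemma eval2_hom:
  assumes "field_embedding e"
  shows "eval2 e (A + B) u v = eval2 e A u v + eval2 e B u v"
    and "eval2 e (A * B) u v = eval2 e A u v * eval2 e B u v"
proof -
  interpret e: field_embedding e by fact
  define m :: "'a::field poly poly \<Rightarrow> 'b::field poly" where "m = map_poly (\<lambda>c. poly (map_poly e c) u)"
  have m0: "m 0 = 0" by (simp add: m_def)
  have add: "m (A + B) = m A + m B" for A B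
    by (rule poly_eqI) (simp add: m_def coeff_map_poly e.map_poly_add)
  have sm: "m (smult c A) = smult (poly (map_poly e c) u) (m A)" for c A
    by (rule poly_eqI) (simp add: m_def coeff_map_poly e.map_poly_mult)
  have mult: "m (A * B) = m A * m B" for A B
  proof (induction A)
    case (pCons a p)
    have shift: "m (pCons c q) = pCons (poly (map_poly e c) u) (m q)" for c q
      by (cases "q = 0 \<and> c = 0") (auto simp add: map_poly_pCons m_def)
    from pCons show ?case by (simp add: add sm shift)
  qed (simp add: m0)
  have eval2_m: "eval2 e A u v = poly (m A) v" for A
    by (simp add: eval2_def m_def)
  show "eval2 e (A + B) u v = eval2 e A u v + eval2 e B u v"
    and "eval2 e (A * B) u v = eval2 e A u v * eval2 e B u v"
    by (simp_all add: eval2_m add mult)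
qed

lemma eval2_linear:
  assumes "field_embedding e"
  shows "eval2 e [:p, q:] u v = poly (map_poly e p) u + poly (map_poly e q) u * v"
  using field_embedding.hom_0[OF assms]
  by (cases "q = 0"; cases "p = 0") (simp_all add: eval2_def map_poly_pCons)

lemma eval2_0: "eval2 e 0 u v = 0"
  by (simp add: eval2_def)

subsection \<open>Norms on the coordinate ring\<close>

locale weierstrass_field =
  fixes W :: "'b::field weierstrass"
begin

abbreviation \<eta> :: "'b ff" where "\<eta> \<equiv> ff_y W"

text \<open>The Weierstrass equation is written as \<open>y\<^sup>2 + lin * y = cub\<close>.\<close>

definition lin :: "'b poly" where "lin = [:wa3 W, wa1 W:]"

definition cub :: "'b poly" where "cub = [:wa6 W, wa4 W, wa2 W, 1:]"

definition ev :: "'b poly poly \<Rightarrow> 'b ff" where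
  "ev A = eval2 ff_const A ff_x \<eta>"

lemma on_weierstrass_iff: "on_weierstrass W u v \<longleftrightarrow> v^2 + poly lin u * v = poly cub u"
  by (simp add: on_weierstrass_def lin_def cub_def algebra_simps power2_eq_square power3_eq_cube)

lemma \<eta>_eq: "\<eta>^2 + ff_poly lin * \<eta> = ff_poly cub"
proof -
  let ?W = "map_weierstrass ff_const W"
  have *: "on_weierstrass ?W ff_x y \<longleftrightarrow> y^2 + ff_poly lin * y = ff_poly cub" for y
  proof -
    have 1: "ff_poly lin = wa1 ?W * ff_x + wa3 ?W"
      by (simp add: lin_def weierstrass.map_sel ff_const_eq ff_x_eq flip: ff_poly_mult ff_poly_add)
    have 2: "ff_poly cub = ff_x^3 + wa2 ?W * ff_x^2 + wa4 ?W * ff_x + wa6 ?W"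
      by (simp add: cub_def weierstrass.map_sel ff_const_eq ff_x_eq power2_eq_square power3_eq_cube
               flip: ff_poly_mult ff_poly_add)
    show ?thesis unfolding 1 2 on_weierstrass_def by (simp add: algebra_simps)
  qed
  have "\<exists>y. poly [:- ff_poly cub, ff_poly lin, 1:] y = 0"
    by (rule alg_closed_imp_poly_has_root) simp
  then obtain y where "- ff_poly cub + y * (ff_poly lin + y) = 0" by auto
  then have "y^2 + ff_poly lin * y = ff_poly cub"
    by (simp add: algebra_simps power2_eq_square)
  then have "\<exists>y. on_weierstrass ?W ff_x y" unfolding * ..
  then have "on_weierstrass ?W ff_x \<eta>" unfolding ff_y_def by (rule someI_ex)
  then show ?thesis unfolding * .
qed

lemma ev_hom: "ev (A + B) = ev A + ev B" "ev (A * B) = ev A * ev B"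
  unfolding ev_def by (rule eval2_hom[OF ff_const.field_embedding_axioms])+

lemma ev_linear: "ev [:p, q:] = ff_poly p + ff_poly q * \<eta>"
  unfolding ev_def eval2_linear[OF ff_const.field_embedding_axioms] poly_ff_const_ff_x ..

lemma ev_const: "ev [:p:] = ff_poly p"
  using ev_linear[of p 0] by simp

lemma ev_one: "ev 1 = 1"
  using ev_const[of 1] by (simp flip: one_pCons)

lemma ev_diff: "ev (A - B) = ev A - ev B"
  using ev_hom(1)[of "A - B" B] by (simp add: algebra_simps)

definition wpoly :: "'b poly poly" where "wpoly = [:- cub, lin, 1:]"

lemma ev_wpoly: "ev wpoly = 0"
  using \<eta>_eq by (simp add: ev_def eval2_def wpoly_def map_poly_pCons poly_ff_const_ff_x algebra_simps power2_eq_square)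

text \<open>
  The Weierstrass polynomial is monic in $y$, so that division leaves a remainder that is linear in $y$: the
  coordinate ring is free over $k[x]$ with basis $1, y$.
\<close>

lemma reduce_mod_wpoly: obtains Q p q where "A = Q * wpoly + [:p, q:]"
proof -
  have "\<exists>Q p q. A = Q * wpoly + [:p, q:]"
  proof (induction A)
    case 0
    have "(0::'b poly poly) = 0 * wpoly + [:0, 0:]" by simp
    then show ?case by blast
  next
    case (pCons a A)
    then obtain Q p q where A: "A = Q * wpoly + [:p, q:]" by blast
    have "pCons a A = [:0, 1:] * A + [:a:]" by simp
    also have "\<dots> = ([:0, 1:] * Q + [:q:]) * wpoly + [:a + q * cub, p - q * lin:]"
      by (simp add: A wpoly_def algebra_simps)
    finally show ?case by blast
  qed
  then show ?thesis using that by blast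
qed

text \<open>
  The norm of $p + q y$ to $k(x)$; the conjugate of $y$ is $-y - a_1 x - a_3$.
\<close>

definition nrm :: "'b poly \<Rightarrow> 'b poly \<Rightarrow> 'b poly" where
  "nrm p q = p^2 - p * q * lin - q^2 * cub"

lemma nrm_conj:
  "(ff_poly p + ff_poly q * \<eta>) * (ff_poly (p - q * lin) - ff_poly q * \<eta>) = ff_poly (nrm p q)"
proof -
  have "(ff_poly p + ff_poly q * \<eta>) * (ff_poly (p - q * lin) - ff_poly q * \<eta>)
      = ff_poly p^2 - ff_poly p * ff_poly q * ff_poly lin - ff_poly q^2 * (\<eta>^2 + ff_poly lin * \<eta>)"
    by (simp add: algebra_simps power2_eq_square)
  then show ?thesis unfolding \<eta>_eq by (simp add: nrm_def)
qed

text \<open>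
  The terms $p^2$ and $q^2 (x^3 + \dots)$ have degrees of different parity, and the larger one also
  dominates the middle term. A degree of 1 would require $q = 0$ and an odd $2 \deg p$.
\<close>

lemma degree_nrm:
  assumes "p \<noteq> 0 \<or> q \<noteq> 0"
  shows "nrm p q \<noteq> 0" and "degree (nrm p q) \<noteq> 1"
proof -
  have dc: "degree cub = 3" by (simp add: cub_def)
  then have c: "cub \<noteq> 0" by auto
  have d2: "degree (- (q^2 * cub)) = 2 * degree q + 3" if "q \<noteq> 0"
    using that dc c by (simp add: degree_mult_eq degree_power_eq)
  have d3: "degree (p * q * lin) \<le> degree p + degree q + 1"
    using degree_mult_le[of "p * q" lin] degree_mult_le[of p q] by (simp add: lin_def split: if_splits)
  consider "q = 0" | "q \<noteq> 0" "degree p \<ge> degree q + 2" | "q \<noteq> 0" "degree p < degree q + 2"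
    by linarith
  then have "nrm p q \<noteq> 0 \<and> degree (nrm p q) \<noteq> 1"
  proof cases
    case 1
    then have "nrm p q = p^2" "p \<noteq> 0" using assms by (simp_all add: nrm_def)
    then show ?thesis by (auto simp: degree_power_eq)
  next
    case 2
    then have "p \<noteq> 0" by auto
    then have d1: "degree (p^2) = 2 * degree p" by (simp add: degree_power_eq)
    have "degree (- (p * q * lin) + - (q^2 * cub)) \<le> max (degree p + degree q + 1) (2 * degree q + 3)"
      by (intro degree_add_le) (use d2[OF 2(1)] d3 in auto)
    also have "\<dots> < degree (p^2)" using d1 2 by auto
    finally have "degree (p^2 + (- (p * q * lin) + - (q^2 * cub))) = degree (p^2)"
      by (intro degree_add_eq_left)
    then have "degree (nrm p q) = 2 * degree p" using d1 by (simp add: nrm_def algebra_simps)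
    then show ?thesis using 2 by auto
  next
    case 3
    have "degree (p^2 + - (p * q * lin)) \<le> max (2 * degree p) (degree p + degree q + 1)"
      by (intro degree_add_le) (use degree_power_le[of p 2] d3 in auto)
    also have "\<dots> < degree (- (q^2 * cub))" using d2[OF 3(1)] 3 by auto
    finally have "degree (p^2 + - (p * q * lin) + - (q^2 * cub)) = degree (- (q^2 * cub))"
      by (intro degree_add_eq_right)
    then have "degree (nrm p q) = 2 * degree q + 3" using d2[OF 3(1)] by (simp add: nrm_def)
    then show ?thesis by auto
  qed
  then show "nrm p q \<noteq> 0" and "degree (nrm p q) \<noteq> 1" by auto
qed

lemma ff_linear_eq_0_iff: "ff_poly p + ff_poly q * \<eta> = 0 \<longleftrightarrow> p = 0 \<and> q = 0"
proof
  assume "ff_poly p + ff_poly q * \<eta> = 0"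
  then have "ff_poly (nrm p q) = 0" unfolding nrm_conj[symmetric] by simp
  then show "p = 0 \<and> q = 0" using degree_nrm(1) by auto
qed simp

lemma nrm_mult:
  "nrm (p * r + q * s * cub) (p * s + q * r - q * s * lin) = nrm p q * nrm r s"
  unfolding nrm_def by (simp add: algebra_simps power2_eq_square)

lemma ff_linear_mult:
  "(ff_poly p + ff_poly q * \<eta>) * (ff_poly r + ff_poly s * \<eta>) =
   ff_poly (p * r + q * s * cub) + ff_poly (p * s + q * r - q * s * lin) * \<eta>"
proof -
  have "(ff_poly p + ff_poly q * \<eta>) * (ff_poly r + ff_poly s * \<eta>)
    = ff_poly p * ff_poly r + (ff_poly p * ff_poly s + ff_poly q * ff_poly r) * \<eta>
      + ff_poly q * ff_poly s * (\<eta>^2 + ff_poly lin * \<eta> - ff_poly lin * \<eta>)"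
    by (simp add: algebra_simps power2_eq_square)
  then show ?thesis unfolding \<eta>_eq by (simp add: algebra_simps)
qed

lemma ff_linear_eq_iff:
  "ff_poly p + ff_poly q * \<eta> = ff_poly r + ff_poly s * \<eta> \<longleftrightarrow> p = r \<and> q = s"
  using ff_linear_eq_0_iff[of "p - r" "q - s"] by (simp add: algebra_simps)

text \<open>
  A polynomial that vanishes at the generic point is a multiple of the Weierstrass polynomial, as a remainder
  $p + q y$ vanishes there only for $p = q = 0$. This transports identities of functions to points over any
  extension \<open>e\<close> of the base field.
\<close>

lemma eval2_eq_0_if_ev_eq_0:
  assumes "ev A = 0" and "field_embedding e" and "on_weierstrass (map_weierstrass e W) u v"
  shows "eval2 e A u v = 0"
proof -
  interpret e: field_embedding e by fact
  obtain Q p q where A: "A = Q * wpoly + [:p, q:]" by (rule reduce_mod_wpoly)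
  from assms(1) have "ff_poly p + ff_poly q * \<eta> = 0"
    unfolding A ev_hom ev_wpoly ev_linear by simp
  then have pq: "p = 0" "q = 0" unfolding ff_linear_eq_0_iff by auto
  have "eval2 e wpoly u v = 0"
    using assms(3)
    by (simp add: eval2_def wpoly_def on_weierstrass_def map_poly_pCons cub_def lin_def
        weierstrass.map_sel e.hom_0 e.hom_1 e.hom_minus algebra_simps power2_eq_square power3_eq_cube)
  then show ?thesis unfolding A pq eval2_hom[OF assms(2)] by (simp add: eval2_0)
qed

end

section \<open>The group law\<close>

subsection \<open>Ideal classes of the coordinate ring\<close>

context weierstrass_field
begin

sublocale coord: Modules.module "\<lambda>A z. ev A * z"
  by standard (simp_all add: ev_hom ev_one algebra_simps)

definition coord_ring :: "'b ff set" where "coord_ring = range ev"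

lemma coord_ring_add: "r \<in> coord_ring \<Longrightarrow> s \<in> coord_ring \<Longrightarrow> r + s \<in> coord_ring"
  by (auto simp: coord_ring_def simp flip: ev_hom)

lemma coord_ring_diff: "r \<in> coord_ring \<Longrightarrow> s \<in> coord_ring \<Longrightarrow> r - s \<in> coord_ring"
  by (auto simp: coord_ring_def simp flip: ev_diff)

lemma coord_ring_mult: "r \<in> coord_ring \<Longrightarrow> s \<in> coord_ring \<Longrightarrow> r * s \<in> coord_ring"
  by (auto simp: coord_ring_def simp flip: ev_hom)

lemma coord_ring_poly: "ff_poly p \<in> coord_ring"
  unfolding coord_ring_def ev_const[symmetric] by simp

lemma coord_ring_const: "ff_const c \<in> coord_ring"
  by (simp add: ff_const_eq coord_ring_poly)

lemma coord_ring_x: "ff_x \<in> coord_ring"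
  by (simp add: ff_x_eq coord_ring_poly)

lemma coord_ring_y: "\<eta> \<in> coord_ring"
  using ev_linear[of 0 1] unfolding coord_ring_def by (metis add_0 ff_poly_0 ff_poly_1 mult_1 rangeI)

lemma coord_ring_one: "1 \<in> coord_ring"
  using coord_ring_poly[of 1] by simp

lemmas coord_ring_intros = coord_ring_add coord_ring_diff coord_ring_mult coord_ring_const
  coord_ring_x coord_ring_y coord_ring_poly coord_ring_one

lemma coord_ring_cases:
  assumes "r \<in> coord_ring" obtains p q where "r = ff_poly p + ff_poly q * \<eta>"
proof -
  from assms obtain A where A: "r = ev A" by (auto simp: coord_ring_def)
  obtain Q p q where "A = Q * wpoly + [:p, q:]" by (rule reduce_mod_wpoly)
  then have "r = ff_poly p + ff_poly q * \<eta>" by (simp add: A ev_hom ev_wpoly ev_linear)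
  then show ?thesis by (rule that)
qed

lemma span_coord_scale: "r \<in> coord_ring \<Longrightarrow> z \<in> coord.span G \<Longrightarrow> r * z \<in> coord.span G"
  unfolding coord_ring_def using coord.span_scale by auto

lemma span_image_mult: "coord.span ((*) c ` G) = (*) c ` coord.span G"
proof -
  have sub: "(*) c ` coord.span G \<subseteq> coord.span ((*) c ` G)" for c G
  proof
    fix z assume "z \<in> (*) c ` coord.span G"
    then obtain y where y: "y \<in> coord.span G" "z = c * y" by auto
    from y(1) have "c * y \<in> coord.span ((*) c ` G)"
    proof (induction rule: coord.span_induct_alt)
      case (step A x y)
      have "c * (ev A * x + y) = ev A * (c * x) + c * y" by (simp add: algebra_simps)
      then show ?case using step
        by (simp only: coord.span_add coord.span_scale coord.span_base imageI)
    qed (simp add: coord.span_zero)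
    then show "z \<in> coord.span ((*) c ` G)" using y by simp
  qed
  moreover have "coord.span ((*) c ` G) \<subseteq> (*) c ` coord.span G"
  proof (rule coord.span_minimal)
    show "coord.subspace ((*) c ` coord.span G)"
    proof (rule coord.subspaceI)
      show "0 \<in> (*) c ` coord.span G" using coord.span_zero by (metis image_eqI mult_zero_right)
      show "x + y \<in> (*) c ` coord.span G" if "x \<in> (*) c ` coord.span G" "y \<in> (*) c ` coord.span G" for x y
        using that by (auto simp flip: distrib_left intro!: imageI coord.span_add)
      show "ev A * x \<in> (*) c ` coord.span G" if "x \<in> (*) c ` coord.span G" for A x
        using that by (auto simp: mult.left_commute[of _ c] intro!: imageI coord.span_scale)
    qed
  qed (use coord.span_superset in auto)
  ultimately show ?thesis by blast
qed

definition prods :: "'b ff set \<Rightarrow> 'b ff set \<Rightarrow> 'b ff set" where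
  "prods G H = {g * h | g h. g \<in> G \<and> h \<in> H}"

lemma coord_span_eqI: "G \<subseteq> coord.span H \<Longrightarrow> H \<subseteq> coord.span G \<Longrightarrow> coord.span G = coord.span H"
  by (intro antisym coord.span_minimal coord.subspace_span)

lemma prods_commute: "prods G H = prods H G"
proof -
  have "prods H G = {h * g | g h. g \<in> G \<and> h \<in> H}" unfolding prods_def by blast
  then show ?thesis by (simp only: prods_def mult.commute)
qed

lemma prods_assoc: "prods (prods G H) I = prods G (prods H I)"
proof -
  have "prods (prods G H) I = {(g * h) * i | g h i. g \<in> G \<and> h \<in> H \<and> i \<in> I}"
    unfolding prods_def by blast
  also have "\<dots> = {g * (h * i) | g h i. g \<in> G \<and> h \<in> H \<and> i \<in> I}"
    by (simp only: mult.assoc)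
  also have "\<dots> = prods G (prods H I)"
    unfolding prods_def by blast
  finally show ?thesis .
qed

lemma prods_one: "prods {1} G = G"
  unfolding prods_def by auto

lemma prods_pair: "prods {a, b} {c, d} = {a * c, a * d, b * c, b * d}"
  unfolding prods_def by auto

lemma span_prods: "coord.span (prods (coord.span G) (coord.span H)) = coord.span (prods G H)"
proof (rule antisym)
  have "x * y \<in> coord.span (prods G H)" if x: "x \<in> coord.span G" and y: "y \<in> coord.span H" for x y
    using x
  proof (induction rule: coord.span_induct_alt)
    case (step A g x)
    have "g * y \<in> coord.span (prods G H)"
      using y
    proof (induction rule: coord.span_induct_alt)
      case (step B h y)
      have "g * (ev B * h + y) = ev B * (g * h) + g * y" by (simp add: algebra_simps)
      moreover have "g * h \<in> prods G H" using step(1) \<open>g \<in> G\<close> unfolding prods_def by auto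
      ultimately show ?case
        using step by (simp only: coord.span_add coord.span_scale coord.span_base)
    qed (simp add: coord.span_zero)
    moreover have "(ev A * g + x) * y = ev A * (g * y) + x * y" by (simp add: algebra_simps)
    ultimately show ?case
      using step by (simp only: coord.span_add coord.span_scale)
  qed (simp add: coord.span_zero)
  then have "prods (coord.span G) (coord.span H) \<subseteq> coord.span (prods G H)"
    unfolding prods_def by auto
  then show "coord.span (prods (coord.span G) (coord.span H)) \<subseteq> coord.span (prods G H)"
    by (rule coord.span_minimal) (rule coord.subspace_span)
  have "prods G H \<subseteq> prods (coord.span G) (coord.span H)"
    unfolding prods_def using coord.span_superset[of G] coord.span_superset[of H] by blast
  then show "coord.span (prods G H) \<subseteq> coord.span (prods (coord.span G) (coord.span H))"
    by (rule coord.span_mono)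
qed

text \<open>
  Fractional ideals of the coordinate ring are given by generators. The factor \<open>c\<close> ranges over the whole field, so
  that this is equality in the ideal class group.
\<close>

definition same_class :: "'b ff set \<Rightarrow> 'b ff set \<Rightarrow> bool" where
  "same_class G H \<longleftrightarrow> (\<exists>c. c \<noteq> 0 \<and> coord.span G = (*) c ` coord.span H)"

lemma same_class_refl: "same_class G G"
  unfolding same_class_def by (intro exI[of _ 1]) simp

lemma same_class_sym: "same_class G H \<Longrightarrow> same_class H G"
  unfolding same_class_def
proof safe
  fix c assume "c \<noteq> 0" "coord.span G = (*) c ` coord.span H"
  then have "coord.span H = (*) (inverse c) ` coord.span G"
    by (simp add: image_image mult.assoc[symmetric])
  then show "\<exists>c. c \<noteq> 0 \<and> coord.span H = (*) c ` coord.span G"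
    using \<open>c \<noteq> 0\<close> by (metis inverse_nonzero_iff_nonzero)
qed

lemma same_class_trans: "same_class G H \<Longrightarrow> same_class H I \<Longrightarrow> same_class G I"
  unfolding same_class_def
proof safe
  fix c d assume "c \<noteq> 0" "coord.span G = (*) c ` coord.span H"
    "d \<noteq> 0" "coord.span H = (*) d ` coord.span I"
  then show "\<exists>c. c \<noteq> 0 \<and> coord.span G = (*) c ` coord.span I"
    by (intro exI[of _ "c * d"]) (simp add: image_image mult.assoc)
qed

lemma same_class_prods:
  assumes "same_class G G'" "same_class H H'"
  shows "same_class (prods G H) (prods G' H')"
proof -
  from assms obtain c d where cd: "c \<noteq> 0" "coord.span G = (*) c ` coord.span G'"
      "d \<noteq> 0" "coord.span H = (*) d ` coord.span H'"
    unfolding same_class_def by blast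
  have "prods ((*) c ` G) ((*) d ` H) = (*) (c * d) ` prods G H" for G H
  proof -
    have "prods ((*) c ` G) ((*) d ` H) = {c * g * (d * h) | g h. g \<in> G \<and> h \<in> H}"
      unfolding prods_def by blast
    also have "\<dots> = {c * d * (g * h) | g h. g \<in> G \<and> h \<in> H}" by (simp only: ac_simps)
    also have "\<dots> = (*) (c * d) ` prods G H" unfolding prods_def by blast
    finally show ?thesis .
  qed
  then have "coord.span (prods G H) = (*) (c * d) ` coord.span (prods (coord.span G') (coord.span H'))"
    by (subst span_prods[symmetric]) (simp only: cd span_image_mult)
  then show ?thesis unfolding same_class_def span_prods using cd
    by (intro exI[of _ "c * d"]) simp
qed

text \<open>
  Generators of the maximal ideal of an affine point; infinity stands for the trivial class.
\<close>

fun point_ideal :: "'b ec_point \<Rightarrow> 'b ff set" where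
  "point_ideal Infinity = {1}"
| "point_ideal (Affine a b) = {ff_x - ff_const a, \<eta> - ff_const b}"

lemma y_relation:
  "\<eta>^2 + (ff_const (wa1 W) * ff_x + ff_const (wa3 W)) * \<eta> =
   ff_x^3 + ff_const (wa2 W) * ff_x^2 + ff_const (wa4 W) * ff_x + ff_const (wa6 W)"
proof -
  have 1: "ff_poly lin = ff_const (wa1 W) * ff_x + ff_const (wa3 W)"
    by (simp add: lin_def ff_const_eq ff_x_eq flip: ff_poly_mult ff_poly_add)
  have 2: "ff_poly cub = ff_x^3 + ff_const (wa2 W) * ff_x^2 + ff_const (wa4 W) * ff_x + ff_const (wa6 W)"
    by (simp add: cub_def ff_const_eq ff_x_eq power2_eq_square power3_eq_cube
             flip: ff_poly_mult ff_poly_add)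
  show ?thesis using \<eta>_eq unfolding 1 2 .
qed

lemma on_weierstrass_ff_const:
  assumes "on_weierstrass W a b"
  shows "ff_const b^2 + ff_const (wa1 W) * ff_const a * ff_const b + ff_const (wa3 W) * ff_const b =
   ff_const a^3 + ff_const (wa2 W) * ff_const a^2 + ff_const (wa4 W) * ff_const a + ff_const (wa6 W)"
  using arg_cong[OF assms[unfolded on_weierstrass_def], of ff_const]
  by (simp only: ff_const.hom_add ff_const.hom_mult ff_const.hom_power)

text \<open>
  If $c$ generated the ideal of $(a, b)$, its norm would divide $(x - a)^2$, the norm of $x - a$. It is not
  constant, because $c$ vanishes at $(a, b)$, and its degree is not 1. If it has degree 2, then $x - a$ is itself
  a generator, but it does not divide $y - b$.
\<close>

lemma nonprincipal_point_ideal: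
  assumes "on_weierstrass W a b"
  shows "\<not> same_class (point_ideal (Affine a b)) {1}"
proof
  let ?X = "[:- a, 1:]"
  have X: "ff_x - ff_const a = ff_poly ?X + ff_poly 0 * \<eta>"
    by (simp add: ff_x_eq ff_const_eq flip: ff_poly_diff)
  have Y: "\<eta> - ff_const b = ff_poly [:- b:] + ff_poly 1 * \<eta>"
    by (simp add: ff_const_eq flip: ff_poly_minus)
  have X0: "ff_x - ff_const a \<noteq> 0" unfolding X ff_linear_eq_0_iff by simp
  have id: "field_embedding (\<lambda>k :: 'b. k)" by standard simp_all
  assume "same_class (point_ideal (Affine a b)) {1}"
  then obtain c where c: "c \<noteq> 0" and span: "coord.span (point_ideal (Affine a b)) = (*) c ` coord_ring"
    unfolding same_class_def coord.span_singleton coord_ring_def by (auto simp: image_def)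
  have "c \<in> coord.span (point_ideal (Affine a b))"
    unfolding span using coord_ring_one by (metis image_eqI mult_1_right)
  \<comment> \<open>Functions in the ideal vanish at the point.\<close>
  moreover have "\<exists>Z. z = ev Z \<and> eval2 (\<lambda>k. k) Z a b = 0"
    if "z \<in> coord.span (point_ideal (Affine a b))" for z
    using that
  proof (induction rule: coord.span_induct_alt)
    case base
    show ?case by (intro exI[of _ 0]) (simp add: ev_def eval2_0)
  next
    case (step F g z)
    have "ev [:?X:] = ff_x - ff_const a" "ev [:[:- b:], 1:] = \<eta> - ff_const b"
      unfolding ev_const ev_linear X Y by simp_all
    moreover have "eval2 (\<lambda>k. k) [:?X:] a b = 0" "eval2 (\<lambda>k. k) [:[:- b:], 1:] a b = 0"
      using eval2_linear[OF id, of ?X 0 a b] eval2_linear[OF id, of "[:- b:]" 1 a b] by simp_all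
    ultimately obtain V where "g = ev V" "eval2 (\<lambda>k. k) V a b = 0"
      using step(1) by (metis insertE singletonD point_ideal.simps(2))
    moreover obtain Z where "z = ev Z" "eval2 (\<lambda>k. k) Z a b = 0" using step.IH by blast
    ultimately show ?case
      by (intro exI[of _ "F * V + Z"]) (simp add: ev_hom eval2_hom[OF id])
  qed
  ultimately obtain Z where Z: "c = ev Z" "eval2 (\<lambda>k. k) Z a b = 0" by blast
  obtain Q r s where Zrs: "Z = Q * wpoly + [:r, s:]" by (rule reduce_mod_wpoly)
  have cc: "c = ff_poly r + ff_poly s * \<eta>"
    by (simp add: Z(1) Zrs ev_hom ev_wpoly ev_linear)
  have "eval2 (\<lambda>k. k) wpoly a b = 0"
    by (rule eval2_eq_0_if_ev_eq_0[OF ev_wpoly id]) (use assms in \<open>cases W; simp\<close>)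
  then have c0: "poly r a + poly s a * b = 0"
    using Z(2) by (simp add: Zrs eval2_hom[OF id] eval2_linear[OF id])
  have rs: "r \<noteq> 0 \<or> s \<noteq> 0" using c unfolding cc ff_linear_eq_0_iff by blast
  have "ff_x - ff_const a \<in> (*) c ` coord_ring" "\<eta> - ff_const b \<in> (*) c ` coord_ring"
    unfolding span[symmetric] by (auto intro: coord.span_base)
  then obtain z z' where z: "z \<in> coord_ring" "ff_x - ff_const a = c * z"
      and z': "z' \<in> coord_ring" "\<eta> - ff_const b = c * z'" by blast
  obtain t u where tu: "z = ff_poly t + ff_poly u * \<eta>" using coord_ring_cases[OF z(1)] .
  have tu0: "t \<noteq> 0 \<or> u \<noteq> 0" using X0 z(2) tu by auto
  have e: "?X = r * t + s * u * cub" "0 = r * u + s * t - s * u * lin"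
    using z(2) unfolding X cc tu ff_linear_mult ff_linear_eq_iff by blast+
  have "nrm ?X 0 = nrm r s * nrm t u"
    unfolding nrm_mult[symmetric] e(1)[symmetric] e(2)[symmetric] ..
  then have N: "nrm r s * nrm t u = ?X^2" by (simp add: nrm_def)
  have "degree (nrm r s) + degree (nrm t u) = 2"
    using arg_cong[OF N, of degree] degree_nrm(1)[OF rs] degree_nrm(1)[OF tu0]
    by (simp add: degree_mult_eq degree_power_eq)
  with degree_nrm(2)[OF rs] have "degree (nrm r s) = 0 \<or> degree (nrm t u) = 0" by linarith
  then show False
  proof
    assume "degree (nrm r s) = 0"
    moreover have "poly (nrm r s) a = 0"
    proof -
      have "poly (nrm r s) a = (poly r a + poly s a * b) * (poly r a - poly s a * (b + poly lin a))
         + (poly s a)^2 * (b^2 + poly lin a * b - poly cub a)"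
        by (simp add: nrm_def algebra_simps power2_eq_square)
      also have "\<dots> = 0" using c0 assms by (simp add: on_weierstrass_iff)
      finally show ?thesis .
    qed
    ultimately show False
      using degree_nrm(1)[OF rs] by (auto elim!: degree_eq_zeroE)
  next
    assume "degree (nrm t u) = 0"
    then obtain k where k: "nrm t u = [:k:]" "k \<noteq> 0"
      using degree_nrm(1)[OF tu0] by (auto elim!: degree_eq_zeroE)
    \<comment> \<open>Now z is a unit, so x - a divides y - b in the coordinate ring.\<close>
    define w where "w = (ff_poly (t - u * lin) - ff_poly u * \<eta>) * ff_const (inverse k)"
    have zw: "z * w = 1"
      unfolding w_def tu mult.assoc[symmetric] nrm_conj k using \<open>k \<noteq> 0\<close>
      by (simp add: ff_const_eq one_pCons flip: ff_poly_mult ff_poly_1)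
    have "w * z' \<in> coord_ring" unfolding w_def by (intro coord_ring_intros z')
    then obtain p q where pq: "w * z' = ff_poly p + ff_poly q * \<eta>" by (rule coord_ring_cases)
    have "\<eta> - ff_const b = (c * z) * (w * z')" using zw z' by (simp add: algebra_simps)
    also have "\<dots> = (ff_poly ?X + ff_poly 0 * \<eta>) * (ff_poly p + ff_poly q * \<eta>)"
      unfolding z(2)[symmetric] pq X ..
    finally have "1 = ?X * q" unfolding Y ff_linear_mult ff_linear_eq_iff by simp
    then have "poly 1 a = poly (?X * q) a" by (rule arg_cong)
    then show False by simp
  qed
qed

end

subsection \<open>Sums of points and products of ideals\<close>

locale smooth_weierstrass = weierstrass_field W for W :: "'b::field weierstrass" +
  assumes smooth: "on_weierstrass W x y \<Longrightarrow>
        wa1 W * y - 3 * x^2 - 2 * wa2 W * x - wa4 W \<noteq> 0 \<or> 2 * y + wa1 W * x + wa3 W \<noteq> 0"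
begin

lemma span_scale_rule:
  "r \<in> coord_ring \<Longrightarrow> z \<in> coord.span G \<Longrightarrow> r * z \<in> coord.span G"
  "r \<in> coord_ring \<Longrightarrow> z \<in> coord.span G \<Longrightarrow> z * r \<in> coord.span G"
  using span_coord_scale by (simp_all add: mult.commute)

lemma const_scaleD:
  assumes "ff_const k * z \<in> coord.span G" "k \<noteq> 0"
  shows "z \<in> coord.span G"
proof -
  have "ff_const (inverse k) * (ff_const k * z) \<in> coord.span G"
    by (intro span_scale_rule coord_ring_const assms)
  moreover have "ff_const (inverse k) * (ff_const k * z) = z"
    using assms(2) by (simp add: ff_const.hom_inverse ff_const.hom_eq_0_iff)
  ultimately show ?thesis by simp
qed

lemma unit_constI: "ff_const k \<in> coord.span G \<Longrightarrow> k \<noteq> 0 \<Longrightarrow> 1 \<in> coord.span G"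
  by (rule const_scaleD[of k]) simp_all

text \<open>
  The product of the two ideals is $x - a$ times the ideal generated by $x - a$, $y - b$, $y - b'$ and
  $T = (y - b)(y - b') / (x - a)$. This last ideal is trivial: if $b \neq b'$ it contains $b' - b$, and
  otherwise $T$ is congruent modulo $x - a$ and $y - b$ to a constant, up to sign the partial derivative of the
  equation in $x$ at $(a, b)$. It is not zero by smoothness, as the partial derivative in $y$ is zero for $b = b'$.
\<close>

lemma point_ideal_opposite:
  assumes P: "on_weierstrass W a b" and s: "b + b' + wa1 W * a + wa3 W = 0"
  shows "same_class (prods (point_ideal (Affine a b)) (point_ideal (Affine a b'))) {1}"
proof -
  define U where "U = ff_x - ff_const a"
  define k :: "'b \<Rightarrow> 'b ff" where "k = ff_const"
  interpret k: field_embedding k unfolding k_def by unfold_locales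
  define T where "T = ff_x^2 + ff_x * k a + k a^2 + k (wa2 W) * (ff_x + k a) + k (wa4 W) - k (wa1 W) * \<eta>"
  have Uk: "U = ff_x - k a" by (simp add: U_def k_def)
  have U0: "U \<noteq> 0" unfolding U_def by (simp add: ff_x_eq ff_const_eq)
  have "b' = - b - wa1 W * a - wa3 W" using s by (simp add: algebra_simps eq_neg_iff_add_eq_0)
  then have sk: "k b' = - k b - k (wa1 W) * k a - k (wa3 W)"
    by (simp add: k.hom_diff k.hom_minus k.hom_mult)
  have "(\<eta> - k b) * (\<eta> - k b') = (\<eta>^2 + (k (wa1 W) * ff_x + k (wa3 W)) * \<eta>)
      - (k b^2 + k (wa1 W) * k a * k b + k (wa3 W) * k b) - k (wa1 W) * U * \<eta>"
    unfolding sk Uk by (simp add: algebra_simps power2_eq_square)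
  then have prod: "(\<eta> - k b) * (\<eta> - k b') = U * T"
    unfolding k_def y_relation on_weierstrass_ff_const[OF P] unfolding Uk T_def
    by (simp add: k_def algebra_simps power2_eq_square power3_eq_cube)
  have one: "1 \<in> coord.span {U, \<eta> - k b, \<eta> - k b', T}" (is "1 \<in> ?S")
  proof (cases "b = b'")
    case False
    have "k (b' - b) = (\<eta> - k b) - (\<eta> - k b')" by (simp add: k.hom_diff)
    also have "\<dots> \<in> ?S" by (intro coord.span_diff coord.span_base) auto
    finally show ?thesis unfolding k_def by (rule unit_constI) (use False in auto)
  next
    case True
    define D where "D = wa1 W * b - 3 * a^2 - 2 * wa2 W * a - wa4 W"
    have "2 * b + wa1 W * a + wa3 W = 0" using s True by simp
    then have D0: "D \<noteq> 0" using smooth[OF P] by (simp add: D_def)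
    have "k D = (ff_x + 2 * k a + k (wa2 W)) * U - k (wa1 W) * (\<eta> - k b) - T"
      unfolding D_def T_def Uk
      by (simp add: k.hom_diff k.hom_add k.hom_mult k.hom_power k.hom_numeral algebra_simps power2_eq_square)
    also have "\<dots> = ff_poly [:2 * a + wa2 W, 1:] * U - k (wa1 W) * (\<eta> - k b) - T"
    proof -
      have "ff_x + 2 * k a + k (wa2 W) = ff_poly [:2 * a + wa2 W, 1:]"
      proof -
        have "ff_poly [:2 * a + wa2 W, 1:] = ff_x + k (2 * a + wa2 W)"
          by (simp add: k_def ff_x_eq ff_const_eq flip: ff_poly_add)
        then show ?thesis by (simp add: k.hom_add k.hom_mult k.hom_numeral)
      qed
      then show ?thesis by simp
    qed
    also have "\<dots> \<in> ?S"
      unfolding k_def by (intro coord.span_diff span_scale_rule coord_ring_intros coord.span_base) auto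
    finally show ?thesis using D0 unfolding k_def by (rule unit_constI)
  qed
  have eq: "prods (point_ideal (Affine a b)) (point_ideal (Affine a b')) = (*) U ` {U, \<eta> - k b, \<eta> - k b', T}"
  proof -
    have "point_ideal (Affine a c) = {U, \<eta> - k c}" for c by (simp add: Uk k_def)
    then have "prods (point_ideal (Affine a b)) (point_ideal (Affine a b')) =
        {U * U, U * (\<eta> - k b'), (\<eta> - k b) * U, U * T}"
      unfolding prod[symmetric] by (simp only: prods_pair)
    also have "\<dots> = {U * U, U * (\<eta> - k b), U * (\<eta> - k b'), U * T}"
      unfolding mult.commute[of "\<eta> - k b" U] by blast
    finally show ?thesis by (simp only: image_insert image_empty)
  qed
  have S: "?S = coord.span {1}"
  proof (rule antisym)
    show "coord.span {1} \<subseteq> ?S" using one by (intro coord.span_minimal) auto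
    have "{U, \<eta> - k b, \<eta> - k b', T} \<subseteq> coord_ring"
      unfolding Uk T_def k_def power2_eq_square by (auto intro!: coord_ring_intros)
    also have "coord_ring = coord.span {1}" by (auto simp: coord.span_singleton coord_ring_def)
    finally show "?S \<subseteq> coord.span {1}" by (intro coord.span_minimal) auto
  qed
  have "coord.span (prods (point_ideal (Affine a b)) (point_ideal (Affine a b'))) = (*) U ` coord.span {1}"
    unfolding eq span_image_mult S ..
  then show ?thesis unfolding same_class_def using U0 by blast
qed

lemma nrm_line:
  "nrm [:- v, - l:] 1 = - ([:- x1, 1:] * [:- x2, 1:] * [:- x3, 1:]) \<Longrightarrow>
   (\<eta> - ff_const l * ff_x - ff_const v) *
   (\<eta> + ff_const (l + wa1 W) * ff_x + ff_const (v + wa3 W)) =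
   (ff_x - ff_const x1) * (ff_x - ff_const x2) * (ff_x - ff_const x3)"
proof -
  assume N: "nrm [:- v, - l:] 1 = - ([:- x1, 1:] * [:- x2, 1:] * [:- x3, 1:])"
  have e: "ff_x - ff_const c = ff_poly [:- c, 1:]" for c
    by (simp add: ff_x_eq ff_const_eq flip: ff_poly_diff)
  have l1: "\<eta> - ff_const l * ff_x - ff_const v = ff_poly [:- v, - l:] + ff_poly 1 * \<eta>"
  proof -
    have "ff_poly [:- v, - l:] = - ff_const l * ff_x - ff_const v"
      by (simp add: ff_x_eq ff_const_eq flip: ff_poly_diff ff_poly_mult ff_poly_minus)
    then show ?thesis by simp
  qed
  have l2: "\<eta> + ff_const (l + wa1 W) * ff_x + ff_const (v + wa3 W) =
      - (ff_poly ([:- v, - l:] - 1 * lin) - ff_poly 1 * \<eta>)"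
  proof -
    have "ff_poly ([:- v, - l:] - 1 * lin) = - (ff_const (l + wa1 W) * ff_x + ff_const (v + wa3 W))"
      by (simp add: ff_x_eq ff_const_eq lin_def flip: ff_poly_add ff_poly_mult ff_poly_minus)
    then show ?thesis by simp
  qed
  show ?thesis
    unfolding e l1 l2 mult_minus_right nrm_conj N by (simp only: ff_poly_minus ff_poly_mult minus_minus)
qed

text \<open>
  Let $L = y - l x - v$. Both ideals are of the form $(x - x_i, L)$, and their product is
  $((x - x_1)(x - x_2), L)$: this is clear for $x_1 \neq x_2$, and for a tangent it follows from the norm equation
  of $L$, in which the coefficient of $L$ does not vanish at $x_1$. By the norm equation again,
  $x - x_3$ times this ideal is $L$ times the ideal generated by $x - x_3$ and the conjugate of $L$, which is the
  ideal of the reflected third point.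
\<close>

lemma point_ideal_line:
  assumes N: "nrm [:- v, - l:] 1 = - ([:- x1, 1:] * [:- x2, 1:] * [:- x3, 1:])"
    and y: "y1 = l * x1 + v" "y2 = l * x2 + v"
    and nondeg: "x1 \<noteq> x2 \<or> 2 * y1 + wa1 W * x1 + wa3 W \<noteq> 0"
  shows "same_class (prods (point_ideal (Affine x1 y1)) (point_ideal (Affine x2 y2)))
           (point_ideal (Affine x3 (- (l + wa1 W) * x3 - v - wa3 W)))"
proof -
  define y3 where "y3 = - (l + wa1 W) * x3 - v - wa3 W"
  define k :: "'b \<Rightarrow> 'b ff" where "k = ff_const"
  interpret k: field_embedding k unfolding k_def by unfold_locales
  define L where "L = \<eta> - k l * ff_x - k v"
  define L' where "L' = \<eta> + k (l + wa1 W) * ff_x + k (v + wa3 W)"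
  have X0: "ff_x - k c \<noteq> 0" for c unfolding k_def by (simp add: ff_x_eq ff_const_eq)
  have L0: "L \<noteq> 0"
  proof -
    have "L = ff_poly [:- v, - l:] + ff_poly 1 * \<eta>"
    proof -
      have "ff_poly [:- v, - l:] = - k l * ff_x - k v"
        by (simp add: k_def ff_x_eq ff_const_eq flip: ff_poly_diff ff_poly_mult ff_poly_minus)
      then show ?thesis by (simp add: L_def)
    qed
    then show ?thesis using ff_linear_eq_0_iff[of "[:- v, - l:]" 1] by simp
  qed
  have LL': "L * L' = (ff_x - k x1) * (ff_x - k x2) * (ff_x - k x3)"
    unfolding L_def L'_def k_def by (rule nrm_line[OF N])
  have gen: "coord.span (point_ideal (Affine c (l * c + v))) = coord.span {ff_x - k c, L}" for c
  proof (rule coord_span_eqI)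
    have "\<eta> - k (l * c + v) = L + k l * (ff_x - k c)" 
      by (simp add: L_def k.hom_add k.hom_mult algebra_simps)
    also have "\<dots> \<in> coord.span {ff_x - k c, L}"
      unfolding k_def by (intro coord.span_add span_scale_rule coord_ring_intros coord.span_base) auto
    finally show "point_ideal (Affine c (l * c + v)) \<subseteq> coord.span {ff_x - k c, L}"
      by (auto simp: k_def[symmetric] intro: coord.span_base)
    have "L = (\<eta> - k (l * c + v)) - k l * (ff_x - k c)" 
      by (simp add: L_def k.hom_add k.hom_mult algebra_simps)
    also have "\<dots> \<in> coord.span (point_ideal (Affine c (l * c + v)))"
      unfolding k_def by (intro coord.span_diff span_scale_rule coord_ring_intros coord.span_base) auto
    finally show "{ff_x - k c, L} \<subseteq> coord.span (point_ideal (Affine c (l * c + v)))"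
      by (auto simp: k_def intro: coord.span_base)
  qed
  define X1 X2 X3 where "X1 = ff_x - k x1" and "X2 = ff_x - k x2" and "X3 = ff_x - k x3"
  have ring: "X1 \<in> coord_ring" "X2 \<in> coord_ring" "X3 \<in> coord_ring" "L \<in> coord_ring" "L' \<in> coord_ring"
    unfolding X1_def X2_def X3_def L_def L'_def k_def by (intro coord_ring_intros)+
  have b: "coord.span (prods {X1, L} {X2, L}) = coord.span {X1 * X2, L}"
  proof (rule coord_span_eqI)
    have *: "coord.span {X1 * X2, L} \<supseteq> {X1 * X2, L}" by (rule coord.span_superset)
    then show "prods {X1, L} {X2, L} \<subseteq> coord.span {X1 * X2, L}"
      using ring by (simp add: prods_pair span_scale_rule)
    let ?S = "coord.span (prods {X1, L} {X2, L})"
    have mem: "X1 * X2 \<in> ?S" "X1 * L \<in> ?S" "L * X2 \<in> ?S" "L * L \<in> ?S"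
      by (auto simp: prods_pair intro: coord.span_base)
    have "L \<in> ?S"
    proof (cases "x1 = x2")
      case False
      have "k (x2 - x1) * L = X1 * L - L * X2" by (simp add: X1_def X2_def k.hom_diff algebra_simps)
      also have "\<dots> \<in> ?S" using mem by (intro coord.span_diff)
      finally show ?thesis unfolding k_def by (rule const_scaleD) (use False in auto)
    next
      case True
      have "k (2 * y1 + wa1 W * x1 + wa3 W) * L =
          L * L' - L * L - k (2 * l + wa1 W) * (X1 * L)"
        unfolding L'_def L_def X1_def y
        by (simp add: k.hom_add k.hom_mult k.hom_numeral algebra_simps power2_eq_square)
      also have "L * L' = (X1 * X2) * X3" unfolding LL' by (simp add: X1_def X2_def X3_def)
      also have "(X1 * X2) * X3 - L * L - k (2 * l + wa1 W) * (X1 * L) \<in> ?S"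
        unfolding k_def
        by (intro coord.span_diff span_scale_rule(2)[OF ring(3) mem(1)] mem(4)
            span_scale_rule(1)[OF coord_ring_const mem(2)])
      finally show ?thesis unfolding k_def by (rule const_scaleD) (use nondeg True in auto)
    qed
    then show "{X1 * X2, L} \<subseteq> ?S" using mem by auto
  qed
  have d: "coord.span {L', X3} = coord.span (point_ideal (Affine x3 y3))"
  proof (rule coord_span_eqI)
    have "L' = (\<eta> - k y3) + k (l + wa1 W) * X3"
      by (simp add: L'_def y3_def X3_def k.hom_add k.hom_diff k.hom_minus k.hom_mult algebra_simps)
    also have "\<dots> \<in> coord.span (point_ideal (Affine x3 y3))"
      unfolding k_def X3_def by (intro coord.span_add span_scale_rule coord_ring_intros coord.span_base) auto
    finally show "{L', X3} \<subseteq> coord.span (point_ideal (Affine x3 y3))"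
      by (auto simp: k_def X3_def intro: coord.span_base)
    have "\<eta> - k y3 = L' - k (l + wa1 W) * X3"
      by (simp add: L'_def y3_def X3_def k.hom_add k.hom_diff k.hom_minus k.hom_mult algebra_simps)
    also have "\<dots> \<in> coord.span {L', X3}"
      unfolding k_def by (intro coord.span_diff span_scale_rule coord_ring_intros coord.span_base) auto
    finally show "point_ideal (Affine x3 y3) \<subseteq> coord.span {L', X3}"
      by (auto simp: k_def[symmetric] X3_def[symmetric] intro: coord.span_base)
  qed
  have "coord.span (prods (point_ideal (Affine x1 y1)) (point_ideal (Affine x2 y2)))
      = coord.span (prods {X1, L} {X2, L})"
    by (subst (1 2) span_prods[symmetric]) (simp only: y gen X1_def X2_def)
  then have c: "coord.span (prods (point_ideal (Affine x1 y1)) (point_ideal (Affine x2 y2)))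
      = coord.span {X1 * X2, L}" unfolding b .
  have "(*) X3 ` {X1 * X2, L} = (*) L ` {L', X3}"
    using LL' by (auto simp: X1_def X2_def X3_def mult.commute)
  then have "(*) X3 ` coord.span {X1 * X2, L} = (*) L ` coord.span {L', X3}"
    unfolding span_image_mult[symmetric] by (rule arg_cong)
  then have "(*) (inverse X3) ` (*) X3 ` coord.span {X1 * X2, L} = (*) (inverse X3) ` (*) L ` coord.span {L', X3}"
    by simp
  then have "coord.span {X1 * X2, L} = (*) (inverse X3 * L) ` coord.span {L', X3}"
    using X0 by (simp add: image_image mult.assoc[symmetric] X3_def)
  then show ?thesis
    unfolding same_class_def c d y3_def[symmetric] using L0 X0
    by (intro exI[of _ "inverse X3 * L"]) (simp add: X3_def)
qed


text \<open>
  The norm of $y - l x - v$ is, up to sign, the cubic polynomial for the abscissas of the points on the line $y = l x + v$.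
  It is determined by its two highest coefficients and by its zeros at the two given points, or by a double
  zero in the case of a tangent.
\<close>

lemma nrm_chord:
  assumes P: "on_weierstrass W x1 y1" and Q: "on_weierstrass W x2 y2"
    and nopp: "\<not> (x1 = x2 \<and> y1 + y2 + wa1 W * x2 + wa3 W = 0)"
    and l: "l = (if x1 = x2
                then (3 * x1^2 + 2 * wa2 W * x1 + wa4 W - wa1 W * y1) / (2 * y1 + wa1 W * x1 + wa3 W)
                else (y2 - y1) / (x2 - x1))"
    and v: "v = y1 - l * x1"
    and x3: "x3 = l^2 + wa1 W * l - wa2 W - x1 - x2"
  shows "nrm [:- v, - l:] 1 = - ([:- x1, 1:] * [:- x2, 1:] * [:- x3, 1:])"
    and "y1 = l * x1 + v" and "y2 = l * x2 + v"
    and "x1 \<noteq> x2 \<or> 2 * y1 + wa1 W * x1 + wa3 W \<noteq> 0"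
proof -
  have eqy: "y1 = y2" if "x1 = x2"
  proof -
    have "(y1 - y2) * (y1 + y2 + wa1 W * x2 + wa3 W) = 0"
      using P Q that unfolding on_weierstrass_def by (simp add: algebra_simps power2_eq_square)
    then show ?thesis using nopp that by auto
  qed
  show y1: "y1 = l * x1 + v" by (simp add: v)
  show y2: "y2 = l * x2 + v"
  proof (cases "x1 = x2")
    case True
    then show ?thesis using eqy y1 by simp
  next
    case False
    then have "l * (x2 - x1) = y2 - y1" by (simp add: l)
    then show ?thesis by (simp add: v algebra_simps)
  qed
  show nondeg: "x1 \<noteq> x2 \<or> 2 * y1 + wa1 W * x1 + wa3 W \<noteq> 0"
    using nopp eqy by (auto simp: algebra_simps)
  \<comment> \<open>The difference of the two sides is linear in x; it vanishes at both points, to second order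
    if they coincide.\<close>
  define c1 where "c1 = 2 * v * l + v * wa1 W + l * wa3 W - wa4 W + (x1 * x2 + x1 * x3 + x2 * x3)"
  define c0 where "c0 = v^2 + v * wa3 W - wa6 W - x1 * x2 * x3"
  have e1: "c1 * x1 + c0 = 0"
    using P unfolding on_weierstrass_def c1_def c0_def x3 y1
    by (simp add: algebra_simps power2_eq_square power3_eq_cube)
  have e2: "c1 * x2 + c0 = 0"
    using Q unfolding on_weierstrass_def c1_def c0_def x3 y2
    by (simp add: algebra_simps power2_eq_square power3_eq_cube)
  have c1: "c1 = 0"
  proof (cases "x1 = x2")
    case False
    have "c1 * (x1 - x2) = (c1 * x1 + c0) - (c1 * x2 + c0)" by (simp add: algebra_simps)
    also have "\<dots> = 0" unfolding e1 e2 by simp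
    finally have "c1 * (x1 - x2) = 0" .
    then show ?thesis using False by simp
  next
    case True
    then have "l * (2 * y1 + wa1 W * x1 + wa3 W) = 3 * x1^2 + 2 * wa2 W * x1 + wa4 W - wa1 W * y1"
      using nondeg by (simp add: l)
    then show ?thesis
      unfolding c1_def x3 y1 using True by (simp add: algebra_simps power2_eq_square)
  qed
  then have c0: "c0 = 0" using e1 by simp
  have n: "nrm [:- v, - l:] 1 = [:v^2 + v * wa3 W - wa6 W, 2 * v * l + v * wa1 W + l * wa3 W - wa4 W,
       l^2 + l * wa1 W - wa2 W, - 1:]"
    by (simp add: nrm_def lin_def cub_def power2_eq_square)
  have "v^2 + v * wa3 W - wa6 W = x1 * x2 * x3" using c0 by (simp add: c0_def)
  moreover have "2 * v * l + v * wa1 W + l * wa3 W - wa4 W = - (x1 * x2 + x1 * x3 + x2 * x3)"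
    using c1 unfolding c1_def eq_neg_iff_add_eq_0 .
  moreover have "l^2 + l * wa1 W - wa2 W = x1 + x2 + x3" by (simp add: x3)
  ultimately show "nrm [:- v, - l:] 1 = - ([:- x1, 1:] * [:- x2, 1:] * [:- x3, 1:])"
    unfolding n by (simp add: algebra_simps)
qed

lemma on_weierstrass_third_point:
  assumes N: "nrm [:- v, - l:] 1 = - ([:- x1, 1:] * [:- x2, 1:] * [:- x3, 1:])"
  shows "on_weierstrass W x3 (- (l + wa1 W) * x3 - v - wa3 W)"
proof -
  have "poly (nrm [:- v, - l:] 1) x3 = 0" unfolding N by (simp add: algebra_simps)
  then show ?thesis
    by (simp add: nrm_def lin_def cub_def on_weierstrass_def algebra_simps power2_eq_square power3_eq_cube)
qed

lemma ec_add_class: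
  assumes "P \<in> curve_points W" "Q \<in> curve_points W"
  shows "ec_add W P Q \<in> curve_points W \<and>
    same_class (prods (point_ideal P) (point_ideal Q)) (point_ideal (ec_add W P Q))"
proof (cases P)
  case Infinity
  then show ?thesis using assms by (simp add: prods_one same_class_refl)
next
  case P: (Affine x1 y1)
  show ?thesis
  proof (cases Q)
    case Infinity
    then show ?thesis using assms P by (simp add: prods_one prods_commute[of _ "{1}"] same_class_refl)
  next
    case Q: (Affine x2 y2)
    have on: "on_weierstrass W x1 y1" "on_weierstrass W x2 y2"
      using assms P Q by (auto simp: curve_points_def)
    show ?thesis
    proof (cases "x1 = x2 \<and> y1 + y2 + wa1 W * x2 + wa3 W = 0")
      case True
      then have e: "ec_add W P Q = Infinity" by (simp add: P Q)
      have "same_class (prods (point_ideal (Affine x1 y1)) (point_ideal (Affine x1 y2))) {1}"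
        using True by (intro point_ideal_opposite on) auto
      then show ?thesis using True e unfolding P Q by (simp add: curve_points_def)
    next
      case False
      define l where "l = (if x1 = x2
                then (3 * x1^2 + 2 * wa2 W * x1 + wa4 W - wa1 W * y1) / (2 * y1 + wa1 W * x1 + wa3 W)
                else (y2 - y1) / (x2 - x1))"
      define v where "v = y1 - l * x1"
      define x3 where "x3 = l^2 + wa1 W * l - wa2 W - x1 - x2"
      note ch = nrm_chord[OF on False l_def v_def x3_def]
      have e: "ec_add W P Q = Affine x3 (- (l + wa1 W) * x3 - v - wa3 W)"
        by (simp only: P Q ec_add.simps if_not_P[OF False] Let_def x3_def v_def l_def)
      show ?thesis
        unfolding e using point_ideal_line[OF ch] on_weierstrass_third_point[OF ch(1)]
        by (simp add: P Q curve_points_def)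
    qed
  qed
qed

lemmas ec_add_closed = ec_add_class[THEN conjunct1]
  and same_class_ec_add = ec_add_class[THEN conjunct2]

fun ec_neg :: "'b ec_point \<Rightarrow> 'b ec_point" where
  "ec_neg Infinity = Infinity"
| "ec_neg (Affine x y) = Affine x (- y - wa1 W * x - wa3 W)"

lemma on_weierstrass_neg:
  "on_weierstrass W x y \<Longrightarrow> on_weierstrass W x (- y - wa1 W * x - wa3 W)"
  by (simp add: on_weierstrass_def algebra_simps power2_eq_square)

lemma ec_neg_closed: "P \<in> curve_points W \<Longrightarrow> ec_neg P \<in> curve_points W"
  by (cases P) (auto simp: curve_points_def intro: on_weierstrass_neg)

lemma ec_add_neg: "ec_add W P (ec_neg P) = Infinity"
  by (cases P) simp_all

lemma ec_add_neg_eq_InfinityD: "ec_add W P (ec_neg Q) = Infinity \<Longrightarrow> P = Q"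
  by (cases P; cases Q) (auto simp: Let_def split: if_splits)

text \<open>
  After multiplication by the ideal of the point opposite to \<open>Q\<close>, one of the two ideals is principal.
\<close>

lemma same_class_point_idealD:
  assumes "P \<in> curve_points W" "Q \<in> curve_points W" "same_class (point_ideal P) (point_ideal Q)"
  shows "P = Q"
proof -
  let ?R = "ec_add W P (ec_neg Q)"
  have "same_class (prods (point_ideal P) (point_ideal (ec_neg Q)))
     (prods (point_ideal Q) (point_ideal (ec_neg Q)))"
    by (intro same_class_prods assms same_class_refl)
  then have "same_class (point_ideal ?R) (point_ideal (ec_add W Q (ec_neg Q)))"
    using same_class_ec_add assms ec_neg_closed same_class_trans same_class_sym by metis
  then have "same_class (point_ideal ?R) {1}" by (simp add: ec_add_neg)
  moreover have "?R \<in> curve_points W" by (intro ec_add_closed assms ec_neg_closed)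
  ultimately have "?R = Infinity"
    using nonprincipal_point_ideal by (cases ?R) (auto simp: curve_points_def simp del: point_ideal.simps)
  then show ?thesis by (rule ec_add_neg_eq_InfinityD)
qed

lemma ec_add_commute:
  assumes "P \<in> curve_points W" "Q \<in> curve_points W"
  shows "ec_add W P Q = ec_add W Q P"
proof (intro same_class_point_idealD ec_add_closed assms)
  show "same_class (point_ideal (ec_add W P Q)) (point_ideal (ec_add W Q P))"
    using same_class_ec_add[OF assms] same_class_ec_add[OF assms(2,1)]
    by (metis prods_commute same_class_sym same_class_trans)
qed

lemma ec_add_assoc:
  assumes "P \<in> curve_points W" "Q \<in> curve_points W" "R \<in> curve_points W"
  shows "ec_add W (ec_add W P Q) R = ec_add W P (ec_add W Q R)"
proof (intro same_class_point_idealD ec_add_closed assms)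
  let ?p = point_ideal
  have "same_class (?p (ec_add W (ec_add W P Q) R)) (prods (?p (ec_add W P Q)) (?p R))"
    by (intro same_class_sym[OF same_class_ec_add] ec_add_closed assms)
  moreover have "same_class (prods (?p (ec_add W P Q)) (?p R)) (prods (prods (?p P) (?p Q)) (?p R))"
    by (intro same_class_prods same_class_refl same_class_sym[OF same_class_ec_add] assms)
  moreover have "same_class (prods (?p P) (prods (?p Q) (?p R))) (prods (?p P) (?p (ec_add W Q R)))"
    by (intro same_class_prods same_class_refl same_class_ec_add assms)
  moreover have "same_class (prods (?p P) (?p (ec_add W Q R))) (?p (ec_add W P (ec_add W Q R)))"
    by (intro same_class_ec_add ec_add_closed assms)
  ultimately show "same_class (?p (ec_add W (ec_add W P Q) R)) (?p (ec_add W P (ec_add W Q R)))"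
    unfolding prods_assoc by (meson same_class_trans)
qed

lemma comm_group_curve_points:
  "comm_group \<lparr>carrier = curve_points W, monoid.mult = ec_add W, one = Infinity\<rparr>"
proof (rule comm_groupI, simp_all)
  show "Infinity \<in> curve_points W" by (simp add: curve_points_def)
  show "\<exists>Q\<in>curve_points W. ec_add W Q P = Infinity" if "P \<in> curve_points W" for P
    using that ec_neg_closed ec_add_neg ec_add_commute by metis
qed (fact ec_add_closed ec_add_assoc ec_add_commute)+

end

lemma smooth_weierstrass_base_change:
  "elliptic_curve E \<Longrightarrow> smooth_weierstrass (base_change E)"
  unfolding elliptic_curve_def smooth_weierstrass_def by (simp add: Let_def)

lemma comm_group_ec_group: "elliptic_curve E \<Longrightarrow> comm_group (ec_group E)"
  unfolding ec_group_def
  by (rule smooth_weierstrass.comm_group_curve_points) (rule smooth_weierstrass_base_change)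

section \<open>Bezout coefficients and lowest terms\<close>

text \<open>
  Coprimality is used in this form because Bezout coefficients keep their meaning over an extension field.
\<close>

definition bezout :: "'a::field poly \<Rightarrow> 'a poly \<Rightarrow> bool" where
  "bezout p q \<longleftrightarrow> (\<exists>u v. u * p + v * q = 1)"

lemma bezout_sym: "bezout p q \<Longrightarrow> bezout q p"
  unfolding bezout_def by (metis add.commute)

lemma coprime_iff_bezout: "coprime p q \<longleftrightarrow> bezout p (q :: 'a::field poly)"
proof
  assume co: "coprime p q"
  define I where "I = {u * p + v * q | u v. u * p + v * q \<noteq> 0}"
  have "p \<noteq> 0 \<or> q \<noteq> 0" using co by auto
  moreover have mem: "x \<in> I" if "x \<noteq> 0" "x = u * p + v * q" for x u v
    using that unfolding I_def by blast
  from mem[of p 1 0] mem[of q 0 1] calculation have "\<exists>x. x \<in> I" by auto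
  then obtain d where d: "d \<in> I" and min: "\<And>e. e \<in> I \<Longrightarrow> degree d \<le> degree e"
    using ex_has_least_nat[of "\<lambda>d. d \<in> I" _ degree] by blast
  then obtain u v where uv: "d = u * p + v * q" and d0: "d \<noteq> 0" unfolding I_def by auto
  \<comment> \<open>A combination of least degree divides both, as remainders are combinations.\<close>
  have "d dvd s * p + t * q" for s t
  proof (rule ccontr)
    assume "\<not> d dvd s * p + t * q"
    then have r0: "(s * p + t * q) mod d \<noteq> 0" by (simp add: dvd_eq_mod_eq_0)
    define c where "c = (s * p + t * q) div d"
    have "(s * p + t * q) mod d = (s * p + t * q) - c * d"
      unfolding c_def by (rule minus_div_mult_eq_mod[symmetric])
    also have "\<dots> = (s - c * u) * p + (t - c * v) * q" by (simp add: uv algebra_simps)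
    finally have "(s * p + t * q) mod d \<in> I" using r0 unfolding I_def by auto
    from min[OF this] show False using degree_mod_less[OF d0, of "s * p + t * q"] r0 by simp
  qed
  from this[of 1 0] this[of 0 1] have "d dvd p" "d dvd q" by simp_all
  then have "is_unit d" using co by (simp add: coprime_def)
  then obtain e where "d * e = 1" by (metis dvdE)
  then have "(e * u) * p + (e * v) * q = 1" by (simp add: uv algebra_simps)
  then show "bezout p q" unfolding bezout_def by blast
next
  assume "bezout p q"
  then obtain u v where "u * p + v * q = 1" unfolding bezout_def by blast
  then show "coprime p q" by (metis coprimeI dvd_add dvd_mult)
qed

lemma bezout_dvd: "bezout p q \<Longrightarrow> p dvd q * r \<Longrightarrow> p dvd r"
proof -
  assume "bezout p q" "p dvd q * r"
  then obtain u v where "u * p + v * q = 1" unfolding bezout_def by blast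
  then have "r = (u * p + v * q) * r" by simp
  also have "\<dots> = (u * r) * p + v * (q * r)" by (simp add: algebra_simps)
  also have "p dvd \<dots>" using \<open>p dvd q * r\<close> by (simp add: dvd_add)
  finally show ?thesis .
qed

lemma bezout_mult: "bezout p q \<Longrightarrow> bezout p r \<Longrightarrow> bezout p (q * r)"
proof -
  assume "bezout p q" "bezout p r"
  then obtain u v u' v' where 1: "u * p + v * q = 1" and 2: "u' * p + v' * r = 1"
    unfolding bezout_def by blast
  have "(u * (u' * p + v' * r) + u' * v * q) * p + (v * v') * (q * r)
      = (u * p + v * q) * (u' * p + v' * r)"
    by (simp add: algebra_simps)
  then show ?thesis unfolding 1 2 bezout_def by (metis mult_1)
qed

lemma bezout_power: "bezout p q \<Longrightarrow> bezout p (q ^ n)"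
proof (induction n)
  case 0
  have "0 * p + 1 * q ^ 0 = 1" by simp
  then show ?case unfolding bezout_def by blast
qed (simp add: bezout_mult)

lemma bezout_add_mult: "bezout p q \<Longrightarrow> bezout p (q + c * p)"
  unfolding bezout_def
proof safe
  fix u v assume "u * p + v * q = 1"
  then have "(u - v * c) * p + v * (q + c * p) = 1" by (simp add: algebra_simps)
  then show "\<exists>u v. u * p + v * (q + c * p) = 1" by blast
qed

lemma bezout_smult: "bezout p q \<Longrightarrow> c \<noteq> 0 \<Longrightarrow> bezout p (smult c q)"
  unfolding bezout_def
proof safe
  fix u v assume "u * p + v * q = 1" "c \<noteq> 0"
  then have "u * p + smult (inverse c) v * smult c q = 1" by simp
  then show "\<exists>u v. u * p + v * smult c q = 1" by blast
qed

lemma monic_dvd_antisym: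
  fixes p q :: "'a::field poly"
  assumes "p dvd q" "q dvd p" "lead_coeff p = 1" "lead_coeff q = 1"
  shows "p = q"
proof -
  have nz: "p \<noteq> 0" "q \<noteq> 0" using assms by auto
  obtain k where k: "q = p * k" using assms(1) by (rule dvdE)
  then have "k \<noteq> 0" using nz by auto
  then have "degree k = 0"
    using dvd_imp_degree_le[OF assms(2)] nz k by (simp add: degree_mult_eq)
  then obtain c where c: "k = [:c:]" by (rule degree_eq_zeroE)
  have "lead_coeff q = lead_coeff p * lead_coeff k" unfolding k by (rule lead_coeff_mult)
  then have "c = 1" unfolding assms(3,4) c by simp
  then show ?thesis unfolding k c by simp
qed

lemma lowest_terms_Fract:
  fixes p q :: "'a::field poly"
  assumes "bezout p q" and "lead_coeff q = 1"
  shows "lowest_terms (Fract p q) = (p, q)"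
  unfolding lowest_terms_def
proof (rule the_equality)
  show "Fract p q = Fract (fst (p, q)) (snd (p, q)) \<and> coprime (fst (p, q)) (snd (p, q))
    \<and> lead_coeff (snd (p, q)) = 1"
    using assms by (simp add: coprime_iff_bezout)
next
  fix pq :: "'a poly \<times> 'a poly"
  obtain r s where pq: "pq = (r, s)" by (cases pq)
  assume "Fract p q = Fract (fst pq) (snd pq) \<and> coprime (fst pq) (snd pq) \<and> lead_coeff (snd pq) = 1"
  then have rs: "Fract p q = Fract r s" "bezout r s" "lead_coeff s = 1"
    by (simp_all add: pq coprime_iff_bezout)
  have nz: "q \<noteq> 0" "s \<noteq> 0" using assms(2) rs(3) by auto
  have eq: "p * s = r * q" using rs(1) nz by (simp add: eq_fract)
  have "q dvd s" using bezout_dvd[OF bezout_sym[OF assms(1)]] eq by (metis dvd_triv_right)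
  moreover have "s dvd q" using bezout_dvd[OF bezout_sym[OF rs(2)]] eq by (metis dvd_triv_right)
  ultimately have "q = s"
    using assms(2) rs(3) monic_dvd_antisym by blast
  then show "pq = (p, q)" using eq nz pq by simp
qed

lemma Fract_lowest_terms:
  fixes S :: "'a::field poly fract"
  shows "S = Fract (numerator S) (denominator S)"
    and "bezout (numerator S) (denominator S)"
    and "lead_coeff (denominator S) = 1"
proof -
  obtain a b where ab: "S = Fract a b" "b \<noteq> 0" by (cases S) auto
  then have "\<exists>q. q \<noteq> 0 \<and> (\<exists>p. S = Fract p q)" by blast
  then obtain q where q: "q \<noteq> 0" "\<exists>p. S = Fract p q"
    and min: "\<And>r. r \<noteq> 0 \<Longrightarrow> \<exists>p. S = Fract p r \<Longrightarrow> degree q \<le> degree r"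
    using ex_has_least_nat[of "\<lambda>q. q \<noteq> 0 \<and> (\<exists>p. S = Fract p q)" _ degree] by blast
  then obtain p where p: "S = Fract p q" by blast
  \<comment> \<open>A denominator of least degree has no common factor with its numerator.\<close>
  have "coprime p q"
  proof (rule coprimeI)
    fix d assume "d dvd p" "d dvd q"
    then obtain p' q' where pq': "p = d * p'" "q = d * q'" by (auto elim!: dvdE)
    then have nz: "d \<noteq> 0" "q' \<noteq> 0" using q by auto
    have "S = Fract p' q'" unfolding p pq' using nz by (simp add: eq_fract)
    then have "degree q \<le> degree q'" using min nz by blast
    then have "degree d = 0" unfolding pq'(2) using nz by (simp add: degree_mult_eq)
    then show "is_unit d" using nz by (simp add: is_unit_iff_degree)
  qed
  define c where "c = inverse (lead_coeff q)"
  have c: "c \<noteq> 0" using q by (simp add: c_def)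
  have "lowest_terms (Fract (smult c p) (smult c q)) = (smult c p, smult c q)"
  proof (rule lowest_terms_Fract)
    show "bezout (smult c p) (smult c q)"
      using \<open>coprime p q\<close> c by (metis bezout_smult bezout_sym coprime_iff_bezout)
    show "lead_coeff (smult c q) = 1" using q by (simp add: c_def)
  qed
  moreover have S: "S = Fract (smult c p) (smult c q)"
    unfolding p using c q by (simp add: eq_fract)
  ultimately have nd: "numerator S = smult c p" "denominator S = smult c q"
    by (simp_all add: numerator_def denominator_def)
  show "S = Fract (numerator S) (denominator S)" unfolding nd by (rule S)
  show "bezout (numerator S) (denominator S)" unfolding nd
    using \<open>coprime p q\<close> c by (metis bezout_smult bezout_sym coprime_iff_bezout)
  show "lead_coeff (denominator S) = 1" unfolding nd using q by (simp add: c_def)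
qed

section \<open>The transform of a polynomial by a rational fraction\<close>

lemma Fract_const_hom: "field_embedding (\<lambda>c :: 'a::field. Fract [:c:] 1)"
  by standard (simp_all add: One_fract_def one_pCons mult.commute)

lemma poly_map_Fract_const:
  fixes A B g :: "'a::field poly"
  assumes "B \<noteq> 0"
  shows "poly (map_poly (\<lambda>c. Fract [:c:] 1) g) (Fract A B) =
     Fract (\<Sum>i\<le>degree g. smult (coeff g i) (A ^ i * B ^ (degree g - i))) (B ^ degree g)"
proof -
  interpret field_embedding "\<lambda>c :: 'a. Fract [:c:] 1" by (rule Fract_const_hom)
  have pow: "Fract A B ^ i = Fract (A ^ i) (B ^ i)" for i
    by (induction i) (simp_all add: One_fract_def)
  have summand: "Fract [:c:] 1 * Fract (A ^ i) (B ^ i) = Fract (smult c (A ^ i * B ^ (n - i))) (B ^ n)"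
    if "i \<le> n" for c i n
  proof -
    have "B ^ n = B ^ i * B ^ (n - i)" using that by (simp flip: power_add)
    then show ?thesis using assms by (simp add: eq_fract mult_ac)
  qed
  have sumF: "(\<Sum>i\<in>I. Fract (F i) D) = Fract (sum F I) D" if "D \<noteq> 0" for I :: "nat set" and F and D :: "'a poly"
  proof (induction I rule: infinite_finite_induct)
    case (insert i I)
    then show ?case using that by (simp add: eq_fract algebra_simps)
  qed (use that in \<open>simp_all add: Zero_fract_def eq_fract\<close>)
  have "poly (map_poly (\<lambda>c. Fract [:c:] 1) g) (Fract A B) =
      (\<Sum>i\<le>degree g. Fract [:coeff g i:] 1 * Fract (A ^ i) (B ^ i))"
    by (simp add: poly_altdef degree_map_poly_hom coeff_map_poly fract_collapse pow del: mult_fract)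
  also have "\<dots> = (\<Sum>i\<le>degree g. Fract (smult (coeff g i) (A ^ i * B ^ (degree g - i))) (B ^ degree g))"
    by (rule sum.cong) (simp_all only: summand atMost_iff)
  also have "\<dots> = Fract (\<Sum>i\<le>degree g. smult (coeff g i) (A ^ i * B ^ (degree g - i))) (B ^ degree g)"
    using assms by (intro sumF) simp
  finally show ?thesis .
qed

text \<open>
  The fraction $g(A/B)$ equals $H / B^n$ with the homogenised sum $H$ and $n = \deg g$. Modulo $B$ only the leading term
  $c A^n$ of $H$ remains, so $H$ is prime to $B$ and the fraction is in lowest terms.
\<close>

lemma S_transform_eq:
  fixes S :: "'a::field poly fract" and g :: "'a poly"
  defines "A \<equiv> numerator S" and "B \<equiv> denominator S"
  shows "S_transform S g = (\<Sum>i\<le>degree g. smult (coeff g i) (A ^ i * B ^ (degree g - i)))"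
proof -
  let ?n = "degree g"
  let ?H = "\<Sum>i\<le>?n. smult (coeff g i) (A ^ i * B ^ (?n - i))"
  have AB: "S = Fract A B" "bezout A B" "lead_coeff B = 1"
    unfolding A_def B_def by (rule Fract_lowest_terms)+
  then have B0: "B \<noteq> 0" by auto
  have "bezout B ?H \<or> g = 0"
  proof (cases "g = 0")
    case False
    have "(\<Sum>i<?n. smult (coeff g i) (A ^ i * B ^ (?n - i))) =
       (\<Sum>i<?n. smult (coeff g i) (A ^ i * B ^ (?n - Suc i))) * B"
      unfolding sum_distrib_right
    proof (rule sum.cong)
      fix i assume "i \<in> {..<?n}"
      then have "?n - i = Suc (?n - Suc i)" by simp
      then show "smult (coeff g i) (A ^ i * B ^ (?n - i)) = smult (coeff g i) (A ^ i * B ^ (?n - Suc i)) * B"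
        by (simp add: mult_ac)
    qed simp
    then have "?H = smult (lead_coeff g) (A ^ ?n) + (\<Sum>i<?n. smult (coeff g i) (A ^ i * B ^ (?n - Suc i))) * B"
      by (simp add: lessThan_Suc_atMost[symmetric])
    then show ?thesis
      using False bezout_sym[OF AB(2)] by (simp only:) (intro disjI1 bezout_add_mult bezout_smult bezout_power; simp)
  qed simp
  then show ?thesis
  proof
    assume "bezout B ?H"
    have "S_transform S g = numerator (Fract ?H (B ^ ?n))"
      unfolding S_transform_def AB(1) using poly_map_Fract_const[OF B0] by simp
    also have "lowest_terms (Fract ?H (B ^ ?n)) = (?H, B ^ ?n)"
    proof (rule lowest_terms_Fract)
      show "bezout ?H (B ^ ?n)" by (rule bezout_power[OF bezout_sym]) fact
      show "lead_coeff (B ^ ?n) = 1" using AB(3) by (simp add: lead_coeff_power)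
    qed
    then have "numerator (Fract ?H (B ^ ?n)) = ?H" by (simp add: numerator_def)
    finally show ?thesis .
  next
    assume "g = 0"
    have "lowest_terms (Fract 0 1 :: 'a poly fract) = (0, 1)"
      by (rule lowest_terms_Fract) (simp_all add: bezout_def)
    then show ?thesis unfolding \<open>g = 0\<close> S_transform_def by (simp add: numerator_def Zero_fract_def)
  qed
qed

lemma degree_S_transform:
  fixes S :: "'a::field poly fract"
  assumes "degree (denominator S) < degree (numerator S)"
  shows "degree (S_transform S g) = degree (numerator S) * degree g"
proof (cases "g = 0")
  case False
  define A B where "A = numerator S" and "B = denominator S"
  have lt: "degree B < degree A" using assms by (simp add: A_def B_def)
  then have A0: "A \<noteq> 0" by auto
  have "B \<noteq> 0" using Fract_lowest_terms(3)[of S] by (auto simp: B_def)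
  let ?n = "degree g"
  have d: "degree (A ^ ?n) = degree A * ?n" using A0 by (simp add: degree_power_eq)
  have "degree (smult (coeff g i) (A ^ i * B ^ (?n - i))) < degree A * ?n" if "i < ?n" for i
  proof -
    have "degree (smult (coeff g i) (A ^ i * B ^ (?n - i))) \<le> i * degree A + (?n - i) * degree B"
      using A0 \<open>B \<noteq> 0\<close> by (intro order_trans[OF degree_smult_le]) (simp add: degree_mult_eq degree_power_eq)
    also have "\<dots> < i * degree A + (?n - i) * degree A" using lt that by simp
    also have "\<dots> = degree A * ?n" using that by (simp add: algebra_simps flip: distrib_left)
    finally show ?thesis .
  qed
  then have small: "?n = 0 \<or> degree (\<Sum>i<?n. smult (coeff g i) (A ^ i * B ^ (?n - i))) < degree A * ?n"
  proof (cases "?n = 0")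
    case False
    then have "0 < degree A * ?n" using lt by simp
    then show ?thesis using \<open>\<And>i. i < ?n \<Longrightarrow> _\<close> by (intro disjI2 degree_sum_less) auto
  qed simp
  have "S_transform S g = smult (lead_coeff g) (A ^ ?n) + (\<Sum>i<?n. smult (coeff g i) (A ^ i * B ^ (?n - i)))"
    unfolding S_transform_eq A_def[symmetric] B_def[symmetric] by (simp add: lessThan_Suc_atMost[symmetric])
  then show ?thesis
    using small d False by (auto simp: degree_add_eq_left A_def[symmetric])
qed (simp add: S_transform_eq)

lemma poly_S_transform:
  fixes S :: "'a::field poly fract" and r :: "'a alg_closure"
  assumes "fract_eval S (Some r) = Some s"
  shows "poly (map_poly to_ac (S_transform S g)) r =
    poly (map_poly to_ac (denominator S)) r ^ degree g * poly (map_poly to_ac g) s"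
proof -
  let ?a = "poly (map_poly to_ac (numerator S)) r" and ?b = "poly (map_poly to_ac (denominator S)) r"
  have b: "?b \<noteq> 0" and s: "s = ?a / ?b" using assms by (auto split: if_splits)
  have "poly (map_poly to_ac (S_transform S g)) r = (\<Sum>i\<le>degree g. to_ac (coeff g i) * (?a ^ i * ?b ^ (degree g - i)))"
    unfolding S_transform_eq
    by (simp add: to_ac.map_poly_sum to_ac.map_poly_smult' to_ac.map_poly_mult to_ac.map_poly_power poly_sum)
  also have "\<dots> = (\<Sum>i\<le>degree g. ?b ^ degree g * (to_ac (coeff g i) * s ^ i))"
  proof (rule sum.cong)
    fix i assume "i \<in> {..degree g}"
    then have "?b ^ degree g = ?b ^ i * ?b ^ (degree g - i)" by (simp flip: power_add)
    then show "to_ac (coeff g i) * (?a ^ i * ?b ^ (degree g - i)) = ?b ^ degree g * (to_ac (coeff g i) * s ^ i)"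
      using b by (simp add: s power_divide)
  qed simp
  also have "\<dots> = ?b ^ degree g * poly (map_poly to_ac g) s"
    by (simp add: poly_altdef sum_distrib_left to_ac.degree_map_poly_hom coeff_map_poly)
  finally show ?thesis .
qed

lemma pderiv_S_transform:
  fixes S :: "'a::field poly fract"
  assumes "pderiv (numerator S) = 0" "pderiv (denominator S) = 0"
  shows "pderiv (S_transform S g) = 0"
proof -
  have "pderiv (sum F I) = (\<Sum>i\<in>I. pderiv (F i))" for F :: "nat \<Rightarrow> 'a poly" and I
    by (induction I rule: infinite_finite_induct) (simp_all add: pderiv_add)
  then show ?thesis
    unfolding S_transform_eq by (simp add: pderiv_smult pderiv_mult pderiv_power assms)
qed

section \<open>The Frobenius automorphism\<close>

lemma finite_field_power_card:
  fixes c :: "'a::{field,finite}"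
  shows "c ^ card (UNIV :: 'a set) = c"
proof (cases "c = 0")
  case False
  let ?U = "UNIV - {0 :: 'a}"
  have bij: "bij_betw ((*) c) ?U ?U"
    using False by (intro bij_betwI[of _ _ _ "(*) (inverse c)"]) (auto simp: mult.assoc[symmetric])
  have "prod (\<lambda>x. x) ?U = prod (\<lambda>x. c * x) ?U"
    using prod.reindex_bij_betw[OF bij, of "\<lambda>x. x"] by simp
  also have "\<dots> = c ^ card ?U * prod (\<lambda>x. x) ?U" by (simp add: prod.distrib)
  finally have "c ^ card ?U = 1" by simp
  moreover have "card (UNIV :: 'a set) = Suc (card ?U)"
    by (rule card_Suc_Diff1[symmetric]) simp_all
  ultimately show ?thesis by (simp only: power_Suc mult_1_right)
qed (simp add: card_gt_0_iff)

lemma degree_one_power: "degree ([:1, 1:] ^ n :: 'a::field poly) = n"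
  by (simp add: degree_power_eq)

text \<open>
  The polynomial $(X+1)^q - X^q - 1$ has degree less than $q$ and vanishes on the field with $q$
  elements, so all its coefficients, the inner binomial coefficients, are zero.
\<close>

lemma card_choose_eq_0:
  assumes "0 < i" "i < card (UNIV :: 'a::{field,finite} set)"
  shows "of_nat (card (UNIV :: 'a set) choose i) = (0 :: 'a)"
proof -
  let ?q = "card (UNIV :: 'a set)"
  define p :: "'a poly" where "p = [:1, 1:] ^ ?q - monom 1 ?q - 1"
  have q: "?q > 0" by (simp add: card_gt_0_iff)
  have coeff: "coeff p j = of_nat (?q choose j) - (if j = ?q then 1 else 0) - (if j = 0 then 1 else 0)" for j
    by (cases "j \<le> ?q") (auto simp: p_def coeff_linear_poly_power binomial_eq_0 coeff_eq_0 degree_one_power coeff_1)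
  have "coeff p j = 0" if "j \<ge> ?q" for j
    using that q unfolding coeff by (cases "j = ?q") (auto simp: binomial_eq_0)
  then have deg: "p = 0 \<or> degree p < ?q"
    by (metis leading_coeff_0_iff not_le)
  have "p = 0"
  proof (rule ccontr)
    assume "p \<noteq> 0"
    have "poly p x = 0" for x
      by (simp add: p_def poly_monom poly_power finite_field_power_card)
    then have "{x. poly p x = 0} = UNIV" by auto
    then show False using card_poly_roots_bound[OF \<open>p \<noteq> 0\<close>] deg \<open>p \<noteq> 0\<close> by auto
  qed
  then show ?thesis using coeff[of i] assms by simp
qed

definition frob :: "'a::{field,finite} alg_closure \<Rightarrow> 'a alg_closure" where
  "frob x = x ^ card (UNIV :: 'a set)"

interpretation frob: field_embedding "frob :: 'a::{field,finite} alg_closure \<Rightarrow> 'a alg_closure"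
proof
  fix x y :: "'a alg_closure"
  let ?q = "card (UNIV :: 'a set)"
  have "frob (x + y) = (\<Sum>i\<le>?q. of_nat (?q choose i) * x ^ i * y ^ (?q - i))"
    unfolding frob_def by (rule binomial_ring)
  also have "\<dots> = (\<Sum>i\<in>{0, ?q}. of_nat (?q choose i) * x ^ i * y ^ (?q - i))"
  proof (rule sum.mono_neutral_right)
    show "\<forall>i\<in>{..?q} - {0, ?q}. of_nat (?q choose i) * x ^ i * y ^ (?q - i) = 0"
    proof
      fix i assume "i \<in> {..?q} - {0, ?q}"
      then have "of_nat (?q choose i) = (0 :: 'a)" by (intro card_choose_eq_0) auto
      then have "of_nat (?q choose i) = (0 :: 'a alg_closure)"
        by (metis to_ac_of_nat to_ac_0)
      then show "of_nat (?q choose i) * x ^ i * y ^ (?q - i) = 0" by simp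
    qed
  qed auto
  also have "\<dots> = frob x + frob y" by (simp add: frob_def add.commute)
  finally show "frob (x + y) = frob x + frob y" .
qed (simp_all add: frob_def power_mult_distrib)

lemma frob_to_ac [simp]: "frob (to_ac c) = to_ac c"
  by (simp add: frob_def finite_field_power_card flip: to_ac_power)

text \<open>
  The base field already supplies as many roots of $X^q - X$ as its degree allows.
\<close>

lemma frob_fixed_iff: "frob x = x \<longleftrightarrow> x \<in> range to_ac"
proof
  let ?q = "card (UNIV :: 'a set)"
  let ?p = "monom 1 ?q - [:0, 1:] :: 'a alg_closure poly"
  have "card {0 :: 'a, 1} \<le> ?q" by (rule card_mono) simp_all
  then have q: "?q > 1" by simp
  then have "coeff ?p ?q = 1" by (cases ?q) (auto simp: coeff_pCons split: nat.splits)
  then have p0: "?p \<noteq> 0" by (metis coeff_0 zero_neq_one)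
  have roots: "{x. poly ?p x = 0} = {x. frob x = x}" by (simp add: poly_monom frob_def)
  have "degree ?p \<le> ?q" using q by (intro degree_diff_le) (auto simp: degree_monom_eq Suc_le_eq)
  then have "card {x. frob (x :: 'a alg_closure) = x} \<le> ?q"
    using card_poly_roots_bound[OF p0] unfolding roots by linarith
  also have "?q = card (range to_ac :: 'a alg_closure set)"
    by (rule card_image[OF inj_to_ac, symmetric])
  finally have "card {x. frob (x :: 'a alg_closure) = x} \<le> card (range to_ac :: 'a alg_closure set)" .
  moreover have "finite {x. frob (x :: 'a alg_closure) = x}"
    using poly_roots_finite[OF p0] unfolding roots .
  ultimately have "range to_ac = {x. frob (x :: 'a alg_closure) = x}"
    by (intro card_seteq) auto
  then show "frob x = x \<Longrightarrow> x \<in> range to_ac" by blast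
qed auto

lemma frob_funpow_embedding:
  "field_embedding ((frob :: 'a::{field,finite} alg_closure \<Rightarrow> 'a alg_closure) ^^ n)"
proof (induction n)
  case 0
  show ?case by standard simp_all
next
  case (Suc n)
  then interpret f: field_embedding "(frob :: 'a alg_closure \<Rightarrow> 'a alg_closure) ^^ n" .
  show ?case
    by standard (simp_all add: f.hom_1 f.hom_add f.hom_mult frob.hom_1 frob.hom_add frob.hom_mult)
qed

lemma frob_funpow_to_ac [simp]: "(frob ^^ n) (to_ac c) = to_ac c"
  by (induction n) simp_all

lemma poly_frob_funpow:
  "poly (map_poly to_ac g) ((frob ^^ n) x) = (frob ^^ n) (poly (map_poly to_ac g) x)"
proof -
  interpret f: field_embedding "frob ^^ n" by (rule frob_funpow_embedding)
  have "map_poly (frob ^^ n) (map_poly to_ac g) = map_poly to_ac g"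
    by (simp add: map_poly_map_poly f.hom_0 o_def)
  then show ?thesis using f.poly_map_poly_hom by metis
qed

lemma poly_frob_funpow_eq_0_iff:
  "poly (map_poly to_ac g) ((frob ^^ n) x) = 0 \<longleftrightarrow> poly (map_poly to_ac g) x = 0"
  using field_embedding.hom_eq_0_iff[OF frob_funpow_embedding] unfolding poly_frob_funpow .

section \<open>Periods and minimal polynomials\<close>

definition period :: "('b \<Rightarrow> 'b) \<Rightarrow> 'b \<Rightarrow> nat" where
  "period F x = (LEAST e. e > 0 \<and> (F ^^ e) x = x)"

lemma period:
  assumes "e > 0" "(F ^^ e) x = x"
  shows "period F x > 0" "(F ^^ period F x) x = x"
  using LeastI[of "\<lambda>e. e > 0 \<and> (F ^^ e) x = x" e] assms unfolding period_def by auto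

lemma funpow_period_mult:
  assumes "(F ^^ e) x = x" shows "(F ^^ (e * j)) x = x"
  using assms by (induction j) (simp_all add: funpow_add)

lemma period_dvd_iff:
  assumes "e > 0" "(F ^^ e) x = x"
  shows "(F ^^ n) x = x \<longleftrightarrow> period F x dvd n"
proof
  let ?p = "period F x"
  note p = period[OF assms]
  assume n: "(F ^^ n) x = x"
  have "x = (F ^^ (n mod ?p + ?p * (n div ?p))) x" using n by simp
  also have "\<dots> = (F ^^ (n mod ?p)) x"
    unfolding funpow_add using funpow_period_mult[OF p(2)] by simp
  finally have "(F ^^ (n mod ?p)) x = x" by simp
  then have "n mod ?p = 0"
    using not_less_Least[of "n mod ?p" "\<lambda>e. e > 0 \<and> (F ^^ e) x = x"] p(1)
    unfolding period_def[symmetric] by auto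
  then show "?p dvd n" by (simp add: dvd_eq_mod_eq_0)
next
  assume "period F x dvd n"
  then show "(F ^^ n) x = x" using funpow_period_mult[OF period(2)[OF assms]] by (auto elim!: dvdE)
qed

lemma inj_on_orbit:
  assumes "inj F" "e > 0" "(F ^^ e) x = x"
  shows "inj_on (\<lambda>i. (F ^^ i) x) {..<period F x}"
proof (rule linorder_inj_onI)
  fix i j assume ij: "i < j" "i \<in> {..<period F x}" "j \<in> {..<period F x}"
  show "(F ^^ i) x \<noteq> (F ^^ j) x"
  proof
    assume "(F ^^ i) x = (F ^^ j) x"
    then have "(F ^^ i) ((F ^^ (j - i)) x) = (F ^^ i) x"
      using ij by (simp flip: funpow_add comp_apply[of "F ^^ i"])
    then have "(F ^^ (j - i)) x = x" by (rule injD[OF inj_fn[OF assms(1)]])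
    then have "period F x dvd j - i" using period_dvd_iff[OF assms(2,3)] by blast
    then show False using ij by (auto dest: dvd_imp_le)
  qed
qed auto

lemma inj_frob: "inj frob"
  using frob.hom_eq_iff by (auto intro: injI)

lemma frob_orbit_finite:
  fixes x :: "'a::{field,finite} alg_closure"
  assumes "g \<noteq> 0" "poly (map_poly to_ac g) x = 0"
  obtains e where "e > 0" "(frob ^^ e) x = x"
proof -
  let ?R = "{y. poly (map_poly to_ac g) y = 0}"
  have "finite ?R" using assms by (intro poly_roots_finite) (simp add: to_ac.map_poly_hom_eq_0_iff)
  moreover have "range (\<lambda>i. (frob ^^ i) x) \<subseteq> ?R"
    using assms(2) poly_frob_funpow_eq_0_iff by auto
  ultimately have "finite (range (\<lambda>i. (frob ^^ i) x))" by (rule rev_finite_subset)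
  then have "\<not> inj (\<lambda>i :: nat. (frob ^^ i) x)" using finite_imageD by blast
  then obtain i j where "i < j" and eq: "(frob ^^ i) x = (frob ^^ j) x"
    unfolding inj_def by (metis linorder_neqE_nat)
  then have "(frob ^^ i) ((frob ^^ (j - i)) x) = (frob ^^ i) x"
    by (simp flip: funpow_add comp_apply[of "frob ^^ i"])
  then have "(frob ^^ (j - i)) x = x" by (rule injD[OF inj_fn[OF inj_frob]])
  then show ?thesis using that[of "j - i"] \<open>i < j\<close> by simp
qed

lemma period_le_degree:
  fixes x :: "'a::{field,finite} alg_closure"
  assumes "g \<noteq> 0" "poly (map_poly to_ac g) x = 0"
  shows "period frob x \<le> degree g"
proof -
  obtain e where e: "e > 0" "(frob ^^ e) x = x" using frob_orbit_finite[OF assms] .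
  let ?R = "{y. poly (map_poly to_ac g) y = 0}"
  have g: "map_poly to_ac g \<noteq> 0" using assms by (simp add: to_ac.map_poly_hom_eq_0_iff)
  have "period frob x = card ((\<lambda>i. (frob ^^ i) x) ` {..<period frob x})"
    using card_image[OF inj_on_orbit[OF inj_frob e]] by simp
  also have "\<dots> \<le> card ?R"
    using assms(2) poly_frob_funpow_eq_0_iff by (intro card_mono poly_roots_finite[OF g]) auto
  also have "\<dots> \<le> degree g"
    using card_poly_roots_bound[OF g] by (simp add: to_ac.degree_map_poly_hom)
  finally show ?thesis .
qed

lemma frob_fixed_polynomial:
  assumes "map_poly frob h = h"
  shows "map_poly to_ac (map_poly of_ac h) = h"
proof (rule poly_eqI)
  fix j
  have "frob (coeff h j) = coeff (map_poly frob h) j"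
    by (simp add: coeff_map_poly frob.hom_0)
  then have "frob (coeff h j) = coeff h j" by (simp only: assms)
  then show "coeff (map_poly to_ac (map_poly of_ac h)) j = coeff h j"
    by (simp add: frob_fixed_iff coeff_map_poly to_ac_of_ac)
qed

text \<open>
  Frobenius permutes the linear factors cyclically, hence fixes the coefficients of the product.
\<close>

lemma orbit_polynomial:
  fixes x :: "'a::{field,finite} alg_closure"
  assumes "e > 0" "(frob ^^ e) x = x"
  obtains u where "map_poly to_ac u = (\<Prod>i<period frob x. [:- (frob ^^ i) x, 1:])"
proof -
  let ?p = "period frob x"
  let ?h = "\<Prod>i<?p. [:- (frob ^^ i) x, 1:]"
  obtain n where n: "?p = Suc n" using period(1)[OF assms] by (cases ?p) auto
  have mp: "map_poly frob (prod F I) = (\<Prod>i\<in>I. map_poly frob (F i))" for F :: "nat \<Rightarrow> 'a alg_closure poly" and I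
    by (induction I rule: infinite_finite_induct) (simp_all add: frob.map_poly_mult frob.hom_1)
  have "map_poly frob ?h = (\<Prod>i<?p. [:- (frob ^^ Suc i) x, 1:])"
    unfolding mp by (simp add: map_poly_pCons frob.hom_minus frob.hom_1 frob.hom_0)
  also have "\<dots> = (\<Prod>i<n. [:- (frob ^^ Suc i) x, 1:]) * [:- (frob ^^ 0) x, 1:]"
    using period(2)[OF assms] unfolding n by (simp del: funpow.simps(2))
  also have "\<dots> = ?h" unfolding n by (simp only: prod.lessThan_Suc_shift mult.commute)
  finally show ?thesis using frob_fixed_polynomial that by blast
qed

lemma degree_prod_linear: "degree (\<Prod>i\<in>I. [:- F i, 1:] :: 'b::field poly) = card I"
  by (induction I rule: infinite_finite_induct) (simp_all add: degree_mult_eq del: mult_pCons_left)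

lemma irreducible_dvd_if_common_root:
  fixes g u :: "'a::field poly" and r :: "'a alg_closure"
  assumes "irreducible g" "poly (map_poly to_ac g) r = 0" "poly (map_poly to_ac u) r = 0"
  shows "g dvd u"
proof -
  have "\<not> bezout g u"
  proof
    assume "bezout g u"
    then obtain a b where "a * g + b * u = 1" unfolding bezout_def by blast
    then have "poly (map_poly to_ac (a * g + b * u)) r = 1" by simp
    then show False using assms by (simp add: to_ac.map_poly_add to_ac.map_poly_mult)
  qed
  then obtain d where d: "d dvd g" "d dvd u" "\<not> is_unit d"
    unfolding coprime_iff_bezout[symmetric] by (rule not_coprimeE)
  from d(1) obtain w where w: "g = d * w" by (rule dvdE)
  with assms(1) d(3) have "is_unit w" by (metis irreducible_def)
  then have "g dvd d" unfolding w by simp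
  then show ?thesis using d(2) by (rule dvd_trans)
qed

text \<open>
  An irreducible polynomial divides the orbit polynomial of its root, whose roots are distinct and are roots of
  \<open>g\<close> too. So both agree up to a constant factor.
\<close>

lemma irreducible_root:
  fixes r :: "'a::{field,finite} alg_closure"
  assumes "irreducible g" "poly (map_poly to_ac g) r = 0"
  shows "degree g = period frob r" and "pderiv g \<noteq> 0"
proof -
  have g0: "g \<noteq> 0" using assms(1) by auto
  obtain e where e: "e > 0" "(frob ^^ e) r = r" using frob_orbit_finite[OF g0 assms(2)] .
  let ?p = "period frob r"
  obtain n where n: "?p = Suc n" using period(1)[OF e] by (cases ?p) auto
  obtain u where u: "map_poly to_ac u = (\<Prod>i<?p. [:- (frob ^^ i) r, 1:])" using orbit_polynomial[OF e] .
  have du: "degree u = ?p" using arg_cong[OF u, of degree]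
    by (simp add: degree_prod_linear to_ac.degree_map_poly_hom)
  then have u0: "u \<noteq> 0" using n by auto
  have split: "map_poly to_ac u = [:- r, 1:] * (\<Prod>i<n. [:- (frob ^^ Suc i) r, 1:])"
    unfolding u n by (simp only: prod.lessThan_Suc_shift funpow_0)
  then have "poly (map_poly to_ac u) r = 0" by simp
  then have "g dvd u" by (rule irreducible_dvd_if_common_root[OF assms])
  then obtain w where w: "u = g * w" by (rule dvdE)
  have "degree g \<le> ?p" using \<open>g dvd u\<close> u0 du by (metis dvd_imp_degree_le)
  then show dg: "degree g = ?p" using period_le_degree[OF g0 assms(2)] by simp
  have "w \<noteq> 0" using w u0 by auto
  then have "degree w = 0" using w du dg g0 by (simp add: degree_mult_eq)
  then obtain c where c: "w = [:c:]" by (rule degree_eq_zeroE)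
  show "pderiv g \<noteq> 0"
  proof
    assume "pderiv g = 0"
    then have "pderiv u = 0" unfolding w c by (simp add: pderiv_smult)
    then have "pderiv (map_poly to_ac u) = 0" by (simp flip: to_ac.map_poly_pderiv)
    then have "poly (pderiv (map_poly to_ac u)) r = 0" by simp
    then have "poly (\<Prod>i<n. [:- (frob ^^ Suc i) r, 1:]) r = 0"
      unfolding split by (simp add: pderiv_mult pderiv_pCons del: mult_pCons_left funpow.simps)
    then obtain i where i: "i < n" "r = (frob ^^ Suc i) r" by (auto simp: poly_prod)
    then have "?p dvd Suc i" using period_dvd_iff[OF e] by metis
    then show False using i(1) n by (auto dest: dvd_imp_le)
  qed
qed

text \<open>
  One of two factors has \<open>r\<close> among its roots, hence the whole orbit, and so the full degree.
\<close>

lemma irreducibleI_period: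
  fixes r :: "'a::{field,finite} alg_closure"
  assumes "degree g > 0" "poly (map_poly to_ac g) r = 0" "degree g \<le> period frob r"
  shows "irreducible g"
proof (rule irreducibleI)
  show g0: "g \<noteq> 0" using assms(1) by auto
  show "\<not> is_unit g" using assms(1) g0 by (simp add: is_unit_iff_degree)
  fix a b assume g: "g = a * b"
  then have ab: "a \<noteq> 0" "b \<noteq> 0" using g0 by auto
  have "degree g = degree a + degree b" using ab by (simp add: g degree_mult_eq)
  moreover have "poly (map_poly to_ac a) r = 0 \<or> poly (map_poly to_ac b) r = 0"
    using assms(2) by (simp add: g to_ac.map_poly_mult)
  then have "degree a \<ge> degree g \<or> degree b \<ge> degree g"
    using period_le_degree ab assms(3) by (meson order_trans)
  ultimately have "degree b = 0 \<or> degree a = 0" by linarith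
  then show "is_unit a \<or> is_unit b" using ab by (auto simp: is_unit_iff_degree)
qed

lemma degree_minimal_polynomial:
  fixes r :: "'a::{field,finite} alg_closure"
  assumes "is_minimal_polynomial (range to_ac) r (map_poly to_ac f)"
  shows "degree f = period frob r" and "f \<noteq> 0" and "poly (map_poly to_ac f) r = 0"
proof -
  have min: "lead_coeff (map_poly to_ac f) = 1" and root: "poly (map_poly to_ac f) r = 0"
    and le: "\<And>q. q \<noteq> 0 \<Longrightarrow> set (coeffs q) \<subseteq> range to_ac \<Longrightarrow> poly q r = 0 \<Longrightarrow> degree f \<le> degree q"
    using assms unfolding is_minimal_polynomial_def to_ac.degree_map_poly_hom by auto
  show f0: "f \<noteq> 0" using min by auto
  show "poly (map_poly to_ac f) r = 0" by (fact root)
  obtain e where e: "e > 0" "(frob ^^ e) r = r" using frob_orbit_finite[OF f0 root] .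
  obtain u where u: "map_poly to_ac u = (\<Prod>i<period frob r. [:- (frob ^^ i) r, 1:])" using orbit_polynomial[OF e] .
  have "degree f \<le> degree (map_poly to_ac u)"
  proof (rule le)
    show "map_poly to_ac u \<noteq> 0" unfolding u by simp
    show "set (coeffs (map_poly to_ac u)) \<subseteq> range to_ac"
      by (auto simp: set_coeffs_map_poly to_ac.hom_eq_0_iff)
    show "poly (map_poly to_ac u) r = 0"
      unfolding u poly_prod using period(1)[OF e] by (intro prod_zero) (auto intro!: bexI[of _ 0])
  qed
  also have "\<dots> = period frob r" unfolding u by (simp add: degree_prod_linear)
  finally show "degree f = period frob r" using period_le_degree[OF f0 root] by simp
qed

section \<open>Finite extensions inside a field\<close>

context
  fixes R :: "'k::field ring"
  defines "R \<equiv> ring_of_type_algebra"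
begin

interpretation R: field R
  unfolding R_def by (rule field_from_type_algebra)

lemma R_simps: "carrier R = UNIV" "x \<otimes>\<^bsub>R\<^esub> y = x * y" "x \<oplus>\<^bsub>R\<^esub> y = x + y" "\<one>\<^bsub>R\<^esub> = 1" "\<zero>\<^bsub>R\<^esub> = 0"
  by (simp_all add: R_def ring_of_type_algebra_def)

lemma R_a_inv: "\<ominus>\<^bsub>R\<^esub> x = - x"
  by (rule R.minus_equality) (simp_all add: R_simps)

lemma R_m_inv: "x \<noteq> 0 \<Longrightarrow> inv\<^bsub>R\<^esub> x = inverse x"
  by (rule R.inv_unique'[symmetric]) (simp_all add: R_simps)

definition field_closed :: "'k set \<Rightarrow> bool" where
  "field_closed K \<longleftrightarrow> 1 \<in> K \<and> (\<forall>x\<in>K. \<forall>y\<in>K. x + y \<in> K \<and> x * y \<in> K) \<and> (\<forall>x\<in>K. - x \<in> K \<and> inverse x \<in> K)"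

lemma field_closed_props:
  assumes "field_closed K"
  shows "1 \<in> K" "0 \<in> K" "x \<in> K \<Longrightarrow> y \<in> K \<Longrightarrow> x + y \<in> K" "x \<in> K \<Longrightarrow> y \<in> K \<Longrightarrow> x - y \<in> K"
    "x \<in> K \<Longrightarrow> y \<in> K \<Longrightarrow> x * y \<in> K" "x \<in> K \<Longrightarrow> y \<in> K \<Longrightarrow> x / y \<in> K" "x \<in> K \<Longrightarrow> - x \<in> K"
    "x \<in> K \<Longrightarrow> inverse x \<in> K"
proof -
  show 1: "1 \<in> K" "x \<in> K \<Longrightarrow> y \<in> K \<Longrightarrow> x + y \<in> K" "x \<in> K \<Longrightarrow> - x \<in> K"
    "x \<in> K \<Longrightarrow> y \<in> K \<Longrightarrow> x * y \<in> K" "x \<in> K \<Longrightarrow> inverse x \<in> K" for x y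
    using assms unfolding field_closed_def by blast+
  show "0 \<in> K" using 1(2)[OF 1(1) 1(3)[OF 1(1)]] by simp
  show "x \<in> K \<Longrightarrow> y \<in> K \<Longrightarrow> x - y \<in> K" using 1(2)[OF _ 1(3)] by (simp only: diff_conv_add_uminus)
  show "x \<in> K \<Longrightarrow> y \<in> K \<Longrightarrow> x / y \<in> K" using 1(4)[OF _ 1(5)] by (simp only: divide_inverse)
qed

lemma subfield_iff_field_closed: "subfield K R \<longleftrightarrow> field_closed K"
proof
  assume K: "field_closed K"
  show "subfield K R"
  proof (rule R.subfieldI')
    show "subring K R"
      by (rule R.subringI) (use field_closed_props[OF K] in \<open>auto simp: R_simps R_a_inv\<close>)
    show "inv\<^bsub>R\<^esub> k \<in> K" if "k \<in> K - {\<zero>\<^bsub>R\<^esub>}" for k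
      using that field_closed_props[OF K] by (simp add: R_simps R_m_inv)
  qed
next
  assume K: "subfield K R"
  note sr = subfieldE(1)[OF K]
  have inv: "inverse x \<in> K" if "x \<in> K" for x
  proof (cases "x = 0")
    case False
    then have "inv\<^bsub>R\<^esub> x \<in> K" using R.subfield_m_inv(1)[OF K, of x] that by (simp add: R_simps)
    then show ?thesis using R_m_inv[OF False] by simp
  qed (use that in simp)
  show "field_closed K"
    unfolding field_closed_def using subringE(3,5-7)[OF sr] inv
    by (auto simp: R_simps R_a_inv)
qed

lemma field_closed_generate_field: "field_closed (generate_field R H)"
  unfolding subfield_iff_field_closed[symmetric] by (rule R.generate_field_is_subfield) (simp add: R_simps)

lemma generate_field_subset: "field_closed K \<Longrightarrow> H \<subseteq> K \<Longrightarrow> generate_field R H \<subseteq> K"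
  unfolding subfield_iff_field_closed[symmetric]
  by (rule R.generate_field_min_subfield1) (simp_all add: R_simps)

lemma combine_eq_sum: "length cs = length us \<Longrightarrow> R.combine cs us = (\<Sum>i<length us. cs ! i * us ! i)"
proof (induction cs us rule: list_induct2)
  case (Cons c cs u us)
  then show ?case by (simp add: R_simps sum.lessThan_Suc_shift del: sum.lessThan_Suc)
qed (simp add: R_simps)

text \<open>
  Linear combinations as sums with coefficient functions; in \<^const>\<open>ring.combine\<close> the coefficients are lists whose
  length need not match.
\<close>

definition lin_combs :: "'k set \<Rightarrow> 'k list \<Rightarrow> 'k set" where
  "lin_combs K us = {\<Sum>i<length us. c i * us ! i | c. \<forall>i<length us. c i \<in> K}"

definition lin_indep :: "'k set \<Rightarrow> 'k list \<Rightarrow> bool" where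
  "lin_indep K us \<longleftrightarrow> (\<forall>c. (\<forall>i<length us. c i \<in> K) \<longrightarrow> (\<Sum>i<length us. c i * us ! i) = 0
      \<longrightarrow> (\<forall>i<length us. c i = 0))"

lemma Span_eq_lin_combs:
  assumes K: "field_closed K"
  shows "R.Span K us = lin_combs K us"
proof -
  have "R.Span K us = {R.combine cs us | cs. length cs = length us \<and> set cs \<subseteq> K}"
    using K by (intro R.Span_eq_combine_set_length_version) (simp_all add: subfield_iff_field_closed R_simps)
  also have "\<dots> = lin_combs K us"
    unfolding lin_combs_def
  proof safe
    fix cs assume "length cs = length us" "set cs \<subseteq> K"
    then show "\<exists>c. R.combine cs us = (\<Sum>i<length us. c i * us ! i) \<and> (\<forall>i<length us. c i \<in> K)"
      by (intro exI[of _ "\<lambda>i. cs ! i"]) (auto simp: combine_eq_sum)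
  next
    fix c assume c: "\<forall>i<length us. c i \<in> K"
    let ?cs = "map c [0..<length us]"
    have "(\<Sum>i<length us. c i * us ! i) = R.combine ?cs us" by (simp add: combine_eq_sum)
    moreover have "length ?cs = length us" "set ?cs \<subseteq> K" using c by auto
    ultimately show "\<exists>cs. (\<Sum>i<length us. c i * us ! i) = R.combine cs us \<and> length cs = length us \<and> set cs \<subseteq> K"
      by blast
  qed
  finally show ?thesis .
qed

lemma independent_if_lin_indep:
  assumes K: "field_closed K" and ind: "lin_indep K us"
  shows "R.independent K us"
proof (rule R.trivial_combine_imp_independent)
  show sf: "subfield K R" using K by (simp add: subfield_iff_field_closed)
  show "set us \<subseteq> carrier R" by (simp add: R_simps)
  fix cs assume cs: "set cs \<subseteq> K" "R.combine cs us = \<zero>\<^bsub>R\<^esub>"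
  \<comment> \<open>Lists of coefficients are padded with zeros or cut off to the right length.\<close>
  define ds where "ds = take (length us) (cs @ replicate (length us) 0)"
  have ds: "length ds = length us" "set ds \<subseteq> K"
    using cs(1) field_closed_props(2)[OF K] by (auto simp: ds_def dest!: in_set_takeD)
  have comb: "R.combine ds us = R.combine cs us"
  proof -
    have "R.combine (take (length vs) (es @ replicate (length vs) 0)) vs = R.combine es vs" for es vs
    proof (induction es arbitrary: vs)
      case Nil
      have "R.combine (replicate n 0) vs = 0" if "n = length vs" for n
        using that by (induction vs arbitrary: n) (auto simp: R_simps)
      then show ?case by (cases vs) (auto simp: R_simps)
    next
      case (Cons e es)
      show ?case
      proof (cases vs)
        case (Cons v vs')
        have "take (length vs') (es @ replicate (Suc (length vs')) 0) = take (length vs') (es @ replicate (length vs') (0::'k))"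
          by (simp add: min_def del: replicate_Suc)
        then show ?thesis using Cons.IH[of vs'] Cons by (simp del: replicate_Suc take_append)
      qed simp
    qed
    then show ?thesis unfolding ds_def .
  qed
  have "\<forall>i<length us. ds ! i = 0"
    using ind ds cs(2) comb unfolding lin_indep_def
    by (auto simp: combine_eq_sum R_simps subset_iff dest!: spec[of _ "\<lambda>i. ds ! i"])
  then have "set ds \<subseteq> {0}" using ds(1) by (auto simp: in_set_conv_nth)
  moreover have "set (take (length us) cs) \<subseteq> set ds" unfolding ds_def by (auto simp: take_append)
  ultimately show "set (take (length us) cs) \<subseteq> {\<zero>\<^bsub>R\<^esub>}" by (auto simp: R_simps)
qed

lemma dimension_lin_combs:
  "field_closed K \<Longrightarrow> lin_indep K us \<Longrightarrow> R.dimension (length us) K (lin_combs K us)"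
  by (rule R.dimensionI)
     (simp_all add: subfield_iff_field_closed independent_if_lin_indep Span_eq_lin_combs del: R.Span.simps)

text \<open>
  Multiplication by a nonzero element of a finite-dimensional algebra is injective, hence onto, and so 1 is
  in the image.
\<close>

lemma inverse_mem_lin_combs:
  assumes K: "field_closed K" and ind: "lin_indep K us"
    and mult: "\<And>x y. x \<in> lin_combs K us \<Longrightarrow> y \<in> lin_combs K us \<Longrightarrow> x * y \<in> lin_combs K us"
    and one: "1 \<in> lin_combs K us"
    and v: "v \<in> lin_combs K us"
  shows "inverse v \<in> lin_combs K us"
proof (cases "v = 0")
  case False
  have sf: "subfield K R" using K by (simp add: subfield_iff_field_closed)
  let ?vs = "map ((*) v) us"
  have sum: "(\<Sum>i<length us. c i * ?vs ! i) = v * (\<Sum>i<length us. c i * us ! i)" for c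
    by (simp add: sum_distrib_left mult_ac)
  have "lin_indep K ?vs"
    using ind False unfolding lin_indep_def length_map sum by simp
  then have "R.independent K ?vs" by (rule independent_if_lin_indep[OF K])
  moreover have "set ?vs \<subseteq> lin_combs K us"
  proof
    fix z assume "z \<in> set ?vs"
    then obtain u where "u \<in> set us" "z = v * u" by auto
    then have "u \<in> R.Span K us" using R.Span_base_incl[OF sf, of us] by (auto simp: R_simps)
    then show "z \<in> lin_combs K us" using mult[OF v] \<open>z = v * u\<close> by (simp add: Span_eq_lin_combs[OF K] del: R.Span.simps)
  qed
  ultimately have "R.Span K ?vs = lin_combs K us"
    using R.independent_length_eq_dimension[OF sf dimension_lin_combs[OF K ind], of ?vs]
    by (simp del: R.Span.simps)
  then have "1 \<in> lin_combs K ?vs" using one Span_eq_lin_combs[OF K] by blast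
  then obtain c where c: "\<forall>i<length us. c i \<in> K" "1 = v * (\<Sum>i<length us. c i * us ! i)"
    unfolding lin_combs_def length_map sum by blast
  have "inverse v = (\<Sum>i<length us. c i * us ! i)" by (rule inverse_unique[OF c(2)[symmetric]])
  then show ?thesis using c(1) unfolding lin_combs_def by blast
qed (use v in simp)

lemma lin_combs_add:
  assumes "field_closed K" "x \<in> lin_combs K us" "y \<in> lin_combs K us"
  shows "x + y \<in> lin_combs K us"
proof -
  obtain c d where "\<forall>i<length us. c i \<in> K" "x = (\<Sum>i<length us. c i * us ! i)"
    "\<forall>i<length us. d i \<in> K" "y = (\<Sum>i<length us. d i * us ! i)"
    using assms unfolding lin_combs_def by blast
  then show ?thesis unfolding lin_combs_def using field_closed_props(3)[OF assms(1)]
    by (intro CollectI exI[of _ "\<lambda>i. c i + d i"]) (simp add: distrib_right sum.distrib)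
qed

lemma lin_combs_scale:
  assumes "field_closed K" "k \<in> K" "y \<in> lin_combs K us"
  shows "k * y \<in> lin_combs K us"
proof -
  obtain d where "\<forall>i<length us. d i \<in> K" "y = (\<Sum>i<length us. d i * us ! i)"
    using assms unfolding lin_combs_def by blast
  then show ?thesis unfolding lin_combs_def using field_closed_props(5)[OF assms(1,2)]
    by (intro CollectI exI[of _ "\<lambda>i. k * d i"]) (simp add: sum_distrib_left mult.assoc)
qed

lemma lin_combs_zero: "field_closed K \<Longrightarrow> 0 \<in> lin_combs K us"
  unfolding lin_combs_def by (intro CollectI exI[of _ "\<lambda>_. 0"]) (simp add: field_closed_props)

lemma lin_combs_sum:
  assumes "field_closed K" "\<And>i. i \<in> I \<Longrightarrow> f i \<in> lin_combs K us"
  shows "sum f I \<in> lin_combs K us"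
  using assms(2)
  by (induction I rule: infinite_finite_induct) (simp_all add: lin_combs_add lin_combs_zero assms(1))

lemma lin_combs_base: "field_closed K \<Longrightarrow> i < length us \<Longrightarrow> us ! i \<in> lin_combs K us"
  unfolding lin_combs_def
  by (intro CollectI exI[of _ "\<lambda>j. if j = i then 1 else 0"])
     (simp add: field_closed_props if_distrib[of "\<lambda>c. c * _"] cong: if_cong)

lemma lin_combs_mult:
  assumes "field_closed K" "\<And>i. i < length us \<Longrightarrow> us ! i * y \<in> lin_combs K us" "x \<in> lin_combs K us"
  shows "x * y \<in> lin_combs K us"
proof -
  obtain c where c: "\<forall>i<length us. c i \<in> K" "x = (\<Sum>i<length us. c i * us ! i)"
    using assms unfolding lin_combs_def by blast
  have "x * y = (\<Sum>i<length us. c i * (us ! i * y))" unfolding c(2) sum_distrib_right by (simp only: mult.assoc)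
  also have "\<dots> \<in> lin_combs K us"
  proof (rule lin_combs_sum[OF assms(1)])
    fix i assume "i \<in> {..<length us}"
    then show "c i * (us ! i * y) \<in> lin_combs K us"
      using c(1) assms(2) by (simp add: lin_combs_scale[OF assms(1)])
  qed
  finally show ?thesis .
qed

lemma field_closed_lin_combs:
  assumes K: "field_closed K" and ind: "lin_indep K us"
    and mult: "\<And>x y. x \<in> lin_combs K us \<Longrightarrow> y \<in> lin_combs K us \<Longrightarrow> x * y \<in> lin_combs K us"
    and one: "1 \<in> lin_combs K us"
  shows "field_closed (lin_combs K us)"
proof -
  have "- x \<in> lin_combs K us" if "x \<in> lin_combs K us" for x
    using lin_combs_scale[OF K _ that, of "- 1"] field_closed_props(1,7)[OF K] by simp
  then show ?thesis unfolding field_closed_def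
    by (intro conjI ballI one lin_combs_add[OF K] mult inverse_mem_lin_combs[OF K ind mult one])
qed

text \<open>
  A basis over \<open>K\<close> spans \<open>V\<close> over \<open>F\<close>, so that the dimension over \<open>F\<close> is finite and the tower law
  applies to it.
\<close>

lemma dim_over_intermediate_field:
  assumes K: "field_closed K" and F: "field_closed F"
    and KF: "R.dimension n K F" and KV: "R.dimension d K V" and sub: "K \<subseteq> F"
    and mult: "\<And>x y. x \<in> F \<Longrightarrow> y \<in> V \<Longrightarrow> x * y \<in> V"
  shows "n * R.dim F V = d"
proof -
  have sf: "subfield K R" "subfield F R" using K F by (simp_all add: subfield_iff_field_closed)
  obtain us where "R.Span K us = V" using R.exists_base[OF sf(1) KV] by blast
  then have V: "V = lin_combs K us" using Span_eq_lin_combs[OF K] by simp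
  have "lin_combs F us = V"
  proof
    show "V \<subseteq> lin_combs F us" unfolding V lin_combs_def using sub by blast
    show "lin_combs F us \<subseteq> V"
    proof
      fix z assume "z \<in> lin_combs F us"
      then obtain c where "\<forall>i<length us. c i \<in> F" "z = (\<Sum>i<length us. c i * us ! i)"
        unfolding lin_combs_def by blast
      then show "z \<in> V"
        using lin_combs_sum[OF K, of "{..<length us}"] mult lin_combs_base[OF K] unfolding V by simp
    qed
  qed
  then have "R.finite_dimension F V"
    using R.Span_finite_dimension[OF sf(2), of us] Span_eq_lin_combs[OF F]
    by (simp add: R_simps del: R.Span.simps)
  then have "R.dimension (R.dim F V) F V"
    using R.finite_dimensionE[OF sf(2)] by (simp add: over_def)
  then have "R.dimension (n * R.dim F V) K V" by (rule R.telescopic_base[OF sf KF])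
  then show ?thesis using R.dimension_is_inj[OF sf(1)] KV by blast
qed

lemma dimension_tower:
  assumes "field_closed K" "field_closed F" "R.dimension n K F" "R.dimension d F V"
  shows "R.dimension (n * d) K V"
  using assms unfolding subfield_iff_field_closed[symmetric] by (rule R.telescopic_base)

lemma dimension_self: "field_closed K \<Longrightarrow> R.dimension 1 K K"
  by (rule R.dimension_one) (simp add: subfield_iff_field_closed)

end

section \<open>The extension of rational function fields given by a rational fraction\<close>

lemma field_closed_range_to_ac: "field_closed (range to_ac)"
  unfolding field_closed_def
proof (intro conjI ballI)
  show "1 \<in> range to_ac" by (metis to_ac_1 rangeI)
  fix x :: "'a alg_closure" assume "x \<in> range to_ac"
  then obtain a where a: "x = to_ac a" by blast
  show "- x \<in> range to_ac" "inverse x \<in> range to_ac" unfolding a by (simp_all flip: to_ac_minus to_ac_inverse)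
  fix y :: "'a alg_closure" assume "y \<in> range to_ac"
  then obtain b where b: "y = to_ac b" by blast
  show "x + y \<in> range to_ac" "x * y \<in> range to_ac" unfolding a b by (simp_all flip: to_ac_add to_ac_mult)
qed

lemma field_closed_sum: "field_closed K \<Longrightarrow> (\<And>i. i \<in> I \<Longrightarrow> f i \<in> K) \<Longrightarrow> sum f I \<in> K"
  by (induction I rule: infinite_finite_induct) (simp_all add: field_closed_props)

lemma to_ac_Fract: "b \<noteq> 0 \<Longrightarrow> to_ac (Fract a b) = ff_poly a / ff_poly b"
  unfolding ff_poly_def to_ac_divide[symmetric] by simp

lemma ff_poly_in_range: "ff_poly p \<in> range to_ac"
  by (simp add: ff_poly_def)

lemma ff_poly_sum: "ff_poly (sum F I) = (\<Sum>i\<in>I. ff_poly (F i))"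
  by (induction I rule: infinite_finite_induct) simp_all

lemma ff_poly_altdef: "degree p \<le> n \<Longrightarrow> ff_poly p = (\<Sum>i\<le>n. ff_const (coeff p i) * ff_x ^ i)"
proof -
  assume n: "degree p \<le> n"
  have "ff_poly p = (\<Sum>i\<le>degree p. ff_const (coeff p i) * ff_x ^ i)"
    by (simp add: poly_ff_const_ff_x[symmetric] poly_altdef ff_const.degree_map_poly_hom coeff_map_poly ff_const.hom_0)
  also have "\<dots> = (\<Sum>i\<le>n. ff_const (coeff p i) * ff_x ^ i)"
    using n by (intro sum.mono_neutral_left) (auto simp: coeff_eq_0 ff_const.hom_0)
  finally show ?thesis .
qed

text \<open>
  The degree condition says that $S$ has a pole at infinity, as is the case for an endomorphism, which fixes the
  point at infinity.
\<close>

locale polynomial_like_fraction =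
  fixes S :: "'a::field poly fract"
  assumes degree_less: "degree (denominator S) < degree (numerator S)"
begin

abbreviation "A \<equiv> numerator S"
abbreviation "B \<equiv> denominator S"

text \<open>
  The value $p(S)$ in $k(x)$; these values form $k[S]$, and their quotients the field $k(S)$.
\<close>

definition subst :: "'a poly \<Rightarrow> 'a ff" where
  "subst p = poly (map_poly ff_const p) (to_ac S)"

definition subst_field :: "'a ff set" where
  "subst_field = {subst p / subst q | p q. q \<noteq> 0}"

lemma B_nz: "B \<noteq> 0"
  using Fract_lowest_terms(3)[of S] by auto

lemma to_ac_S: "to_ac S = ff_poly A / ff_poly B"
  by (subst Fract_lowest_terms(1)) (rule to_ac_Fract[OF B_nz])

lemma subst_add: "subst (p + q) = subst p + subst q"
  by (simp add: subst_def ff_const.map_poly_add)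

lemma subst_mult: "subst (p * q) = subst p * subst q"
  by (simp add: subst_def ff_const.map_poly_mult)

lemma subst_const: "subst [:c:] = ff_const c"
  by (simp add: subst_def map_poly_pCons ff_const.hom_0)

lemma subst_X: "subst [:0, 1:] = to_ac S"
  by (simp add: subst_def map_poly_pCons ff_const.hom_0 ff_const.hom_1)

lemma subst_0: "subst 0 = 0" and subst_1: "subst 1 = 1"
  by (simp_all add: subst_def ff_const.hom_1)

lemma subst_clear_denominator:
  assumes "degree p \<le> n"
  shows "subst p * ff_poly B ^ n = ff_poly (\<Sum>j\<le>n. smult (coeff p j) (A ^ j * B ^ (n - j)))"
proof -
  have "subst p = (\<Sum>j\<le>degree p. ff_const (coeff p j) * to_ac S ^ j)"
    by (simp add: subst_def poly_altdef ff_const.degree_map_poly_hom coeff_map_poly ff_const.hom_0)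
  also have "\<dots> = (\<Sum>j\<le>n. ff_const (coeff p j) * to_ac S ^ j)"
    using assms by (intro sum.mono_neutral_left) (auto simp: coeff_eq_0 ff_const.hom_0)
  finally have "subst p * ff_poly B ^ n = (\<Sum>j\<le>n. ff_const (coeff p j) * to_ac S ^ j * ff_poly B ^ n)"
    by (simp add: sum_distrib_right)
  also have "\<dots> = (\<Sum>j\<le>n. ff_poly (smult (coeff p j) (A ^ j * B ^ (n - j))))"
  proof (rule sum.cong)
    fix j assume "j \<in> {..n}"
    then have "ff_poly B ^ n = ff_poly B ^ j * ff_poly B ^ (n - j)" by (simp flip: power_add)
    moreover have "ff_poly (smult (coeff p j) (A ^ j * B ^ (n - j))) = ff_const (coeff p j) * (ff_poly A ^ j * ff_poly B ^ (n - j))"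
      using ff_poly_mult[of "[:coeff p j:]" "A ^ j * B ^ (n - j)"] by (simp add: ff_const_eq)
    ultimately show "ff_const (coeff p j) * to_ac S ^ j * ff_poly B ^ n = ff_poly (smult (coeff p j) (A ^ j * B ^ (n - j)))"
      using B_nz by (simp add: to_ac_S power_divide)
  qed simp
  finally show ?thesis by (simp add: ff_poly_sum)
qed

text \<open>
  The numerator divides all terms except the one for $j = 0$, hence also \<open>C 0\<close>, whose degree is too small
  unless it is zero. A factor $A$ can then be cancelled.
\<close>

lemma expansion_unique:
  assumes "(\<Sum>j\<le>n. C j * (A ^ j * B ^ (n - j))) = 0" and "\<And>j. degree (C j) < degree A"
  shows "\<forall>j\<le>n. C j = 0"
  using assms
proof (induction n arbitrary: C)
  case (Suc n)
  have A0: "A \<noteq> 0" using degree_less by auto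
  have "(\<Sum>j\<le>Suc n. C j * (A ^ j * B ^ (Suc n - j))) =
      C 0 * B ^ Suc n + A * (\<Sum>j\<le>n. C (Suc j) * (A ^ j * B ^ (n - j)))"
    by (subst sum.atMost_Suc_shift) (simp add: sum_distrib_left mult_ac)
  then have eq: "C 0 * B ^ Suc n + A * (\<Sum>j\<le>n. C (Suc j) * (A ^ j * B ^ (n - j))) = 0"
    using Suc.prems(1) by simp
  then have "B ^ Suc n * C 0 = A * - (\<Sum>j\<le>n. C (Suc j) * (A ^ j * B ^ (n - j)))"
    by (simp add: mult.commute eq_neg_iff_add_eq_0)
  then have "A dvd B ^ Suc n * C 0" by simp
  then have "A dvd C 0" by (rule bezout_dvd[OF bezout_power[OF Fract_lowest_terms(2)]])
  then have C0: "C 0 = 0" using Suc.prems(2)[of 0] by (meson dvd_imp_degree_le not_le)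
  with eq A0 have "(\<Sum>j\<le>n. C (Suc j) * (A ^ j * B ^ (n - j))) = 0" by simp
  then have "\<forall>j\<le>n. C (Suc j) = 0" using Suc.prems(2) by (intro Suc.IH) auto
  then show ?case using C0 by (metis Suc_le_mono not0_implies_Suc)
qed simp

lemma subst_eq_0_iff: "subst p = 0 \<longleftrightarrow> p = 0"
proof
  assume "subst p = 0"
  then have "(\<Sum>j\<le>degree p. smult (coeff p j) (A ^ j * B ^ (degree p - j))) = 0"
    using subst_clear_denominator[OF order_refl, of p] by simp
  then have "(\<Sum>j\<le>degree p. [:coeff p j:] * (A ^ j * B ^ (degree p - j))) = 0" by simp
  then have "\<forall>j\<le>degree p. [:coeff p j:] = 0"
    using degree_less by (intro expansion_unique) auto
  then have "lead_coeff p = 0" by (metis order_refl pCons_eq_0_iff)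
  then show "p = 0" by simp
qed (simp add: subst_0)

lemma field_closed_subst_field: "field_closed subst_field"
  unfolding field_closed_def
proof (intro conjI ballI)
  show "1 \<in> subst_field"
    unfolding subst_field_def by (intro CollectI exI[of _ 1]) (simp add: subst_1)
  fix x assume "x \<in> subst_field"
  then obtain p q where x: "x = subst p / subst q" "q \<noteq> 0" unfolding subst_field_def by blast
  have "- x = subst ([:-1:] * p) / subst q"
    unfolding subst_mult subst_const x by (simp add: ff_const.hom_minus ff_const.hom_1)
  then show "- x \<in> subst_field" unfolding subst_field_def using x(2) by blast
  show "inverse x \<in> subst_field"
  proof (cases "p = 0")
    case True
    then have "inverse x = subst 0 / subst 1" by (simp add: x subst_0)
    then show ?thesis unfolding subst_field_def
      by (intro CollectI exI[of _ 0] exI[of _ 1]) simp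
  next
    case False
    then have "inverse x = subst q / subst p" by (simp add: x)
    then show ?thesis unfolding subst_field_def using False by blast
  qed
  fix y assume "y \<in> subst_field"
  then obtain r s where y: "y = subst r / subst s" "s \<noteq> 0" unfolding subst_field_def by blast
  have "x + y = subst (p * s + r * q) / subst (q * s)" "x * y = subst (p * r) / subst (q * s)" "q * s \<noteq> 0"
    using x y by (simp_all add: subst_mult subst_add subst_eq_0_iff add_frac_eq)
  then show "x + y \<in> subst_field" "x * y \<in> subst_field" unfolding subst_field_def by blast+
qed

lemma subst_in_subst_field: "subst p \<in> subst_field"
  unfolding subst_field_def by (intro CollectI exI[of _ p] exI[of _ 1]) (simp add: subst_1)

lemma subst_field_subset: "subst_field \<subseteq> range to_ac"
proof
  note cl = field_closed_props[OF field_closed_range_to_ac]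
  have "subst p \<in> range to_ac" for p
  proof (induction p)
    case (pCons c p)
    have "subst (pCons c p) = ff_const c + to_ac S * subst p"
      by (simp add: subst_def map_poly_pCons ff_const.hom_0)
    also have "\<dots> \<in> range to_ac"
      unfolding ff_const_eq by (intro cl ff_poly_in_range pCons.IH rangeI)
    finally show ?case .
  qed (simp add: subst_0 cl)
  note mem = this
  fix x assume "x \<in> subst_field"
  then obtain p q where x: "x = subst p / subst q" unfolding subst_field_def by blast
  show "x \<in> range to_ac" unfolding x by (intro cl mem)
qed

definition x_powers :: "'a ff list" where "x_powers = map ((^) ff_x) [0..<degree A]"

lemma length_x_powers [simp]: "length x_powers = degree A"
  by (simp add: x_powers_def)

lemma nth_x_powers [simp]: "i < degree A \<Longrightarrow> x_powers ! i = ff_x ^ i"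
  by (simp add: x_powers_def)

text \<open>
  A relation between powers of $x$ over $k(S)$ becomes, after multiplication by a common denominator, an expansion
  in powers of $S$ whose coefficients are polynomials in $x$ of degree less than $\deg A$.
\<close>

lemma lin_indep_x_powers: "lin_indep subst_field x_powers"
  unfolding lin_indep_def length_x_powers
proof (intro allI impI)
  fix c i0
  assume "\<forall>i<degree A. c i \<in> subst_field" and sum0: "(\<Sum>i<degree A. c i * x_powers ! i) = 0"
    and i0: "i0 < degree A"
  then have "\<forall>i. \<exists>p q. i < degree A \<longrightarrow> c i = subst p / subst q \<and> q \<noteq> 0"
    unfolding subst_field_def by blast
  then obtain p q where c: "\<And>i. i < degree A \<Longrightarrow> c i = subst (p i) / subst (q i)"
    and q: "\<And>i. i < degree A \<Longrightarrow> q i \<noteq> 0" by metis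
  define Q where "Q = (\<Prod>i<degree A. q i)"
  define r where "r i = p i * (\<Prod>j\<in>{..<degree A} - {i}. q j)" for i
  have Q0: "subst Q \<noteq> 0" unfolding subst_eq_0_iff Q_def using q by simp
  have cr: "c i * subst Q = subst (r i)" if "i < degree A" for i
  proof -
    have "Q = q i * (\<Prod>j\<in>{..<degree A} - {i}. q j)"
      unfolding Q_def using that by (intro prod.remove) auto
    then show ?thesis using c[OF that] q[OF that] by (simp add: r_def subst_mult subst_eq_0_iff)
  qed
  define n where "n = (\<Sum>i<degree A. degree (r i))"
  have n: "degree (r i) \<le> n" if "i < degree A" for i
    unfolding n_def using that by (intro member_le_sum) auto
  define C where "C j = (\<Sum>i<degree A. monom (coeff (r i) j) i)" for j
  have "ff_poly (\<Sum>j\<le>n. C j * (A ^ j * B ^ (n - j)))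
      = ff_poly (\<Sum>i<degree A. (\<Sum>j\<le>n. smult (coeff (r i) j) (A ^ j * B ^ (n - j))) * monom 1 i)"
  proof -
    have "(\<Sum>j\<le>n. C j * (A ^ j * B ^ (n - j))) =
       (\<Sum>j\<le>n. \<Sum>i<degree A. monom (coeff (r i) j) i * (A ^ j * B ^ (n - j)))"
      by (simp add: C_def sum_distrib_right)
    also have "\<dots> = (\<Sum>i<degree A. \<Sum>j\<le>n. monom (coeff (r i) j) i * (A ^ j * B ^ (n - j)))"
      by (rule sum.swap)
    also have "\<dots> = (\<Sum>i<degree A. (\<Sum>j\<le>n. smult (coeff (r i) j) (A ^ j * B ^ (n - j))) * monom 1 i)"
    proof -
      have "monom a i * z = smult a z * monom 1 i" for a :: 'a and i z
        by (metis mult.commute mult_1_right mult_smult_left mult_smult_right smult_monom)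
      then show ?thesis by (simp add: sum_distrib_right)
    qed
    finally show ?thesis by (rule arg_cong)
  qed
  also have "\<dots> = (\<Sum>i<degree A. ff_poly (\<Sum>j\<le>n. smult (coeff (r i) j) (A ^ j * B ^ (n - j))) * ff_x ^ i)"
    unfolding ff_poly_sum ff_poly_mult by (simp add: ff_x_eq monom_altdef flip: ff_poly_power)
  also have "\<dots> = (\<Sum>i<degree A. (c i * x_powers ! i) * (subst Q * ff_poly B ^ n))"
    by (rule sum.cong) (simp_all add: subst_clear_denominator[OF n, symmetric] cr[symmetric] mult_ac)
  also have "\<dots> = 0" unfolding sum_distrib_right[symmetric] sum0 by simp
  finally have "(\<Sum>j\<le>n. C j * (A ^ j * B ^ (n - j))) = 0" by simp
  moreover have "degree (C j) < degree A" for j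
    unfolding C_def using degree_less by (intro degree_sum_less) (auto intro: le_less_trans[OF degree_monom_le])
  ultimately have C0: "\<forall>j\<le>n. C j = 0" by (rule expansion_unique)
  have "coeff (r i0) j = 0" for j
  proof (cases "j \<le> n")
    case True
    have "coeff (C j) i0 = coeff (r i0) j"
      unfolding C_def coeff_sum using i0 by (simp add: coeff_monom if_distrib sum.delta cong: if_cong)
    then show ?thesis using C0 True by simp
  next
    case False
    then show ?thesis using n[OF i0] by (intro coeff_eq_0) simp
  qed
  then have "r i0 = 0" by (simp add: poly_eq_iff)
  then have "c i0 * subst Q = 0" using cr[OF i0] by (simp add: subst_0)
  then show "c i0 = 0" using Q0 by simp
qed

text \<open>
  As $x$ is a root of $A(X) - S B(X)$, a polynomial of degree $\deg A$ over $k(S)$, its lower powers span a ring.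
  Being finite-dimensional over $k(S)$, this ring is a field.
\<close>

lemma lin_combs_x_powers: "lin_combs subst_field x_powers = range to_ac"
proof -
  note K = field_closed_subst_field
  note cl = field_closed_props[OF K]
  let ?V = "lin_combs subst_field x_powers"
  have pos: "0 < degree A" using degree_less by simp
  have base: "ff_x ^ i \<in> ?V" if "i < degree A" for i
    using lin_combs_base[OF K, of i x_powers] that by simp
  have const: "ff_const c \<in> subst_field" for c using subst_in_subst_field[of "[:c:]"] by (simp add: subst_const)
  have lowdeg: "ff_poly p \<in> ?V" if "degree p < degree A" for p
    unfolding ff_poly_altdef[OF order_refl]
    using that by (intro lin_combs_sum[OF K] lin_combs_scale[OF K const] base) auto
  \<comment> \<open>The numerator, hence the power of x of the same degree, is S times the denominator.\<close>
  have top: "ff_x ^ degree A \<in> ?V"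
  proof -
    let ?c = "lead_coeff A"
    have c0: "?c \<noteq> 0" using pos by auto
    define A' where "A' = A - monom ?c (degree A)"
    have "degree A' < degree A"
    proof -
      have "degree A' \<le> degree A" unfolding A'_def by (intro degree_diff_le) (simp_all add: degree_monom_le)
      moreover have "coeff A' (degree A) = 0" by (simp add: A'_def)
      ultimately show ?thesis using pos by (metis degree_0 leading_coeff_0_iff le_neq_implies_less)
    qed
    have "ff_const ?c * ff_x ^ degree A = ff_poly (monom ?c (degree A))"
      by (simp add: ff_const_eq ff_x_eq monom_altdef flip: ff_poly_power ff_poly_mult)
    also have "\<dots> = ff_poly A - ff_poly A'" by (simp add: A'_def)
    also have "ff_poly A = to_ac S * ff_poly B" using B_nz by (simp add: to_ac_S)
    also have "to_ac S * ff_poly B - ff_poly A' = to_ac S * ff_poly B + ff_const (- 1) * ff_poly A'"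
      by (simp add: ff_const.hom_minus ff_const.hom_1)
    also have "\<dots> \<in> ?V"
      using subst_in_subst_field[of "[:0, 1:]"] \<open>degree A' < degree A\<close> degree_less
      by (intro lin_combs_add[OF K] lin_combs_scale[OF K] const lowdeg) (simp_all add: subst_X)
    finally have "ff_const (inverse ?c) * (ff_const ?c * ff_x ^ degree A) \<in> ?V"
      by (rule lin_combs_scale[OF K const])
    moreover have "ff_const (inverse ?c) * (ff_const ?c * ff_x ^ degree A) = ff_x ^ degree A"
      using c0 by (simp add: mult.assoc[symmetric] ff_const.hom_1 flip: ff_const.hom_mult)
    ultimately show ?thesis by simp
  qed
  have multx: "w * ff_x \<in> ?V" if "w \<in> ?V" for w
  proof (rule lin_combs_mult[OF K _ that])
    fix i assume "i < length x_powers"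
    then have i: "i < degree A" by simp
    then have "x_powers ! i * ff_x = ff_x ^ Suc i" by simp
    also have "\<dots> \<in> ?V" using i base[of "Suc i"] top by (cases "Suc i = degree A") auto
    finally show "x_powers ! i * ff_x \<in> ?V" .
  qed
  have multpow: "w * ff_x ^ i \<in> ?V" if "w \<in> ?V" for w i
    using that multx by (induction i) (simp_all add: mult.assoc[symmetric] power_commutes[symmetric])
  have mult: "w * z \<in> ?V" if "w \<in> ?V" "z \<in> ?V" for w z
    by (rule lin_combs_mult[OF K _ that(1)]) (use multpow[OF that(2)] in \<open>simp add: mult.commute\<close>)
  have one: "1 \<in> ?V" using base[OF pos] by simp
  have fc: "field_closed ?V"
    by (rule field_closed_lin_combs[OF K lin_indep_x_powers mult one])
  have poly: "ff_poly p \<in> ?V" for p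
  proof -
    have "ff_const c * (1 * ff_x ^ i) \<in> ?V" for c i
      by (intro lin_combs_scale[OF K const] multpow one)
    then show ?thesis unfolding ff_poly_altdef[OF order_refl]
      by (intro lin_combs_sum[OF K]) simp
  qed
  show ?thesis
  proof
    show "range to_ac \<subseteq> ?V"
    proof
      fix z :: "'a ff" assume "z \<in> range to_ac"
      then obtain s where "z = to_ac s" by blast
      moreover obtain a b where "s = Fract a b" "b \<noteq> 0" by (cases s) auto
      ultimately have "z = ff_poly a / ff_poly b" by (simp add: to_ac_Fract)
      then show "z \<in> ?V" using poly field_closed_props(6)[OF fc] by simp
    qed
    show "?V \<subseteq> range to_ac"
    proof
      note cl' = field_closed_props[OF field_closed_range_to_ac]
      fix z assume "z \<in> ?V"
      then obtain c where c: "\<forall>i<degree A. c i \<in> subst_field" "z = (\<Sum>i<degree A. c i * x_powers ! i)"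
        unfolding lin_combs_def by auto
      have "c i * x_powers ! i \<in> range to_ac" if "i < degree A" for i
      proof -
        have "c i \<in> range to_ac" using that c(1) subst_field_subset by blast
        moreover have "x_powers ! i \<in> range to_ac"
          using that ff_poly_in_range[of "[:0, 1:] ^ i"] by (simp add: ff_x_eq)
        ultimately show ?thesis by (rule cl'(5))
      qed
      then show "z \<in> range to_ac" unfolding c(2)
        by (intro field_closed_sum[OF field_closed_range_to_ac]) simp
    qed
  qed
qed

lemma dimension_subst_field:
  "ring.dimension ring_of_type_algebra (degree A) subst_field (range to_ac :: 'a ff set)"
  using dimension_lin_combs[OF field_closed_subst_field lin_indep_x_powers]
  unfolding lin_combs_x_powers by simp

end

subsection \<open>The function field as a quadratic extension\<close>

lemma lin_combs_pair: "lin_combs K [1, y] = {a + b * y | a b. a \<in> K \<and> b \<in> K}"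
  unfolding lin_combs_def
proof safe
  fix c assume "\<forall>i<length [1, y]. c i \<in> K"
  then show "\<exists>a b. (\<Sum>i<length [1, y]. c i * [1, y] ! i) = a + b * y \<and> a \<in> K \<and> b \<in> K"
    by (intro exI[of _ "c 0"] exI[of _ "c 1"]) simp
next
  fix a b assume "a \<in> K" "b \<in> K"
  then show "\<exists>c. a + b * y = (\<Sum>i<length [1, y]. c i * [1, y] ! i) \<and> (\<forall>i<length [1, y]. c i \<in> K)"
    by (intro exI[of _ "\<lambda>i. if i = 0 then a else b"]) simp
qed

lemma lin_indep_pair:
  assumes K: "field_closed K" and y: "y \<notin> K"
  shows "lin_indep K [1, y]"
  unfolding lin_indep_def
proof (intro allI impI)
  fix c :: "nat \<Rightarrow> 'a" and i
  assume "\<forall>i<length [1, y]. c i \<in> K" and "(\<Sum>i<length [1, y]. c i * [1, y] ! i) = 0" and i: "i < length [1, y]"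
  then have c: "c 0 \<in> K" "c 1 \<in> K" "c 0 + c 1 * y = 0" by simp_all
  have "c 1 = 0"
  proof (rule ccontr)
    assume "c 1 \<noteq> 0"
    then have "y = (- c 0) / c 1" using c(3) by (simp add: field_simps eq_neg_iff_add_eq_0)
    also have "\<dots> \<in> K" by (intro field_closed_props[OF K] c)
    finally show False using y by simp
  qed
  then show "c i = 0" using c(3) i by (cases i) auto
qed

context weierstrass_field
begin

text \<open>
  With $1, y$ independent over $k[x]$, the element $y$ cannot be a quotient of polynomials in $x$.
\<close>

lemma y_notin_range: "\<eta> \<notin> range to_ac"
proof
  assume "\<eta> \<in> range to_ac"
  then obtain s where "\<eta> = to_ac s" by blast
  moreover obtain a b where "s = Fract a b" "b \<noteq> 0" by (cases s) auto
  ultimately have "\<eta> = ff_poly a / ff_poly b" "b \<noteq> 0" by (simp_all add: to_ac_Fract)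
  then have "ff_poly (- a) + ff_poly b * \<eta> = 0" by simp
  then show False unfolding ff_linear_eq_0_iff using \<open>b \<noteq> 0\<close> by simp
qed

lemma function_field_eq: "function_field W = {a + b * \<eta> | a b. a \<in> range to_ac \<and> b \<in> range to_ac}"
proof
  note K = field_closed_range_to_ac
  note cl = field_closed_props[OF K]
  let ?V = "lin_combs (range to_ac) [1, \<eta>]"
  have FC: "field_closed (function_field W)"
    unfolding function_field_def by (rule field_closed_generate_field)
  have memF: "\<eta> \<in> function_field W" "range to_ac \<subseteq> function_field W"
    unfolding function_field_def by (auto intro: generate_field.incl)
  show "{a + b * \<eta> | a b. a \<in> range to_ac \<and> b \<in> range to_ac} \<subseteq> function_field W"
    using field_closed_props(3,5)[OF FC] memF by blast
  have base: "1 \<in> ?V" "\<eta> \<in> ?V" using lin_combs_base[OF K, of 0 "[1, \<eta>]"] lin_combs_base[OF K, of 1 "[1, \<eta>]"] by simp_all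
  have "\<eta> * \<eta> = ff_poly cub + (- ff_poly lin) * \<eta>"
    using \<eta>_eq by (simp add: power2_eq_square algebra_simps)
  then have sq: "\<eta> * \<eta> \<in> ?V" unfolding lin_combs_pair using cl(7) ff_poly_in_range by blast
  have m\<eta>: "z * \<eta> \<in> ?V" if "z \<in> ?V" for z
    by (rule lin_combs_mult[OF K _ that]) (use base sq in \<open>auto simp: less_Suc_eq\<close>)
  have mult: "z * w \<in> ?V" if "z \<in> ?V" "w \<in> ?V" for z w
    by (rule lin_combs_mult[OF K _ that(1)]) (use m\<eta>[OF that(2)] that(2) in \<open>auto simp: less_Suc_eq mult.commute\<close>)
  have "field_closed ?V"
    by (rule field_closed_lin_combs[OF K lin_indep_pair[OF K y_notin_range] mult base(1)])
  moreover have "insert \<eta> (range to_ac) \<subseteq> ?V"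
  proof -
    have "a \<in> ?V" if "a \<in> range to_ac" for a
      using lin_combs_scale[OF K that base(1)] by simp
    then show ?thesis using base(2) by blast
  qed
  ultimately have "function_field W \<subseteq> ?V"
    unfolding function_field_def by (rule generate_field_subset)
  then show "function_field W \<subseteq> {a + b * \<eta> | a b. a \<in> range to_ac \<and> b \<in> range to_ac}"
    unfolding lin_combs_pair .
qed

lemma field_closed_function_field: "field_closed (function_field W)"
  unfolding function_field_def by (rule field_closed_generate_field)

lemma y_in_function_field: "\<eta> \<in> function_field W"
  and range_subset_function_field: "range to_ac \<subseteq> function_field W"
  unfolding function_field_def by (auto intro: generate_field.incl)

lemma dimension_function_field: "ring.dimension ring_of_type_algebra 2 (range to_ac) (function_field W)"
  using dimension_lin_combs[OF field_closed_range_to_ac lin_indep_pair[OF field_closed_range_to_ac y_notin_range]]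
  unfolding lin_combs_pair function_field_eq by (simp add: numeral_2_eq_2)

end

section \<open>Values of rational functions and the pullback field\<close>

lemma infinite_UNIV_alg_closed: "infinite (UNIV :: 'b::alg_closed_field set)"
proof
  assume fin: "finite (UNIV :: 'b set)"
  define p where "p = (\<Prod>x\<in>(UNIV :: 'b set). [:- x, 1:]) + 1"
  have "degree (\<Prod>x\<in>(UNIV :: 'b set). [:- x, 1:]) = card (UNIV :: 'b set)"
    by (rule degree_prod_linear)
  moreover have "card (UNIV :: 'b set) > 0" using fin by (simp add: card_gt_0_iff)
  ultimately have "degree p > 0" unfolding p_def by (subst degree_add_eq_left) auto
  then obtain r where "poly p r = 0" using alg_closed_imp_poly_has_root by blast
  moreover have "poly (\<Prod>x\<in>(UNIV :: 'b set). [:- x, 1:]) r = 0"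
    unfolding poly_prod using fin by (intro prod_zero) auto
  ultimately show False by (simp add: p_def)
qed

context weierstrass_field
begin

abbreviation on_curve :: "'b alg_closure \<Rightarrow> 'b alg_closure \<Rightarrow> bool" where
  "on_curve \<equiv> on_weierstrass (base_change W)"

abbreviation value2 :: "'b poly poly \<Rightarrow> 'b alg_closure \<Rightarrow> 'b alg_closure \<Rightarrow> 'b alg_closure" where
  "value2 \<equiv> eval2 to_ac"

lemma on_curve_iff:
  "on_curve u v \<longleftrightarrow> v^2 + poly (map_poly to_ac lin) u * v = poly (map_poly to_ac cub) u"
  by (simp add: on_weierstrass_def lin_def cub_def map_poly_pCons weierstrass.map_sel
      algebra_simps power2_eq_square power3_eq_cube)

lemma value2_hom:
  "value2 (F + G) u v = value2 F u v + value2 G u v"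
  "value2 (F * G) u v = value2 F u v * value2 G u v"
  "value2 [:p:] u v = poly (map_poly to_ac p) u"
  using eval2_linear[OF to_ac.field_embedding_axioms, of p 0 u v]
  by (simp_all add: eval2_hom[OF to_ac.field_embedding_axioms])

lemma value2_diff: "value2 (F - G) u v = value2 F u v - value2 G u v"
  using value2_hom(1)[of "F - G" G u v] by simp

lemma value2_eq_0: "ev F = 0 \<Longrightarrow> on_curve u v \<Longrightarrow> value2 F u v = 0"
  by (rule eval2_eq_0_if_ev_eq_0[OF _ to_ac.field_embedding_axioms])

lemma value2_cong: "ev F = ev G \<Longrightarrow> on_curve u v \<Longrightarrow> value2 F u v = value2 G u v"
  using value2_eq_0[of "F - G" u v] by (simp add: ev_diff value2_diff)

lemma finite_points_over:
  assumes "finite U"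
  shows "finite {(u, v). on_curve u v \<and> u \<in> U}"
proof -
  let ?q = "\<lambda>u. [:- poly (map_poly to_ac cub) u, poly (map_poly to_ac lin) u, 1:]"
  have "{(u, v). on_curve u v \<and> u \<in> U} \<subseteq> Sigma U (\<lambda>u. {v. poly (?q u) v = 0})"
    by (auto simp: on_curve_iff algebra_simps power2_eq_square)
  moreover have "finite (Sigma U (\<lambda>u. {v. poly (?q u) v = 0}))"
    using assms by (intro finite_SigmaI poly_roots_finite) auto
  ultimately show ?thesis by (rule finite_subset)
qed

lemma ex_point_over: "\<exists>v. on_curve u v"
proof -
  have "\<exists>v. poly [:- poly (map_poly to_ac cub) u, poly (map_poly to_ac lin) u, 1:] v = 0"
    by (rule alg_closed_imp_poly_has_root) simp
  then show ?thesis by (auto simp: on_curve_iff algebra_simps power2_eq_square)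
qed

lemma infinite_curve: "infinite (curve_points (base_change W))"
proof
  assume "finite (curve_points (base_change W))"
  then have "finite (x_coord ` curve_points (base_change W))" by simp
  moreover have "range Some \<subseteq> x_coord ` curve_points (base_change W)"
  proof
    fix z assume "z \<in> range (Some :: 'b alg_closure \<Rightarrow> _)"
    then obtain u where "z = Some u" by blast
    moreover obtain v where "on_curve u v" using ex_point_over by blast
    ultimately show "z \<in> x_coord ` curve_points (base_change W)"
      by (intro image_eqI[of _ _ "Affine u v"]) (simp_all add: curve_points_def)
  qed
  ultimately have "finite (range (Some :: 'b alg_closure \<Rightarrow> _))" by (rule rev_finite_subset)
  then show False using infinite_UNIV_alg_closed by (auto dest: finite_imageD)
qed

text \<open>The norm of a nonzero function is a nonzero polynomial in $x$ that vanishes at the abscissas of the zeros.\<close>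

lemma finite_zeros:
  assumes "ev F \<noteq> 0"
  shows "finite {(u, v). on_curve u v \<and> value2 F u v = 0}"
proof -
  obtain Q p q where F: "F = Q * wpoly + [:p, q:]" by (rule reduce_mod_wpoly)
  have "ff_poly p + ff_poly q * \<eta> \<noteq> 0"
    using assms by (simp add: F ev_hom ev_wpoly ev_linear)
  then have pq: "p \<noteq> 0 \<or> q \<noteq> 0" by auto
  let ?N = "map_poly to_ac (nrm p q)"
  have "?N \<noteq> 0" using degree_nrm(1)[OF pq] by (simp add: to_ac.map_poly_hom_eq_0_iff)
  then have fin: "finite {u. poly ?N u = 0}" by (rule poly_roots_finite)
  have "poly ?N u = 0" if on: "on_curve u v" and z: "value2 F u v = 0" for u v
  proof -
    let ?p = "poly (map_poly to_ac p) u" and ?q = "poly (map_poly to_ac q) u"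
    let ?l = "poly (map_poly to_ac lin) u" and ?c = "poly (map_poly to_ac cub) u"
    have "?p + ?q * v = 0"
      using z value2_eq_0[OF ev_wpoly on]
      by (simp add: F value2_hom eval2_linear[OF to_ac.field_embedding_axioms])
    moreover have "poly ?N u = (?p + ?q * v) * (?p - ?q * (v + ?l)) + ?q^2 * (v^2 + ?l * v - ?c)"
      unfolding nrm_def to_ac.map_poly_diff to_ac.map_poly_mult to_ac.map_poly_power
        poly_diff poly_mult poly_power
      by (simp add: algebra_simps power2_eq_square)
    ultimately show ?thesis using on unfolding on_curve_iff by simp
  qed
  then have "{(u, v). on_curve u v \<and> value2 F u v = 0} \<subseteq> {(u, v). on_curve u v \<and> u \<in> {u. poly ?N u = 0}}"
    by auto
  then show ?thesis using finite_points_over[OF fin] by (rule finite_subset)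
qed

lemma has_value_iff:
  "has_value W h u v w \<longleftrightarrow> (\<exists>F G. h = ev F / ev G \<and> value2 G u v \<noteq> 0 \<and> w = value2 F u v / value2 G u v)"
  unfolding has_value_def ev_def ..

lemma has_valueE:
  assumes "has_value W h u v w" "on_curve u v"
  obtains F G where "h = ev F / ev G" "ev G \<noteq> 0" "value2 G u v \<noteq> 0" "w = value2 F u v / value2 G u v"
  using assms value2_eq_0 unfolding has_value_iff by blast

lemma has_value_poly: "has_value W (ff_poly p) u v (poly (map_poly to_ac p) u)"
  unfolding has_value_iff
  by (rule exI[of _ "[:p:]"], rule exI[of _ "[:1:]"]) (simp add: ev_const value2_hom)

lemma has_value_add:
  assumes "has_value W h u v w" "has_value W h' u v w'" "on_curve u v"
  shows "has_value W (h + h') u v (w + w')"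
proof -
  obtain F G F' G' where
    1: "h = ev F / ev G" "ev G \<noteq> 0" "value2 G u v \<noteq> 0" "w = value2 F u v / value2 G u v" and
    2: "h' = ev F' / ev G'" "ev G' \<noteq> 0" "value2 G' u v \<noteq> 0" "w' = value2 F' u v / value2 G' u v"
    using assms by (metis has_valueE)
  show ?thesis unfolding has_value_iff
    by (rule exI[of _ "F * G' + F' * G"], rule exI[of _ "G * G'"])
      (use 1 2 in \<open>simp add: ev_hom value2_hom add_frac_eq\<close>)
qed

lemma has_value_mult:
  assumes "has_value W h u v w" "has_value W h' u v w'" "on_curve u v"
  shows "has_value W (h * h') u v (w * w')"
proof -
  obtain F G F' G' where
    1: "h = ev F / ev G" "ev G \<noteq> 0" "value2 G u v \<noteq> 0" "w = value2 F u v / value2 G u v" and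
    2: "h' = ev F' / ev G'" "ev G' \<noteq> 0" "value2 G' u v \<noteq> 0" "w' = value2 F' u v / value2 G' u v"
    using assms by (metis has_valueE)
  show ?thesis unfolding has_value_iff
    by (rule exI[of _ "F * F'"], rule exI[of _ "G * G'"])
      (use 1 2 in \<open>simp add: ev_hom value2_hom\<close>)
qed

lemma has_value_inverse:
  assumes "has_value W h u v w" "w \<noteq> 0"
  shows "has_value W (inverse h) u v (inverse w)"
proof -
  obtain F G where 1: "h = ev F / ev G" "value2 G u v \<noteq> 0" "w = value2 F u v / value2 G u v"
    using assms unfolding has_value_iff by blast
  show ?thesis unfolding has_value_iff
    by (rule exI[of _ G], rule exI[of _ F]) (use 1 assms(2) in simp)
qed

lemma has_value_unique:
  assumes "has_value W h u v w" "has_value W h u v w'" "on_curve u v"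
  shows "w = w'"
proof -
  obtain F G F' G' where
    1: "h = ev F / ev G" "ev G \<noteq> 0" "value2 G u v \<noteq> 0" "w = value2 F u v / value2 G u v" and
    2: "h = ev F' / ev G'" "ev G' \<noteq> 0" "value2 G' u v \<noteq> 0" "w' = value2 F' u v / value2 G' u v"
    using assms by (metis has_valueE)
  have "ev F / ev G = ev F' / ev G'" using 1(1) 2(1) by simp
  then have "ev (F * G') = ev (F' * G)" using 1(2) 2(2) by (simp add: ev_hom frac_eq_eq)
  then have "value2 (F * G') u v = value2 (F' * G) u v" using assms(3) by (rule value2_cong)
  then show ?thesis using 1 2 by (simp add: value2_hom frac_eq_eq)
qed

lemma function_field_cases:
  assumes "h \<in> function_field W"
  obtains F G where "h = ev F / ev G" "ev G \<noteq> 0"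
proof -
  obtain r s where h: "h = to_ac r + to_ac s * \<eta>" using assms unfolding function_field_eq by blast
  obtain a b where ab: "r = Fract a b" "b \<noteq> 0" by (cases r) auto
  obtain c d where cd: "s = Fract c d" "d \<noteq> 0" by (cases s) auto
  have "h = ev [:a * d, c * b:] / ev [:b * d:]"
    unfolding h ab(1) cd(1) to_ac_Fract[OF ab(2)] to_ac_Fract[OF cd(2)] ev_linear ev_const
    using ab(2) cd(2) by (simp add: field_simps)
  then show ?thesis by (rule that) (use ab(2) cd(2) in \<open>simp add: ev_const\<close>)
qed

lemma finite_zero_values:
  assumes "h \<in> function_field W" "h \<noteq> 0"
  shows "finite {(u, v). on_curve u v \<and> has_value W h u v 0}"
proof -
  obtain F G where h: "h = ev F / ev G" "ev G \<noteq> 0" using function_field_cases[OF assms(1)] .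
  then have F: "ev F \<noteq> 0" using assms(2) by auto
  have "value2 F u v = 0" if on: "on_curve u v" and val: "has_value W h u v 0" for u v
  proof -
    obtain F' G' where
      1: "h = ev F' / ev G'" "ev G' \<noteq> 0" "value2 G' u v \<noteq> 0" "0 = value2 F' u v / value2 G' u v"
      using val on by (rule has_valueE)
    have "ev F / ev G = ev F' / ev G'" using h(1) 1(1) by simp
    then have "ev (F * G') = ev (F' * G)" using h(2) 1(2) by (simp add: ev_hom frac_eq_eq)
    then have "value2 (F * G') u v = value2 (F' * G) u v" using on by (rule value2_cong)
    then show ?thesis using 1 by (simp add: value2_hom)
  qed
  then have "{(u, v). on_curve u v \<and> has_value W h u v 0} \<subseteq> {(u, v). on_curve u v \<and> value2 F u v = 0}"
    by auto
  then show ?thesis using finite_zeros[OF F] by (rule finite_subset)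
qed

end

locale curve_map_over_fraction =
  weierstrass_field E + polynomial_like_fraction S
  for E :: "'a::field weierstrass" and S :: "'a poly fract" +
  fixes \<phi> :: "'a alg_closure ec_point \<Rightarrow> 'a alg_closure ec_point"
  assumes maps_curve: "\<phi> \<in> curve_points (base_change E) \<rightarrow> curve_points (base_change E)"
    and x_map: "is_x_coordinate_map E \<phi> S"
begin

definition almost_all :: "('a alg_closure ec_point \<Rightarrow> bool) \<Rightarrow> bool" where
  "almost_all P \<longleftrightarrow> finite {R \<in> curve_points (base_change E). \<not> P R}"

lemma almost_all_mono:
  "almost_all P \<Longrightarrow> (\<And>R. R \<in> curve_points (base_change E) \<Longrightarrow> P R \<Longrightarrow> Q R) \<Longrightarrow> almost_all Q"
  unfolding almost_all_def by (rule finite_subset[rotated]) auto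

lemma almost_all_conj: "almost_all P \<Longrightarrow> almost_all Q \<Longrightarrow> almost_all (\<lambda>R. P R \<and> Q R)"
  unfolding almost_all_def
  by (rule finite_subset[OF _ finite_UnI, of _ "{R \<in> curve_points (base_change E). \<not> P R}"
      "{R \<in> curve_points (base_change E). \<not> Q R}"]) auto

lemma not_almost_all_False: "\<not> almost_all (\<lambda>R. False)"
  unfolding almost_all_def using infinite_curve by simp

lemma finite_affine_points:
  "finite {(u, v). on_curve u v \<and> P u v} \<Longrightarrow>
   finite {R \<in> curve_points (base_change E). \<exists>u v. R = Affine u v \<and> P u v}"
  by (rule finite_subset[OF _ finite_imageI[where h = "\<lambda>(u, v). Affine u v"]])
     (auto simp: curve_points_def)

text \<open>
  Coordinates of a point and of its image, away from infinity and from the poles of $S$.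
\<close>

definition affine_pair where
  "affine_pair R u v u' v' \<longleftrightarrow> R = Affine u v \<and> \<phi> R = Affine u' v' \<and> on_curve u v \<and> on_curve u' v' \<and>
     poly (map_poly to_ac B) u \<noteq> 0 \<and> u' = poly (map_poly to_ac A) u / poly (map_poly to_ac B) u"

lemma almost_all_affine_pair: "almost_all (\<lambda>R. \<exists>u v u' v'. affine_pair R u v u' v')"
proof -
  let ?pts = "curve_points (base_change E)"
  let ?b = "map_poly to_ac B"
  have "finite {u. poly ?b u = 0}"
    using B_nz by (intro poly_roots_finite) (simp add: to_ac.map_poly_hom_eq_0_iff)
  then have "finite {(u, v). on_curve u v \<and> poly ?b u = 0}"
    using finite_points_over[of "{u. poly ?b u = 0}"] by simp
  then have fin: "finite {R \<in> ?pts. \<exists>u v. R = Affine u v \<and> poly ?b u = 0}" by (rule finite_affine_points)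
  have "\<exists>u v u' v'. affine_pair R u v u' v'"
    if R: "R \<in> ?pts" "R \<noteq> Infinity" "\<not> (\<exists>u v. R = Affine u v \<and> poly ?b u = 0)" for R
  proof -
    obtain u v where uv: "R = Affine u v" using R(2) by (cases R) auto
    have b: "poly ?b u \<noteq> 0" using R(3) uv by blast
    have "x_coord (\<phi> R) = Some (poly (map_poly to_ac A) u / poly ?b u)"
      using x_map R(1) b unfolding is_x_coordinate_map_def uv by auto
    then obtain v' where v': "\<phi> R = Affine (poly (map_poly to_ac A) u / poly ?b u) v'" by (cases "\<phi> R") auto
    have "\<phi> R \<in> ?pts" using maps_curve R(1) by blast
    then have "affine_pair R u v (poly (map_poly to_ac A) u / poly ?b u) v'"
      using uv v' b R(1) unfolding affine_pair_def by (auto simp: curve_points_def)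
    then show ?thesis by blast
  qed
  then have "{R \<in> ?pts. \<not> (\<exists>u v u' v'. affine_pair R u v u' v')} \<subseteq>
      insert Infinity {R \<in> ?pts. \<exists>u v. R = Affine u v \<and> poly ?b u = 0}" by blast
  then show ?thesis unfolding almost_all_def using fin by (meson finite_insert finite_subset)
qed

text \<open>
  The pointwise relation $h(R) = g(\varphi(R))$, with both sides regular; it holds for almost all points exactly if
  \<open>h\<close> is the pullback of \<open>g\<close>.
\<close>

definition agree :: "'a ff \<Rightarrow> 'a ff \<Rightarrow> 'a alg_closure ec_point \<Rightarrow> bool" where
  "agree g h R \<longleftrightarrow> (\<exists>u v u' v' w. affine_pair R u v u' v' \<and> has_value E g u' v' w \<and> has_value E h u v w)"

lemma is_pullback_iff: "is_pullback E \<phi> g h \<longleftrightarrow> almost_all (agree g h)"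
proof
  assume "is_pullback E \<phi> g h"
  then have "almost_all (\<lambda>R. \<exists>u v u' v' w. R = Affine u v \<and> \<phi> R = Affine u' v' \<and>
                         has_value E g u' v' w \<and> has_value E h u v w)"
    unfolding is_pullback_def almost_all_def .
  from almost_all_conj[OF this almost_all_affine_pair] show "almost_all (agree g h)"
    by (rule almost_all_mono) (auto simp: agree_def affine_pair_def)
next
  assume "almost_all (agree g h)"
  then have "almost_all (\<lambda>R. \<exists>u v u' v' w. R = Affine u v \<and> \<phi> R = Affine u' v' \<and>
                         has_value E g u' v' w \<and> has_value E h u v w)"
    by (rule almost_all_mono) (unfold agree_def affine_pair_def, blast)
  then show "is_pullback E \<phi> g h" unfolding is_pullback_def almost_all_def .
qed

lemma agree_pointwise:
  assumes "agree g h R" "agree g' h' R"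
  shows "agree (g + g') (h + h') R" "agree (g * g') (h * h') R"
proof -
  obtain u v u' v' w where 1: "affine_pair R u v u' v'" "has_value E g u' v' w" "has_value E h u v w"
    using assms(1) unfolding agree_def by blast
  obtain s t s' t' z where 2: "affine_pair R s t s' t'" "has_value E g' s' t' z" "has_value E h' s t z"
    using assms(2) unfolding agree_def by blast
  have "s = u" "t = v" "s' = u'" "t' = v'" using 1(1) 2(1) unfolding affine_pair_def by auto
  note 2 = 2[unfolded this]
  have on: "on_curve u v" "on_curve u' v'" using 1(1) unfolding affine_pair_def by auto
  show "agree (g + g') (h + h') R"
    unfolding agree_def using 1(1) has_value_add[OF 1(2) 2(2) on(2)] has_value_add[OF 1(3) 2(3) on(1)] by blast
  show "agree (g * g') (h * h') R"
    unfolding agree_def using 1(1) has_value_mult[OF 1(2) 2(2) on(2)] has_value_mult[OF 1(3) 2(3) on(1)] by blast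
qed

lemma is_pullback_add: "is_pullback E \<phi> g h \<Longrightarrow> is_pullback E \<phi> g' h' \<Longrightarrow> is_pullback E \<phi> (g + g') (h + h')"
  unfolding is_pullback_iff
  by (rule almost_all_mono[OF almost_all_conj, of "agree g h" "agree g' h'"]) (auto intro: agree_pointwise)

lemma is_pullback_mult: "is_pullback E \<phi> g h \<Longrightarrow> is_pullback E \<phi> g' h' \<Longrightarrow> is_pullback E \<phi> (g * g') (h * h')"
  unfolding is_pullback_iff
  by (rule almost_all_mono[OF almost_all_conj, of "agree g h" "agree g' h'"]) (auto intro: agree_pointwise)

lemma is_pullback_const: "is_pullback E \<phi> (ff_const c) (ff_const c)"
  unfolding is_pullback_iff
proof (rule almost_all_mono[OF almost_all_affine_pair])
  fix R assume "\<exists>u v u' v'. affine_pair R u v u' v'"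
  moreover have "has_value E (ff_const c) u v (to_ac c)" for u v
    using has_value_poly[of "[:c:]" u v] by (simp add: ff_const_eq map_poly_pCons)
  ultimately show "agree (ff_const c) (ff_const c) R" unfolding agree_def by blast
qed

lemma is_pullback_x: "is_pullback E \<phi> ff_x (to_ac S)"
  unfolding is_pullback_iff
proof (rule almost_all_mono[OF almost_all_affine_pair])
  fix R assume "\<exists>u v u' v'. affine_pair R u v u' v'"
  then obtain u v u' v' where ap: "affine_pair R u v u' v'" by blast
  have "has_value E ff_x u' v' u'"
    using has_value_poly[of "[:0, 1:]" u' v'] by (simp add: ff_x_eq map_poly_pCons)
  moreover have "has_value E (to_ac S) u v u'"
  proof -
    have "has_value E (ff_poly A * inverse (ff_poly B)) u v
       (poly (map_poly to_ac A) u * inverse (poly (map_poly to_ac B) u))"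
      using ap unfolding affine_pair_def by (intro has_value_mult has_value_poly has_value_inverse) auto
    then show ?thesis using ap unfolding affine_pair_def to_ac_S divide_inverse by simp
  qed
  ultimately show "agree ff_x (to_ac S) R" unfolding agree_def using ap by blast
qed

lemma almost_all_no_zero:
  assumes "h \<in> function_field E" "h \<noteq> 0"
  shows "almost_all (\<lambda>R. \<not> (\<exists>u v. R = Affine u v \<and> has_value E h u v 0))"
  using finite_affine_points[OF finite_zero_values[OF assms]] unfolding almost_all_def by simp

lemma is_pullback_inverse:
  assumes "is_pullback E \<phi> g h" "h \<in> function_field E" "h \<noteq> 0"
  shows "is_pullback E \<phi> (inverse g) (inverse h)"
  unfolding is_pullback_iff
proof (rule almost_all_mono[OF almost_all_conj])
  show "almost_all (agree g h)" using assms(1) by (simp add: is_pullback_iff)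
  show "almost_all (\<lambda>R. \<not> (\<exists>u v. R = Affine u v \<and> has_value E h u v 0))" by (rule almost_all_no_zero[OF assms(2,3)])
  fix R assume "agree g h R \<and> \<not> (\<exists>u v. R = Affine u v \<and> has_value E h u v 0)"
  then obtain u v u' v' w where 1: "affine_pair R u v u' v'" "has_value E g u' v' w" "has_value E h u v w" "w \<noteq> 0"
    unfolding agree_def affine_pair_def by blast
  then show "agree (inverse g) (inverse h) R" unfolding agree_def using has_value_inverse by blast
qed

text \<open>
  The difference of two pullbacks of the same function has the value 0 at almost all points, but a nonzero
  function has finitely many zeros.
\<close>

lemma is_pullback_unique:
  assumes "is_pullback E \<phi> g h" "is_pullback E \<phi> g h'" "h \<in> function_field E" "h' \<in> function_field E"
  shows "h = h'"
proof (rule ccontr)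
  assume "h \<noteq> h'"
  note cl = field_closed_props[OF field_closed_function_field]
  have "is_pullback E \<phi> (g + ff_const (- 1) * g) (h + ff_const (- 1) * h')"
    by (intro is_pullback_add is_pullback_mult is_pullback_const assms)
  then have z: "almost_all (agree 0 (h - h'))"
    by (simp add: is_pullback_iff ff_const.hom_minus ff_const.hom_1)
  have "almost_all (\<lambda>R. \<not> (\<exists>u v. R = Affine u v \<and> has_value E (h - h') u v 0))"
    using \<open>h \<noteq> h'\<close> by (intro almost_all_no_zero cl assms) simp
  from almost_all_conj[OF z this] have "almost_all (\<lambda>R. False)"
  proof (rule almost_all_mono)
    fix R assume R: "agree 0 (h - h') R \<and> \<not> (\<exists>u v. R = Affine u v \<and> has_value E (h - h') u v 0)"
    then obtain u v u' v' w where 1: "affine_pair R u v u' v'" "has_value E 0 u' v' w" "has_value E (h - h') u v w"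
      unfolding agree_def by blast
    have "has_value E 0 u' v' 0" using has_value_poly[of 0 u' v'] by simp
    then have "w = 0" using has_value_unique 1(1,2) unfolding affine_pair_def by blast
    then show False using R 1 unfolding affine_pair_def by blast
  qed
  then show False using not_almost_all_False by blast
qed

lemma is_pullback_subst: "is_pullback E \<phi> (ff_poly p) (subst p)"
proof (induction p)
  case 0
  show ?case using is_pullback_const[of 0] by (simp add: subst_0 ff_const.hom_0)
next
  case (pCons c p)
  have "subst (pCons c p) = ff_const c + to_ac S * subst p"
    by (simp add: subst_def map_poly_pCons ff_const.hom_0)
  moreover have "ff_poly (pCons c p) = ff_const c + ff_x * ff_poly p"
    by (simp add: ff_const_eq ff_x_eq flip: ff_poly_add ff_poly_mult)
  ultimately show ?case
    using is_pullback_add[OF is_pullback_const is_pullback_mult[OF is_pullback_x pCons.IH]] by simp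
qed

lemma subst_field_subset_function_field: "subst_field \<subseteq> function_field E"
  using subst_field_subset range_subset_function_field by blast

lemma is_pullback_quotient:
  assumes "q \<noteq> 0"
  shows "is_pullback E \<phi> (ff_poly p / ff_poly q) (subst p / subst q)"
  unfolding divide_inverse using assms subst_in_subst_field subst_field_subset_function_field
  by (intro is_pullback_mult is_pullback_inverse is_pullback_subst) (auto simp: subst_eq_0_iff)

lemma ex_pullback_of_range:
  assumes "a \<in> range to_ac"
  obtains a' where "a' \<in> subst_field" "is_pullback E \<phi> a a'" "a' = 0 \<longrightarrow> a = 0"
proof -
  obtain r where "a = to_ac r" using assms by blast
  moreover obtain p q where "r = Fract p q" "q \<noteq> 0" by (cases r) auto
  ultimately have a: "a = ff_poly p / ff_poly q" "q \<noteq> 0" by (simp_all add: to_ac_Fract)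
  show ?thesis
  proof (rule that)
    show "subst p / subst q \<in> subst_field" unfolding subst_field_def using a(2) by blast
    show "is_pullback E \<phi> a (subst p / subst q)" unfolding a(1) using a(2) by (rule is_pullback_quotient)
    show "subst p / subst q = 0 \<longrightarrow> a = 0" using a by (auto simp: subst_eq_0_iff)
  qed
qed

lemma subst_field_subset_pullback_field: "subst_field \<subseteq> pullback_field E \<phi>"
proof
  fix h assume h: "h \<in> subst_field"
  then obtain p q where pq: "h = subst p / subst q" "q \<noteq> 0" unfolding subst_field_def by blast
  have "ff_poly p / ff_poly q \<in> function_field E"
    using ff_poly_in_range range_subset_function_field
    by (intro field_closed_props(6)[OF field_closed_function_field]) auto
  then show "h \<in> pullback_field E \<phi>"
    unfolding pullback_field_def using h subst_field_subset_function_field is_pullback_quotient[OF pq(2)] pq(1)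
    by blast
qed

lemma field_closed_pullback_field: "field_closed (pullback_field E \<phi>)"
  unfolding field_closed_def
proof (intro conjI ballI)
  note cl = field_closed_props[OF field_closed_function_field]
  show "1 \<in> pullback_field E \<phi>"
    using subst_field_subset_pullback_field field_closed_props(1)[OF field_closed_subst_field] by blast
  fix x assume "x \<in> pullback_field E \<phi>"
  then obtain g where x: "x \<in> function_field E" "g \<in> function_field E" "is_pullback E \<phi> g x"
    unfolding pullback_field_def by blast
  have "is_pullback E \<phi> (ff_const (-1) * g) (ff_const (-1) * x)"
    by (intro is_pullback_mult is_pullback_const x)
  then have "is_pullback E \<phi> (- g) (- x)" by (simp add: ff_const.hom_minus ff_const.hom_1)
  then show "- x \<in> pullback_field E \<phi>" unfolding pullback_field_def using x cl(7) by blast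
  show "inverse x \<in> pullback_field E \<phi>"
  proof (cases "x = 0")
    case False
    then show ?thesis unfolding pullback_field_def
      using is_pullback_inverse[OF x(3,1)] cl(8) x(1,2) by blast
  qed (use \<open>x \<in> pullback_field E \<phi>\<close> in simp)
  fix y assume "y \<in> pullback_field E \<phi>"
  then obtain g' where y: "y \<in> function_field E" "g' \<in> function_field E" "is_pullback E \<phi> g' y"
    unfolding pullback_field_def by blast
  show "x + y \<in> pullback_field E \<phi>" unfolding pullback_field_def
    using is_pullback_add[OF x(3) y(3)] cl(3) x(1,2) y(1,2) by blast
  show "x * y \<in> pullback_field E \<phi>" unfolding pullback_field_def
    using is_pullback_mult[OF x(3) y(3)] cl(5) x(1,2) y(1,2) by blast
qed

text \<open>
  Pullbacks of functions of $x$ are the elements of $k(S)$. Once a function $a + b y$ with $b \neq 0$ has a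
  pullback, so has $y$, and then the pullback of every function is determined by that of $y$.
\<close>

lemma pullback_field_cases:
  obtains "pullback_field E \<phi> = subst_field"
  | y where "y \<notin> subst_field" "pullback_field E \<phi> = lin_combs subst_field [1, y]"
proof -
  note cl = field_closed_props[OF field_closed_function_field]
  note clp = field_closed_props[OF field_closed_pullback_field]
  note L = subst_field_subset_pullback_field
  have split: "\<exists>a b. g = a + b * \<eta> \<and> a \<in> range to_ac \<and> b \<in> range to_ac" if "g \<in> function_field E" for g
    using that unfolding function_field_eq by blast
  have inF: "h \<in> function_field E" if "h \<in> subst_field" for h
    using that subst_field_subset_function_field by blast
  show ?thesis
  proof (cases "\<exists>a b h. a \<in> range to_ac \<and> b \<in> range to_ac \<and> b \<noteq> 0 \<and> h \<in> function_field E \<and>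
       is_pullback E \<phi> (a + b * \<eta>) h")
    case False
    have "pullback_field E \<phi> \<subseteq> subst_field"
    proof
      fix h assume "h \<in> pullback_field E \<phi>"
      then obtain g where g: "h \<in> function_field E" "g \<in> function_field E" "is_pullback E \<phi> g h"
        unfolding pullback_field_def by blast
      then obtain a b where ab: "g = a + b * \<eta>" "a \<in> range to_ac" "b \<in> range to_ac" using split by blast
      then have "b = 0" using False g by blast
      then have "is_pullback E \<phi> a h" using ab g by simp
      moreover obtain a' where "a' \<in> subst_field" "is_pullback E \<phi> a a'" using ex_pullback_of_range[OF ab(2)] .
      ultimately show "h \<in> subst_field" using is_pullback_unique g(1) inF by blast
    qed
    then show ?thesis using L that(1) by blast
  next
    case True
    then obtain a b h where ab: "a \<in> range to_ac" "b \<in> range to_ac" "b \<noteq> 0" "h \<in> function_field E"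
      and pb: "is_pullback E \<phi> (a + b * \<eta>) h" by blast
    obtain a' where a': "a' \<in> subst_field" "is_pullback E \<phi> a a'" using ex_pullback_of_range[OF ab(1)] .
    obtain b' where b': "b' \<in> subst_field" "is_pullback E \<phi> b b'" "b' = 0 \<longrightarrow> b = 0"
      using ex_pullback_of_range[OF ab(2)] .
    \<comment> \<open>The pullback of the coordinate function y.\<close>
    define Y where "Y = (h + ff_const (- 1) * a') * inverse b'"
    have "is_pullback E \<phi> ((a + b * \<eta> + ff_const (- 1) * a) * inverse b) Y"
      unfolding Y_def using b' ab(3) inF
      by (intro is_pullback_mult is_pullback_add is_pullback_inverse is_pullback_const pb a') auto
    moreover have "(a + b * \<eta> + ff_const (- 1) * a) * inverse b = \<eta>"
      using ab(3) by (simp add: ff_const.hom_minus ff_const.hom_1)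
    ultimately have Y: "is_pullback E \<phi> \<eta> Y" by simp
    have "ff_const (- 1) \<in> function_field E"
      using ff_poly_in_range range_subset_function_field unfolding ff_const_eq by blast
    then have YF: "Y \<in> function_field E" unfolding Y_def
      using ab(4) inF[OF a'(1)] inF[OF b'(1)] by (intro cl(3,5,8))
    have Ypb: "Y \<in> pullback_field E \<phi>" unfolding pullback_field_def using YF y_in_function_field Y by blast
    have eq: "pullback_field E \<phi> = lin_combs subst_field [1, Y]"
    proof
      show "lin_combs subst_field [1, Y] \<subseteq> pullback_field E \<phi>"
        unfolding lin_combs_pair using L clp(3,5) Ypb by blast
      show "pullback_field E \<phi> \<subseteq> lin_combs subst_field [1, Y]"
      proof
        fix z assume "z \<in> pullback_field E \<phi>"
        then obtain g where g: "z \<in> function_field E" "g \<in> function_field E" "is_pullback E \<phi> g z"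
          unfolding pullback_field_def by blast
        then obtain c d where cd: "g = c + d * \<eta>" "c \<in> range to_ac" "d \<in> range to_ac" using split by blast
        obtain c' where c': "c' \<in> subst_field" "is_pullback E \<phi> c c'" using ex_pullback_of_range[OF cd(2)] .
        obtain d' where d': "d' \<in> subst_field" "is_pullback E \<phi> d d'" using ex_pullback_of_range[OF cd(3)] .
        have "is_pullback E \<phi> g (c' + d' * Y)"
          unfolding cd(1) by (intro is_pullback_add is_pullback_mult c' d' Y)
        moreover have "c' + d' * Y \<in> function_field E" by (intro cl(3,5) inF c' d' YF)
        ultimately have "z = c' + d' * Y" using is_pullback_unique[OF g(3) _ g(1)] by blast
        then show "z \<in> lin_combs subst_field [1, Y]" unfolding lin_combs_pair using c' d' by blast
      qed
    qed
    show ?thesis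
    proof (cases "Y \<in> subst_field")
      case True
      then have "pullback_field E \<phi> \<subseteq> subst_field"
        unfolding eq lin_combs_pair using field_closed_props(3,5)[OF field_closed_subst_field] by blast
      then show ?thesis using L that(1) by blast
    next
      case False
      then show ?thesis using eq that(2) by blast
    qed
  qed
qed

text \<open>
  If $n \le 2$ is the degree of the pullback field over $k(S)$, then $n$ times the degree of $\varphi$ is $2 \deg A$;
  an odd degree of $\varphi$ leaves only $n = 2$.
\<close>

lemma odd_degree_numerator:
  assumes "odd (endo_degree E \<phi>)"
  shows "odd (degree A)"
proof -
  note L = field_closed_subst_field
  let ?R = "ring_of_type_algebra :: 'a ff ring"
  have FL: "ring.dimension ?R (degree A * 2) subst_field (function_field E)"
    by (rule dimension_tower[OF L field_closed_range_to_ac dimension_subst_field dimension_function_field])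
  have "\<exists>n. n \<le> 2 \<and> ring.dimension ?R n subst_field (pullback_field E \<phi>)"
  proof (rule pullback_field_cases)
    assume "pullback_field E \<phi> = subst_field"
    then show ?thesis using dimension_self[OF L] by (intro exI[of _ 1]) simp
  next
    fix y assume y: "y \<notin> subst_field" "pullback_field E \<phi> = lin_combs subst_field [1, y]"
    then show ?thesis using dimension_lin_combs[OF L lin_indep_pair[OF L y(1)]]
      by (intro exI[of _ 2]) (simp add: numeral_2_eq_2)
  qed
  then obtain n where n: "n \<le> 2" "ring.dimension ?R n subst_field (pullback_field E \<phi>)" by blast
  have "n * ring.dim ?R (pullback_field E \<phi>) (function_field E) = degree A * 2"
  proof (rule dim_over_intermediate_field[OF L field_closed_pullback_field n(2) FL subst_field_subset_pullback_field])
    show "x * y \<in> function_field E" if "x \<in> pullback_field E \<phi>" "y \<in> function_field E" for x y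
      using that field_closed_props(5)[OF field_closed_function_field] unfolding pullback_field_def by blast
  qed
  moreover have "endo_degree E \<phi> = ring.dim ?R (pullback_field E \<phi>) (function_field E)"
    using assms unfolding endo_degree_def by (auto split: if_splits)
  ultimately have eq: "n * endo_degree E \<phi> = degree A * 2" by simp
  then have "even n" using assms by (metis even_mult_iff dvd_triv_right)
  moreover have "degree A > 0" using degree_less by simp
  ultimately have "n = 2" using n(1) eq by (cases "n = 0"; cases "n = 1") auto
  then have "endo_degree E \<phi> = degree A" using eq by simp
  then show ?thesis using assms by simp
qed

end

section \<open>Orbits in towers of preimages\<close>

text \<open>
  The group is written multiplicatively; \<open>g\<close> generates the kernel of $\varphi^2$.
\<close>

locale cyclic_tower = comm_group G for G (structure) +
  fixes \<phi> :: "'a \<Rightarrow> 'a" and m :: nat and g :: 'a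
  assumes hom: "\<phi> \<in> hom G G"
    and card_kernel: "card (kernel G G \<phi>) = m" and m_pos: "m > 0"
    and g: "g \<in> carrier G" "\<phi> (\<phi> g) = \<one>"
    and cyclic: "\<And>x. x \<in> carrier G \<Longrightarrow> \<phi> (\<phi> x) = \<one> \<Longrightarrow> \<exists>i::int. x = g [^] i"
begin

sublocale \<phi>: group_hom G G \<phi>
  by unfold_locales (rule hom)

lemma kernelI: "x \<in> carrier G \<Longrightarrow> \<phi> x = \<one> \<Longrightarrow> x \<in> kernel G G \<phi>"
  by (simp add: kernel_def)

lemma kernelD: "x \<in> kernel G G \<phi> \<Longrightarrow> x \<in> carrier G" "x \<in> kernel G G \<phi> \<Longrightarrow> \<phi> x = \<one>"
  by (simp_all add: kernel_def)

definition order_m :: "'a \<Rightarrow> bool" where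
  "order_m t \<longleftrightarrow> t \<in> carrier G \<and> (\<forall>j::int. t [^] j = \<one> \<longleftrightarrow> int m dvd j)"

lemma kernel_pow: "x \<in> kernel G G \<phi> \<Longrightarrow> x [^] int m = \<one>"
proof -
  assume x: "x \<in> kernel G G \<phi>"
  interpret K: group "G\<lparr>carrier := kernel G G \<phi>\<rparr>"
    by (rule subgroup.subgroup_is_group[OF \<phi>.subgroup_kernel]) (rule group_axioms)
  have "x [^]\<^bsub>G\<lparr>carrier := kernel G G \<phi>\<rparr>\<^esub> Coset.order (G\<lparr>carrier := kernel G G \<phi>\<rparr>) = \<one>"
    using K.pow_order_eq_1[of x] x by simp
  then have "x [^] m = \<one>" by (simp add: Coset.order_def card_kernel nat_pow_consistent[symmetric])
  then show ?thesis by (simp add: int_pow_int)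
qed

lemma int_pow_eq_one_mult: "x \<in> carrier G \<Longrightarrow> x [^] (i::int) = \<one> \<Longrightarrow> x [^] (i * j) = \<one>"
  using int_pow_pow[of x i j] by simp

text \<open>
  With $j$ also $\gcd(j, m)$ is an exponent that kills the element, so that only divisors of $m$ need to be considered.
\<close>

lemma order_mI:
  assumes "x \<in> carrier G" "x [^] int m = \<one>"
    and "\<And>d :: nat. d > 0 \<Longrightarrow> d dvd m \<Longrightarrow> x [^] int d = \<one> \<Longrightarrow> d = m"
  shows "order_m x"
  unfolding order_m_def
proof (intro conjI allI iffI)
  fix j :: int
  show "x [^] j = \<one>" if "int m dvd j"
    using that int_pow_eq_one_mult[OF assms(1,2)] by (auto elim!: dvdE)
  assume j: "x [^] j = \<one>"
  obtain u v where uv: "u * j + v * int m = gcd j (int m)" using bezout_int by blast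
  have "x [^] (j * u + int m * v) = \<one>"
    using assms(1) int_pow_eq_one_mult[OF assms(1) j, of u] int_pow_eq_one_mult[OF assms(1,2), of v]
    by (simp add: int_pow_mult)
  then have "x [^] int (nat (gcd j (int m))) = \<one>" using uv by (simp add: mult.commute)
  moreover have "nat (gcd j (int m)) > 0" using m_pos by simp
  moreover have "nat (gcd j (int m)) dvd m" by (simp add: nat_dvd_iff int_dvd_int_iff[symmetric] del: int_dvd_int_iff)
  ultimately have "nat (gcd j (int m)) = m" using assms(3) by blast
  then have "gcd j (int m) = int m" by (metis gcd_ge_0_int int_nat_eq)
  then show "int m dvd j" by (metis gcd_dvd1)
qed (fact assms(1))

lemma kernel_generated:
  assumes "x \<in> kernel G G \<phi>" "\<And>y. y \<in> kernel G G \<phi> \<Longrightarrow> \<exists>i::int. y = x [^] i"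
  shows "order_m x"
proof (rule order_mI)
  show x: "x \<in> carrier G" and "x [^] int m = \<one>" using kernelD(1) kernel_pow assms(1) by auto
  fix d :: nat assume d: "d > 0" "d dvd m" "x [^] int d = \<one>"
  have sub: "kernel G G \<phi> \<subseteq> (\<lambda>i. x [^] int i) ` {..<d}"
  proof
    fix y assume "y \<in> kernel G G \<phi>"
    then obtain i :: int where y: "y = x [^] i" using assms(2) by blast
    have "x [^] i = x [^] (i mod int d + int d * (i div int d))" by simp
    also have "\<dots> = x [^] (i mod int d)"
      using x int_pow_eq_one_mult[OF x d(3)] by (simp only: int_pow_mult int_pow_closed r_one)
    also have "\<dots> = x [^] int (nat (i mod int d))" using d(1) by simp
    finally show "y \<in> (\<lambda>i. x [^] int i) ` {..<d}" unfolding y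
      using d(1) by (intro image_eqI[of _ _ "nat (i mod int d)"]) (auto simp: nat_less_iff)
  qed
  have "m \<le> d" using card_mono[OF _ sub] card_image_le[of "{..<d}" "\<lambda>i. x [^] int i"]
    by (simp add: card_kernel)
  then show "d = m" using d(2) m_pos by (simp add: dvd_imp_le le_antisym)
qed

text \<open>
  An element $s$ of $\ker\varphi^2 = \langle g\rangle$ with $\varphi(s)$ of order $m$ is a power $g^a$ with $a$ prime
  to $m$; as $g^m$ generates $\ker\varphi$, the power $s^m$ generates $\ker\varphi$ too.
\<close>

lemma order_m_pow:
  assumes s: "s \<in> carrier G" "\<phi> (\<phi> s) = \<one>" and ord: "order_m (\<phi> s)"
  shows "order_m (s [^] int m)" and "\<phi> (s [^] int m) = \<one>"
proof -
  obtain a :: int where a: "s = g [^] a" using cyclic[OF s] by blast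
  let ?h = "\<phi> g"
  have h: "?h \<in> carrier G" "?h \<in> kernel G G \<phi>" using g by (auto intro: kernelI)
  have \<phi>s: "\<phi> s = ?h [^] a" unfolding a using g(1) by (rule \<phi>.hom_int_pow)
  have oh: "?h [^] j = \<one> \<longleftrightarrow> int m dvd j" for j :: int
  proof
    assume "?h [^] j = \<one>"
    then have "\<phi> s [^] j = \<one>"
      unfolding \<phi>s int_pow_pow[OF h(1)] using int_pow_eq_one_mult[OF h(1), of j a] by (simp add: mult.commute)
    then show "int m dvd j" using ord unfolding order_m_def by blast
  next
    assume "int m dvd j"
    then show "?h [^] j = \<one>" using int_pow_eq_one_mult[OF h(1) kernel_pow[OF h(2)]] by (auto elim!: dvdE)
  qed
  have "coprime a (int m)"
  proof -
    let ?d = "gcd a (int m)"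
    obtain a' m' where am: "a = ?d * a'" "int m = ?d * m'" by (metis dvdE gcd_dvd1 gcd_dvd2)
    have "\<phi> s [^] m' = ?h [^] (a * m')" unfolding \<phi>s by (rule int_pow_pow[OF h(1)])
    also have "a * m' = ?d * m' * a'" by (subst am(1)) (simp add: mult_ac)
    also have "\<dots> = int m * a'" by (rule arg_cong[OF am(2)[symmetric], of "\<lambda>z. z * a'"])
    also have "?h [^] (int m * a') = \<one>" by (rule int_pow_eq_one_mult[OF h(1) kernel_pow[OF h(2)]])
    finally have "int m dvd m'" using ord unfolding order_m_def by blast
    have "?d > 0" using m_pos by simp
    have "?d * m' > 0" using am(2) m_pos by linarith
    then have "m' > 0" using \<open>?d > 0\<close> by (rule zero_less_mult_pos)
    with \<open>int m dvd m'\<close> have "int m \<le> m'" by (rule zdvd_imp_le)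
    then have "?d * m' \<le> 1 * m'" using am(2) by simp
    then have "?d \<le> 1" using \<open>m' > 0\<close> by (simp only: mult_le_cancel_right_pos)
    then have "?d = 1" using \<open>?d > 0\<close> by linarith
    then show ?thesis by (simp add: coprime_iff_gcd_eq_1)
  qed
  let ?u = "g [^] int m"
  have u: "?u \<in> carrier G" using g by simp
  have "order_m ?u"
  proof (rule kernel_generated)
    show "?u \<in> kernel G G \<phi>" using g h oh by (intro kernelI) (simp_all add: \<phi>.hom_int_pow)
    fix y assume y: "y \<in> kernel G G \<phi>"
    then obtain i :: int where i: "y = g [^] i" using cyclic[of y] kernelD by auto
    then have "?h [^] i = \<one>" using kernelD(2)[OF y] g(1) by (simp add: \<phi>.hom_int_pow)
    then obtain k where "i = int m * k" unfolding oh by (rule dvdE)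
    then show "\<exists>i::int. y = ?u [^] i" using i int_pow_pow[OF g(1)] by auto
  qed
  moreover have su: "s [^] int m = ?u [^] a" unfolding a using g(1) by (simp add: int_pow_pow mult.commute)
  ultimately show "order_m (s [^] int m)"
    using u \<open>coprime a (int m)\<close> unfolding order_m_def
    by (simp add: int_pow_pow coprime_dvd_mult_right_iff coprime_commute)
  show "\<phi> (s [^] int m) = \<one>"
    using s ord unfolding order_m_def by (simp add: \<phi>.hom_int_pow)
qed

lemma funpow_translate:
  assumes "\<tau> \<in> hom G G" "x \<in> carrier G" "s \<in> carrier G" "\<tau> s = s" "\<tau> x = x \<otimes> s"
  shows "(\<tau> ^^ i) x = x \<otimes> s [^] int i"
proof (induction i)
  case (Suc i)
  have "\<tau> (s [^] int i) = s [^] int i"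
    using hom_int_pow[OF assms(1,3)] assms(4) group_axioms by simp
  then have "\<tau> (x \<otimes> s [^] int i) = (x \<otimes> s) \<otimes> s [^] int i"
    using assms by (simp add: hom_mult)
  also have "\<dots> = x \<otimes> s [^] int (Suc i)"
    using assms int_pow_mult[OF assms(3), of 1 "int i"] by (simp add: m_assoc)
  finally show ?case using Suc by simp
qed (use assms in simp)

text \<open>
  The argument climbs the tower one level at a time: if $\tau = \sigma^{m^n}$ fixes $Q_n$ and translates
  $Q_{n+1}$ by an element of order $m$, then $\tau$ translates $Q_{n+2}$ by some $s \in \ker\varphi^2$, and
  $\tau^m$ fixes $Q_{n+1}$ and translates $Q_{n+2}$ by $s^m$.
\<close>

lemma tower_orbits:
  assumes \<sigma>: "\<sigma> \<in> hom G G" "\<And>x. x \<in> carrier G \<Longrightarrow> \<phi> (\<sigma> x) = \<sigma> (\<phi> x)"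
    and fix2: "\<And>x. x \<in> carrier G \<Longrightarrow> \<phi> (\<phi> x) = \<one> \<Longrightarrow> \<sigma> x = x"
    and Q: "\<And>n. Q n \<in> carrier G" "\<And>n. \<phi> (Q (Suc n)) = Q n"
    and Q0: "\<sigma> (Q 0) = Q 0"
    and Q1: "\<And>d. d > 0 \<Longrightarrow> (\<sigma> ^^ d) (Q 1) = Q 1 \<Longrightarrow> m dvd d"
  shows "(\<sigma> ^^ j) (Q n) = Q n \<Longrightarrow> m ^ n dvd j"
proof -
  have pow_hom: "\<sigma> ^^ i \<in> hom G G" for i
    by (induction i) (auto simp: hom_def Pi_iff intro: hom_in_carrier[OF \<sigma>(1)] hom_mult[OF \<sigma>(1)])
  have pow_closed: "(\<sigma> ^^ i) x \<in> carrier G" if "x \<in> carrier G" for i x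
    using hom_in_carrier[OF pow_hom that] .
  have pow_comm: "\<phi> ((\<sigma> ^^ i) x) = (\<sigma> ^^ i) (\<phi> x)" if "x \<in> carrier G" for i x
    using that by (induction i) (simp_all add: \<sigma>(2) pow_closed)
  have pow_fix2: "(\<sigma> ^^ i) x = x" if "x \<in> carrier G" "\<phi> (\<phi> x) = \<one>" for i x
    using that by (induction i) (simp_all add: fix2)
  have diff: "\<exists>s. s \<in> carrier G \<and> (\<sigma> ^^ i) (Q n) = Q n \<otimes> s \<and> (\<forall>k. (\<sigma> ^^ i) (\<phi> (Q n)) = \<phi> (Q n) \<otimes> k \<longrightarrow> k \<in> carrier G \<longrightarrow> \<phi> s = k)" for i n
  proof (intro exI conjI allI impI)
    let ?s = "inv (Q n) \<otimes> (\<sigma> ^^ i) (Q n)"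
    show "?s \<in> carrier G" using Q pow_closed by simp
    show "(\<sigma> ^^ i) (Q n) = Q n \<otimes> ?s" using Q pow_closed by (simp add: m_assoc[symmetric])
    fix k assume k: "(\<sigma> ^^ i) (\<phi> (Q n)) = \<phi> (Q n) \<otimes> k" "k \<in> carrier G"
    have "\<phi> ?s = inv (\<phi> (Q n)) \<otimes> (\<phi> (Q n) \<otimes> k)"
      using Q pow_closed k(1) by (simp add: pow_comm)
    then show "\<phi> ?s = k" using Q k(2) by (simp add: m_assoc[symmetric])
  qed
  have level: "\<exists>t. order_m t \<and> \<phi> t = \<one> \<and> (\<sigma> ^^ (m ^ n)) (Q (Suc n)) = Q (Suc n) \<otimes> t" for n
  proof (induction n)
    case 0
    obtain t where t: "t \<in> carrier G" "(\<sigma> ^^ 1) (Q 1) = Q 1 \<otimes> t"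
      "\<And>k. (\<sigma> ^^ 1) (\<phi> (Q 1)) = \<phi> (Q 1) \<otimes> k \<Longrightarrow> k \<in> carrier G \<Longrightarrow> \<phi> t = k"
      using diff[of 1 1] by blast
    have \<phi>t: "\<phi> t = \<one>" using t(3)[of \<one>] Q(1)[of 0] Q(2)[of 0] Q0 by simp
    have "order_m t"
    proof (rule order_mI[OF t(1) kernel_pow[OF kernelI[OF t(1) \<phi>t]]])
      fix d :: nat assume d: "d > 0" "d dvd m" "t [^] int d = \<one>"
      have "(\<sigma> ^^ d) (Q 1) = Q 1 \<otimes> t [^] int d"
        using t \<phi>t fix2[of t] by (intro funpow_translate \<sigma> Q) auto
      then have "m dvd d" using Q1[OF d(1)] d(3) Q(1) by simp
      then show "d = m" using d(2) by (rule dvd_antisym[rotated])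
    qed
    then show ?case using t(2) \<phi>t by auto
  next
    case (Suc n)
    then obtain t where t: "order_m t" "\<phi> t = \<one>" "(\<sigma> ^^ (m ^ n)) (Q (Suc n)) = Q (Suc n) \<otimes> t" by blast
    let ?\<tau> = "\<sigma> ^^ (m ^ n)"
    obtain s where s: "s \<in> carrier G" "?\<tau> (Q (Suc (Suc n))) = Q (Suc (Suc n)) \<otimes> s" "\<phi> s = t"
      using diff[of "m ^ n" "Suc (Suc n)"] t Q(2)[of "Suc n"] unfolding order_m_def by metis
    have "(?\<tau> ^^ m) (Q (Suc (Suc n))) = Q (Suc (Suc n)) \<otimes> s [^] int m"
      using s t pow_fix2[of s] by (intro funpow_translate pow_hom Q) auto
    moreover have "?\<tau> ^^ m = \<sigma> ^^ (m ^ Suc n)" by (simp add: funpow_mult mult.commute)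
    ultimately show ?case
      using order_m_pow[of s] s t by auto
  qed
  show "m ^ n dvd j" if "(\<sigma> ^^ j) (Q n) = Q n" for j n
    using that
  proof (induction n arbitrary: j)
    case (Suc n)
    have "(\<sigma> ^^ j) (Q n) = \<phi> ((\<sigma> ^^ j) (Q (Suc n)))" using Q by (simp add: pow_comm)
    also have "\<dots> = Q n" using Suc.prems Q(2) by simp
    finally have "m ^ n dvd j" by (rule Suc.IH)
    then obtain i where i: "j = m ^ n * i" by (rule dvdE)
    obtain t where t: "order_m t" "\<phi> t = \<one>" "(\<sigma> ^^ (m ^ n)) (Q (Suc n)) = Q (Suc n) \<otimes> t"
      using level by blast
    have tc: "t \<in> carrier G" using t(1) by (simp add: order_m_def)
    have "((\<sigma> ^^ (m ^ n)) ^^ i) (Q (Suc n)) = Q (Suc n) \<otimes> t [^] int i"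
      using t tc pow_fix2[of t] by (intro funpow_translate pow_hom Q) auto
    then have "Q (Suc n) \<otimes> t [^] int i = Q (Suc n)"
      using Suc.prems unfolding i by (simp add: funpow_mult mult.commute)
    then have "t [^] int i = \<one>" using Q(1) tc by (simp add: r_cancel_one)
    then have "int m dvd int i" using t(1) unfolding order_m_def by blast
    then show ?case unfolding i by (simp add: mult_dvd_mono)
  qed simp
qed

end

section \<open>Points with a given abscissa\<close>

lemma card_roots_if_simple:
  fixes p :: "'b::alg_closed_field poly"
  assumes "p \<noteq> 0" "\<And>r. poly p r = 0 \<Longrightarrow> poly (pderiv p) r \<noteq> 0"
  shows "card {r. poly p r = 0} = degree p"
  using assms
proof (induction "degree p" arbitrary: p)
  case 0
  then obtain c where "p = [:c:]" by (metis degree_eq_zeroE)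
  then show ?case using 0 by auto
next
  case (Suc n)
  then obtain r where r: "poly p r = 0" using alg_closed_imp_poly_has_root[of p] by auto
  then obtain q where q: "p = [:- r, 1:] * q" unfolding poly_eq_0_iff_dvd by (rule dvdE)
  have q0: "q \<noteq> 0" using Suc.prems(1) q by auto
  have dq: "degree p = Suc (degree q)" unfolding q using q0 by (simp add: degree_mult_eq del: mult_pCons_left)
  have pd: "poly (pderiv p) s = poly q s + (s - r) * poly (pderiv q) s" for s
    unfolding q pderiv_mult by (simp add: pderiv_pCons algebra_simps)
  have roots: "{s. poly p s = 0} = insert r {s. poly q s = 0}" unfolding q by auto
  have "poly q r \<noteq> 0" using Suc.prems(2)[OF r] unfolding pd by simp
  moreover have "card {s. poly q s = 0} = degree q"
  proof (rule Suc.hyps(1))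
    show "n = degree q" using Suc.hyps(2) dq by simp
    show "q \<noteq> 0" by (fact q0)
    fix s assume "poly q s = 0"
    then have "poly (pderiv p) s \<noteq> 0" by (intro Suc.prems(2)) (simp add: q)
    then show "poly (pderiv q) s \<noteq> 0" using \<open>poly q s = 0\<close> unfolding pd by auto
  qed
  moreover have "finite {s. poly q s = 0}" by (rule poly_roots_finite[OF q0])
  ultimately show ?case unfolding roots dq by simp
qed

context weierstrass_field
begin

lemma on_weierstrass_same_x:
  assumes "on_weierstrass W x y" "on_weierstrass W x y'"
  shows "y' = y \<or> y' = - y - wa1 W * x - wa3 W"
proof -
  have "(y' - y) * (y' + y + wa1 W * x + wa3 W) =
      (y'^2 + wa1 W * x * y' + wa3 W * y') - (y^2 + wa1 W * x * y + wa3 W * y)"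
    by (simp add: algebra_simps power2_eq_square)
  also have "\<dots> = 0" using assms unfolding on_weierstrass_def by simp
  finally have "y' - y = 0 \<or> y' + y + wa1 W * x + wa3 W = 0" by (simp only: mult_eq_0_iff)
  then show ?thesis
  proof
    assume 0: "y' + y + wa1 W * x + wa3 W = 0"
    have "y' = (y' + y + wa1 W * x + wa3 W) - y - wa1 W * x - wa3 W" by simp
    then show ?thesis unfolding 0 by simp
  qed simp
qed

end

context smooth_weierstrass
begin

lemma same_x_coord:
  assumes "P \<in> curve_points W" "Q \<in> curve_points W" "x_coord P = x_coord Q"
  shows "Q = P \<or> Q = ec_neg P"
  using assms on_weierstrass_same_x by (cases P; cases Q) (auto simp: curve_points_def)

lemma x_coord_neg [simp]: "x_coord (ec_neg P) = x_coord P"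
  by (cases P) simp_all

lemma ec_neg_neg [simp]: "ec_neg (ec_neg P) = P"
  by (cases P) simp_all

lemma inv_eq_ec_neg:
  defines "G \<equiv> \<lparr>carrier = curve_points W, monoid.mult = ec_add W, one = Infinity\<rparr>"
  assumes "P \<in> curve_points W"
  shows "inv\<^bsub>G\<^esub> P = ec_neg P"
proof -
  interpret comm_group G unfolding G_def by (rule comm_group_curve_points)
  have "P \<otimes>\<^bsub>G\<^esub> ec_neg P = \<one>\<^bsub>G\<^esub>" by (simp add: G_def ec_add_neg)
  moreover have "P \<in> carrier G" "ec_neg P \<in> carrier G" using assms(2) ec_neg_closed by (simp_all add: G_def)
  ultimately show ?thesis by (metis inv_equality inv_inv m_comm)
qed

end

text \<open>
  The abscissas of the points of order 2 are zeros of the 2-division polynomial $4 \cdot cub + lin^2$. Its leading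
  coefficient is 4; in characteristic 2, where it reduces to $lin^2$, it could be zero only for a singular curve.
\<close>

lemma finite_two_torsion:
  fixes W :: "'b::alg_closed_field weierstrass"
  assumes "smooth_weierstrass W"
  shows "finite {x. \<exists>y. on_weierstrass W x y \<and> 2 * y + wa1 W * x + wa3 W = 0}"
proof -
  interpret smooth_weierstrass W by fact
  define p where "p = 4 * cub + lin^2"
  have "poly p x = 0" if "on_weierstrass W x y" "2 * y + wa1 W * x + wa3 W = 0" for x y
  proof -
    have "poly p x = 4 * (y^2 + poly lin x * y) + poly lin x^2"
      using that(1) unfolding on_weierstrass_iff by (simp add: p_def)
    also have "\<dots> = (2 * y + poly lin x)^2" by (simp add: algebra_simps power2_eq_square)
    also have "2 * y + poly lin x = 0" using that(2) by (simp add: lin_def algebra_simps)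
    finally show ?thesis by simp
  qed
  moreover have "p \<noteq> 0"
  proof
    assume "p = 0"
    have "coeff p 3 = 4"
      by (simp add: p_def cub_def lin_def power2_eq_square numeral_poly coeff_pCons split: nat.splits)
    then have "(4 :: 'b) = 0" using \<open>p = 0\<close> by simp
    moreover have "(4 :: 'b) = 2 * 2" by simp
    ultimately have two: "(2 :: 'b) = 0" by (metis mult_eq_0_iff)
    then have "(4 :: 'b poly) = 0" by (metis \<open>(4 :: 'b) = 0\<close> numeral_poly pCons_0_0)
    then have "lin = 0" using \<open>p = 0\<close> by (simp add: p_def)
    then have a13: "wa1 W = 0" "wa3 W = 0" by (simp_all add: lin_def)
    \<comment> \<open>In characteristic 2 with both coefficients zero the curve is singular where the derivative
      of the cubic vanishes.\<close>
    have "\<exists>x. poly [:wa4 W, 0, 1:] x = 0" by (rule alg_closed_imp_poly_has_root) simp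
    then obtain x where x: "wa4 W + x * x = 0" by auto
    have "\<exists>y. poly [:- poly cub x, 0, 1:] y = 0" by (rule alg_closed_imp_poly_has_root) simp
    then obtain y where "y * y = poly cub x" by auto
    then have "on_weierstrass W x y" unfolding on_weierstrass_iff by (simp add: \<open>lin = 0\<close> power2_eq_square)
    moreover have "wa1 W * y - 3 * x^2 - 2 * wa2 W * x - wa4 W = - (3 * x^2 + wa4 W)"
      "2 * y + wa1 W * x + wa3 W = 0" using a13 two by simp_all
    ultimately have "3 * x^2 + wa4 W \<noteq> 0" using smooth[of x y] by (metis neg_equal_0_iff_equal)
    moreover have "3 * x^2 + wa4 W = 2 * x^2 + (wa4 W + x * x)" by (simp add: power2_eq_square)
    ultimately show False using x two by simp
  qed
  ultimately show ?thesis
    by (intro finite_subset[OF _ poly_roots_finite[of p]]) auto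
qed

section \<open>The fibres of the endomorphism\<close>

locale ec_x_map =
  fixes E :: "'a::field weierstrass" and S :: "'a poly fract"
    and \<phi> :: "'a alg_closure ec_point \<Rightarrow> 'a alg_closure ec_point"
  assumes elliptic: "elliptic_curve E"
    and \<phi>_hom: "\<phi> \<in> hom (ec_group E) (ec_group E)"
    and x_map: "is_x_coordinate_map E \<phi> S"
begin

abbreviation "pts \<equiv> curve_points (base_change E)"
abbreviation "nA \<equiv> map_poly to_ac (numerator S)"
abbreviation "nB \<equiv> map_poly to_ac (denominator S)"

sublocale smooth_weierstrass "base_change E"
  using elliptic by (rule smooth_weierstrass_base_change)

sublocale G: comm_group "ec_group E"
  by (rule comm_group_ec_group[OF elliptic])

sublocale \<phi>: group_hom "ec_group E" "ec_group E" \<phi>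
  by unfold_locales (rule \<phi>_hom)

lemma group_simps [simp]: "carrier (ec_group E) = pts" "\<one>\<^bsub>ec_group E\<^esub> = Infinity"
  by (simp_all add: ec_group_def)

lemma \<phi>_closed: "R \<in> pts \<Longrightarrow> \<phi> R \<in> pts"
  using \<phi>.hom_closed by simp

lemma \<phi>_Infinity: "\<phi> Infinity = Infinity"
  using \<phi>.hom_one by simp

lemma \<phi>_neg: "R \<in> pts \<Longrightarrow> \<phi> (ec_neg R) = ec_neg (\<phi> R)"
  using \<phi>.hom_inv[of R] inv_eq_ec_neg \<phi>_closed by (simp add: ec_group_def)

lemma degree_less: "degree (denominator S) < degree (numerator S)"
proof -
  have "Infinity \<in> pts" by (simp add: curve_points_def)
  then have "x_coord (\<phi> Infinity) = fract_eval S (x_coord (Infinity :: 'a alg_closure ec_point))"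
    using x_map unfolding is_x_coordinate_map_def by blast
  then show ?thesis by (simp add: \<phi>_Infinity split: if_splits)
qed

lemma \<phi>_Affine:
  assumes "Affine u v \<in> pts" "poly nB u \<noteq> 0"
  obtains v' where "\<phi> (Affine u v) = Affine (poly nA u / poly nB u) v'"
proof -
  have "x_coord (\<phi> (Affine u v)) = fract_eval S (x_coord (Affine u v))"
    using x_map assms(1) unfolding is_x_coordinate_map_def by blast
  then have "x_coord (\<phi> (Affine u v)) = Some (poly nA u / poly nB u)" using assms(2) by simp
  then show ?thesis using that by (cases "\<phi> (Affine u v)") auto
qed

lemma nA_nB_coprime: "poly nA u = 0 \<Longrightarrow> poly nB u \<noteq> 0"
proof
  assume z: "poly nA u = 0" "poly nB u = 0"
  obtain a b where "a * numerator S + b * denominator S = 1"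
    using Fract_lowest_terms(2)[of S] unfolding bezout_def by blast
  then have "poly (map_poly to_ac (a * numerator S + b * denominator S)) u = 1" by simp
  then show False using z by (simp add: to_ac.map_poly_add to_ac.map_poly_mult)
qed

definition fibre_poly :: "'a alg_closure \<Rightarrow> 'a alg_closure poly" where
  "fibre_poly c = nA - smult c nB"

lemma degree_fibre_poly: "degree (fibre_poly c) = degree (numerator S)"
proof -
  have "degree (smult c nB) < degree nA"
    using degree_less degree_smult_le[of c nB] by (simp add: to_ac.degree_map_poly_hom)
  then have "degree (nA + - smult c nB) = degree nA" by (intro degree_add_eq_left) simp
  then show ?thesis by (simp add: fibre_poly_def to_ac.degree_map_poly_hom)
qed

lemma fibre_poly_root:
  assumes "poly (fibre_poly c) r = 0"
  shows "poly nB r \<noteq> 0" "poly nA r / poly nB r = c"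
proof -
  have "poly nA r = c * poly nB r" using assms by (simp add: fibre_poly_def)
  moreover from this show "poly nB r \<noteq> 0" using nA_nB_coprime[of r] by auto
  ultimately show "poly nA r / poly nB r = c" by simp
qed

text \<open>
  Both points over \<open>r\<close> are mapped to points over \<open>c\<close>, and as $\varphi$ respects signs, one of them is mapped
  to the given point.
\<close>

lemma ex_preimage_over_root:
  assumes T: "Affine c d \<in> pts" and r: "poly (fibre_poly c) r = 0"
  shows "\<exists>v. Affine r v \<in> pts \<and> \<phi> (Affine r v) = Affine c d"
proof -
  have "\<exists>v. on_weierstrass (base_change E) r v"
    by (rule weierstrass_field.ex_point_over)
  then obtain v where v: "Affine r v \<in> pts" by (auto simp: curve_points_def)
  obtain d' where d': "\<phi> (Affine r v) = Affine c d'"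
    using \<phi>_Affine[OF v fibre_poly_root(1)[OF r]] fibre_poly_root(2)[OF r] by metis
  then have "Affine c d' \<in> pts" using \<phi>_closed[OF v] by simp
  from same_x_coord[OF this T] have "Affine c d = Affine c d' \<or> Affine c d = ec_neg (Affine c d')" by simp
  then show ?thesis
  proof
    assume "Affine c d = Affine c d'"
    then show ?thesis using v d' by auto
  next
    assume "Affine c d = ec_neg (Affine c d')"
    then have "\<phi> (ec_neg (Affine r v)) = Affine c d" using \<phi>_neg[OF v] d' by simp
    moreover have "ec_neg (Affine r v) \<in> pts" by (rule ec_neg_closed[OF v])
    ultimately show ?thesis by auto
  qed
qed

lemma \<phi>_surj:
  assumes "T \<in> pts"
  obtains R where "R \<in> pts" "\<phi> R = T"
proof (cases T)
  case Infinity
  then show ?thesis using that[of Infinity] \<phi>_Infinity by (simp add: curve_points_def)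
next
  case (Affine c d)
  have "degree (fibre_poly c) > 0" using degree_less by (simp add: degree_fibre_poly)
  then obtain r where "poly (fibre_poly c) r = 0" using alg_closed_imp_poly_has_root by blast
  then show ?thesis using ex_preimage_over_root[of c d r] assms Affine that by blast
qed

text \<open>
  Over all but finitely many $c$ the equation $S(x) = c$ has $\deg S$ simple roots, and each root is the
  abscissa of exactly one preimage of a given point over $c$ that is not its own opposite.
\<close>

lemma card_kernel_eq_degree:
  assumes sep: "pderiv (numerator S) \<noteq> 0 \<or> pderiv (denominator S) \<noteq> 0"
  shows "card (kernel (ec_group E) (ec_group E) \<phi>) = degree (numerator S)"
proof -
  let ?A = "numerator S" and ?B = "denominator S"
  define w where "w = pderiv ?A * ?B - ?A * pderiv ?B"
  have "w \<noteq> 0"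
  proof
    assume "w = 0"
    then have eq: "?B * pderiv ?A = ?A * pderiv ?B" by (simp add: w_def mult.commute)
    then have "?A dvd ?B * pderiv ?A" by simp
    then have "?A dvd pderiv ?A" by (rule bezout_dvd[OF Fract_lowest_terms(2)])
    moreover have "pderiv ?A \<noteq> 0 \<Longrightarrow> degree (pderiv ?A) < degree ?A"
    proof -
      have "degree (pderiv ?A) \<le> degree ?A - 1"
        by (rule degree_le) (auto simp: coeff_pderiv coeff_eq_0)
      then show ?thesis using degree_less by linarith
    qed
    ultimately have "pderiv ?A = 0" by (meson dvd_imp_degree_le not_le)
    moreover from this have "pderiv ?B = 0" using eq degree_less by auto
    ultimately show False using sep by blast
  qed
  let ?w = "map_poly to_ac w"
  have "finite {r. poly ?w r = 0}"
    using \<open>w \<noteq> 0\<close> by (intro poly_roots_finite) (simp add: to_ac.map_poly_hom_eq_0_iff)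
  then have "finite ((\<lambda>r. poly nA r / poly nB r) ` {r. poly ?w r = 0} \<union>
      {x. \<exists>y. on_weierstrass (base_change E) x y \<and> 2 * y + wa1 (base_change E) * x + wa3 (base_change E) = 0})"
    using finite_two_torsion[OF smooth_weierstrass_axioms] by blast
  then obtain c where c: "c \<notin> (\<lambda>r. poly nA r / poly nB r) ` {r. poly ?w r = 0}"
    and c2: "\<not> (\<exists>y. on_weierstrass (base_change E) c y \<and> 2 * y + wa1 (base_change E) * c + wa3 (base_change E) = 0)"
    using ex_new_if_finite[OF infinite_UNIV_alg_closed] by blast
  have "\<exists>d. on_weierstrass (base_change E) c d" by (rule weierstrass_field.ex_point_over)
  then obtain d where d: "on_weierstrass (base_change E) c d" by blast
  define T where "T = Affine c d"
  have T: "T \<in> pts" using d by (simp add: T_def curve_points_def)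
  have Tneg: "ec_neg T \<noteq> T"
  proof
    assume "ec_neg T = T"
    then have "- d - wa1 (base_change E) * c - wa3 (base_change E) = d" by (simp add: T_def)
    then have "2 * d + wa1 (base_change E) * c + wa3 (base_change E) = 0"
      by (simp add: algebra_simps eq_neg_iff_add_eq_0)
    then show False using c2 d by blast
  qed
  have simple: "poly (pderiv (fibre_poly c)) r \<noteq> 0" if r: "poly (fibre_poly c) r = 0" for r
  proof
    assume "poly (pderiv (fibre_poly c)) r = 0"
    then have "poly (pderiv nA) r = c * poly (pderiv nB) r"
      by (simp add: fibre_poly_def pderiv_diff pderiv_smult)
    moreover have "poly nA r = c * poly nB r" using r by (simp add: fibre_poly_def)
    ultimately have "poly ?w r = 0"
      by (simp add: w_def to_ac.map_poly_diff to_ac.map_poly_mult to_ac.map_poly_pderiv)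
    then show False using c fibre_poly_root(2)[OF r] by blast
  qed
  have "fibre_poly c \<noteq> 0" using degree_fibre_poly[of c] degree_less by auto
  then have roots: "card {r. poly (fibre_poly c) r = 0} = degree ?A"
    using card_roots_if_simple[OF _ simple] degree_fibre_poly by simp
  let ?F = "{R \<in> pts. \<phi> R = T}"
  have "bij_betw x_coord ?F (Some ` {r. poly (fibre_poly c) r = 0})"
  proof (rule bij_betw_imageI)
    show "inj_on x_coord ?F"
    proof (rule inj_onI)
      fix R R' assume R: "R \<in> ?F" "R' \<in> ?F" "x_coord R = x_coord R'"
      then have "R' = R \<or> R' = ec_neg R" by (intro same_x_coord) auto
      moreover have "R' \<noteq> ec_neg R" using R \<phi>_neg[of R] Tneg by auto
      ultimately show "R = R'" by blast
    qed
    show "x_coord ` ?F = Some ` {r. poly (fibre_poly c) r = 0}"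
    proof (intro equalityI subsetI)
      fix z assume "z \<in> x_coord ` ?F"
      then obtain R where R: "R \<in> pts" "\<phi> R = T" "z = x_coord R" by auto
      then obtain u v where uv: "R = Affine u v" using \<phi>_Infinity by (cases R) (auto simp: T_def)
      have "fract_eval S (Some u) = Some c"
        using x_map R uv unfolding is_x_coordinate_map_def T_def by (metis x_coord.simps(2))
      then have "poly (fibre_poly c) u = 0" by (auto simp: fibre_poly_def split: if_splits)
      then show "z \<in> Some ` {r. poly (fibre_poly c) r = 0}" using R uv by auto
    next
      fix z assume "z \<in> Some ` {r. poly (fibre_poly c) r = 0}"
      then obtain r where r: "z = Some r" "poly (fibre_poly c) r = 0" by auto
      then obtain v where "Affine r v \<in> pts" "\<phi> (Affine r v) = T"
        using ex_preimage_over_root[of c d r] T unfolding T_def by blast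
      then show "z \<in> x_coord ` ?F" using r(1) by (intro image_eqI[of _ _ "Affine r v"]) simp_all
    qed
  qed
  then have "card ?F = card (Some ` {r. poly (fibre_poly c) r = 0})" by (rule bij_betw_same_card)
  also have "\<dots> = degree ?A" using roots by (simp add: card_image)
  finally have cardF: "card ?F = degree ?A" .
  obtain R0 where R0: "R0 \<in> pts" "\<phi> R0 = T" using \<phi>_surj[OF T] .
  let ?G = "ec_group E"
  have "bij_betw (\<lambda>k. R0 \<otimes>\<^bsub>?G\<^esub> k) (kernel ?G ?G \<phi>) ?F"
  proof (rule bij_betwI[where g = "\<lambda>R. inv\<^bsub>?G\<^esub> R0 \<otimes>\<^bsub>?G\<^esub> R"])
    show "(\<lambda>k. R0 \<otimes>\<^bsub>?G\<^esub> k) \<in> kernel ?G ?G \<phi> \<rightarrow> ?F"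
      using R0 T G.m_closed \<phi>.hom_mult G.r_one by (auto simp: kernel_def)
    show "(\<lambda>R. inv\<^bsub>?G\<^esub> R0 \<otimes>\<^bsub>?G\<^esub> R) \<in> ?F \<rightarrow> kernel ?G ?G \<phi>"
      using R0 T G.m_closed G.inv_closed \<phi>.hom_mult \<phi>.hom_inv G.l_inv by (auto simp: kernel_def)
    show "inv\<^bsub>?G\<^esub> R0 \<otimes>\<^bsub>?G\<^esub> (R0 \<otimes>\<^bsub>?G\<^esub> k) = k" if "k \<in> kernel ?G ?G \<phi>" for k
      using that R0 G.m_assoc[of "inv\<^bsub>?G\<^esub> R0" R0 k] G.l_one[of k] G.inv_closed[of R0]
      by (simp add: kernel_def)
    show "R0 \<otimes>\<^bsub>?G\<^esub> (inv\<^bsub>?G\<^esub> R0 \<otimes>\<^bsub>?G\<^esub> R) = R" if "R \<in> ?F" for R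
      using that R0 G.m_assoc[of R0 "inv\<^bsub>?G\<^esub> R0" R] G.l_one[of R] G.inv_closed[of R0] by simp
  qed
  then have "card (kernel ?G ?G \<phi>) = card ?F" by (rule bij_betw_same_card)
  then show ?thesis using cardF by simp
qed

end

section \<open>The action of Frobenius on points\<close>

context field_embedding
begin

lemma on_weierstrass_map: "on_weierstrass (map_weierstrass h W) (h x) (h y) \<longleftrightarrow> on_weierstrass W x y"
proof -
  have "on_weierstrass (map_weierstrass h W) (h x) (h y) \<longleftrightarrow>
     h (y^2 + wa1 W * x * y + wa3 W * y) = h (x^3 + wa2 W * x^2 + wa4 W * x + wa6 W)"
    unfolding on_weierstrass_def by (simp add: weierstrass.map_sel hom_add hom_mult hom_power)
  then show ?thesis unfolding hom_eq_iff on_weierstrass_def .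
qed

lemma map_ec_point_curve_points:
  "P \<in> curve_points W \<Longrightarrow> map_ec_point h P \<in> curve_points (map_weierstrass h W)"
  by (cases P) (auto simp: curve_points_def on_weierstrass_map)

lemma ec_add_map:
  "ec_add (map_weierstrass h W) (map_ec_point h P) (map_ec_point h Q) = map_ec_point h (ec_add W P Q)"
proof (cases P)
  case P: (Affine x1 y1)
  show ?thesis
  proof (cases Q)
    case Q: (Affine x2 y2)
    have "h (y1 + y2 + wa1 W * x2 + wa3 W) = 0 \<longleftrightarrow> y1 + y2 + wa1 W * x2 + wa3 W = 0"
      by (rule hom_eq_0_iff)
    then have c: "h y1 + h y2 + h (wa1 W) * h x2 + h (wa3 W) = 0 \<longleftrightarrow> y1 + y2 + wa1 W * x2 + wa3 W = 0"
      by (simp add: hom_add hom_mult)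
    show ?thesis
      unfolding P Q
      by (simp add: Let_def weierstrass.map_sel c hom_eq_iff hom_add hom_mult hom_diff hom_minus
          hom_power hom_divide hom_numeral)
  qed (simp add: P)
qed simp

end

lemma map_ec_point_funpow:
  fixes f :: "'c \<Rightarrow> 'c"
  shows "map_ec_point f ^^ n = map_ec_point (f ^^ n)"
proof
  show "(map_ec_point f ^^ n) R = map_ec_point (f ^^ n) R" for R
  proof (induction n)
    case 0
    show ?case by (cases R) simp_all
  next
    case (Suc n)
    then show ?case by (cases R) simp_all
  qed
qed

lemma x_coord_map: "x_coord (map_ec_point f R) = map_option f (x_coord R)"
  by (cases R) simp_all

lemma map_weierstrass_frob: "map_weierstrass (frob ^^ n) (base_change E) = base_change E"
  by (cases E) simp

lemma frob_form_eval:
  "form_eval d c (frob u, frob v, frob w) = frob (form_eval d c (u, v, w))"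
  unfolding form_eval_def by (simp add: frob.hom_sum frob.hom_mult frob.hom_power)

text \<open>A morphism over the base field is given by forms with coefficients fixed by Frobenius.\<close>

lemma curve_morphism_frob:
  fixes E :: "'a::{field,finite} weierstrass"
  assumes mor: "curve_morphism E \<phi>" and R: "R \<in> curve_points (base_change E)"
  shows "\<phi> (map_ec_point frob R) = map_ec_point frob (\<phi> R)"
proof -
  let ?R' = "map_ec_point frob R"
  have "map_ec_point frob R \<in> curve_points (map_weierstrass (frob ^^ 1) (base_change E))"
    using frob.map_ec_point_curve_points[OF R] by simp
  then have R': "?R' \<in> curve_points (base_change E)" by (simp only: map_weierstrass_frob)
  obtain d c0 c1 c2 where
    nz: "(form_eval d c0 (proj_coords R), form_eval d c1 (proj_coords R), form_eval d c2 (proj_coords R)) \<noteq> (0, 0, 0)"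
    and loc: "\<And>Q. Q \<in> curve_points (base_change E) \<Longrightarrow>
       (form_eval d c0 (proj_coords Q), form_eval d c1 (proj_coords Q), form_eval d c2 (proj_coords Q)) \<noteq> (0, 0, 0) \<Longrightarrow>
       \<exists>s u v w. proj_coords (\<phi> Q) = (u, v, w) \<and>
         (form_eval d c0 (proj_coords Q), form_eval d c1 (proj_coords Q), form_eval d c2 (proj_coords Q)) = (s * u, s * v, s * w)"
    using mor R unfolding curve_morphism_def Let_def by blast
  have proj: "proj_coords ?R' = (case proj_coords R of (u, v, w) \<Rightarrow> (frob u, frob v, frob w))"
    by (cases R) (simp_all add: frob.hom_0 frob.hom_1)
  have form: "form_eval d c (proj_coords ?R') = frob (form_eval d c (proj_coords R))" for c
    unfolding proj by (cases "proj_coords R") (simp add: frob_form_eval)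
  obtain s u v w where 1: "proj_coords (\<phi> R) = (u, v, w)"
    "form_eval d c0 (proj_coords R) = s * u" "form_eval d c1 (proj_coords R) = s * v"
    "form_eval d c2 (proj_coords R) = s * w"
    using loc[OF R nz] by auto
  have s: "frob s \<noteq> 0" using nz 1 by (auto simp: frob.hom_eq_0_iff)
  have "(form_eval d c0 (proj_coords ?R'), form_eval d c1 (proj_coords ?R'), form_eval d c2 (proj_coords ?R')) \<noteq> (0, 0, 0)"
    using nz unfolding form by (simp add: frob.hom_eq_0_iff)
  from loc[OF R' this] obtain s' u' v' w' where 2: "proj_coords (\<phi> ?R') = (u', v', w')"
    "frob s * frob u = s' * u'" "frob s * frob v = s' * v'" "frob s * frob w = s' * w'"
    unfolding form 1 frob.hom_mult by auto
  show ?thesis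
    using 1(1) 2 s
    by (cases "\<phi> R"; cases "\<phi> ?R'") (auto simp: frob.hom_0 frob.hom_1)
qed

lemma fixed_points_field_of_definition:
  fixes x y :: "'a::{field,finite} alg_closure"
  assumes sub: "field_of_definition R \<subseteq> field_of_definition (Affine x y)"
    and fixed: "(frob ^^ n) x = x" "(frob ^^ n) y = y"
  shows "map_ec_point (frob ^^ n) R = R"
proof (cases R)
  case (Affine a b)
  interpret f: field_embedding "(frob :: 'a alg_closure \<Rightarrow> 'a alg_closure) ^^ n"
    by (rule frob_funpow_embedding)
  let ?K = "{z :: 'a alg_closure. (frob ^^ n) z = z}"
  have "field_closed ?K"
    unfolding field_closed_def
    by (simp add: f.hom_1 f.hom_add f.hom_mult f.hom_minus f.hom_inverse)
  then have "field_of_definition (Affine x y) \<subseteq> ?K"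
    unfolding field_of_definition.simps using fixed by (intro generate_field_subset) auto
  moreover have "{a, b} \<subseteq> field_of_definition R"
    unfolding Affine by (auto intro: generate_field.incl)
  ultimately show ?thesis using sub unfolding Affine by auto
qed simp

section \<open>Irreducibility of all iterates\<close>

theorem corollary2p3:
  fixes E :: "'a::{field,finite} weierstrass"
    and \<phi> :: "'a alg_closure ec_point \<Rightarrow> 'a alg_closure ec_point"
    and x\<^sub>P y\<^sub>P :: "'a alg_closure"
    and S :: "'a poly fract"
    and f :: "'a poly"
  assumes "elliptic_curve E"
    and "ec_endomorphism E \<phi>"
    and "endo_separable E \<phi>"
    and "odd (endo_degree E \<phi>)"
    and "Affine x\<^sub>P y\<^sub>P \<in> carrier (ec_group E)"
    and "cyclic_group ((ec_group E)\<lparr>carrier := kernel (ec_group E) (ec_group E) (\<phi> \<circ> \<phi>)\<rparr>)"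
    and "\<forall>R \<in> kernel (ec_group E) (ec_group E) (\<phi> \<circ> \<phi>).
           field_of_definition R \<subseteq> field_of_definition (Affine x\<^sub>P y\<^sub>P)"
    and "is_x_coordinate_map E \<phi> S"
    and "is_minimal_polynomial (range to_ac) x\<^sub>P (map_poly to_ac f)"
    and "irreducible (S_transform S f)"
  shows "\<forall>n. irreducible ((S_transform S ^^ n) f)"
proof
  let ?G = "ec_group E" and ?T = "S_transform S"
  define m where "m = degree (numerator S)"
  define e where "e = period frob x\<^sub>P"
  have mor: "curve_morphism E \<phi>" and hom: "\<phi> \<in> hom ?G ?G"
    using assms(2) by (simp_all add: ec_endomorphism_def)
  interpret X: ec_x_map E S \<phi>
    by unfold_locales (fact assms(1) hom assms(8))+
  interpret C: curve_map_over_fraction E S \<phi>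
    by unfold_locales (use X.degree_less X.\<phi>_closed assms(8) in auto)
  have "odd m" unfolding m_def by (rule C.odd_degree_numerator[OF assms(4)])
  note min = degree_minimal_polynomial[OF assms(9)]
  obtain i where i: "i > 0" "(frob ^^ i) x\<^sub>P = x\<^sub>P" by (rule frob_orbit_finite[OF min(2,3)])
  have e: "e > 0" "(frob ^^ e) x\<^sub>P = x\<^sub>P" "degree f = e"
    unfolding e_def using period[OF i] min(1) by simp_all

  \<comment> \<open>A tower of preimages of P, with abscissas x n.\<close>
  have "\<forall>R\<in>X.pts. \<exists>R'. R' \<in> X.pts \<and> \<phi> R' = R" using X.\<phi>_surj by metis
  then obtain pre where pre: "\<forall>R\<in>X.pts. pre R \<in> X.pts \<and> \<phi> (pre R) = R" by metis
  define Q where "Q n = (pre ^^ n) (Affine x\<^sub>P y\<^sub>P)" for n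
  have Q0: "Q 0 = Affine x\<^sub>P y\<^sub>P" by (simp add: Q_def)
  have Qpts: "Q n \<in> X.pts" for n
    unfolding Q_def using assms(5) pre by (induction n) simp_all
  have Q\<phi>: "\<phi> (Q (Suc n)) = Q n" for n
    using pre Qpts[of n] by (simp add: Q_def)
  have "Q n \<noteq> Infinity" for n
  proof (induction n)
    case (Suc n)
    then show ?case using Q\<phi>[of n] X.\<phi>_Infinity by metis
  qed (simp add: Q0)
  then have "\<forall>n. \<exists>x. x_coord (Q n) = Some x" by (metis ec_point.exhaust x_coord.simps(2))
  then obtain x where x: "\<And>n. x_coord (Q n) = Some (x n)" by metis
  have x0: "x 0 = x\<^sub>P" using x[of 0] by (simp add: Q0)
  have Sx: "fract_eval S (Some (x (Suc n))) = Some (x n)" for n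
    using assms(8) Qpts[of "Suc n"] x Q\<phi> unfolding is_x_coordinate_map_def by metis
  have deg: "degree ((?T ^^ n) f) = m ^ n * e" for n
    by (induction n) (simp_all add: degree_S_transform[OF X.degree_less] e(3) m_def)
  have root: "poly (map_poly to_ac ((?T ^^ n) f)) (x n) = 0" for n
    by (induction n) (simp_all add: poly_S_transform[OF Sx] min(3) x0)

  have irr1: "degree (?T f) = period frob (x 1)" "pderiv (?T f) \<noteq> 0"
    using irreducible_root[OF assms(10), of "x 1"] root[of 1] by simp_all
  have card: "card (kernel ?G ?G \<phi>) = m"
    unfolding m_def using irr1(2) pderiv_S_transform by (intro X.card_kernel_eq_degree) blast
  have m: "m > 0" using \<open>odd m\<close> by (rule odd_pos)

  let ?\<pi> = "map_ec_point frob :: 'a alg_closure ec_point \<Rightarrow> 'a alg_closure ec_point"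
  have \<pi>_closed: "?\<pi> R \<in> X.pts" if "R \<in> X.pts" for R
    using frob.map_ec_point_curve_points[OF that] map_weierstrass_frob[of 1 E] by simp
  have \<pi>_add: "?\<pi> (ec_add (base_change E) R R') = ec_add (base_change E) (?\<pi> R) (?\<pi> R')" for R R'
    using frob.ec_add_map[of "base_change E" R R'] map_weierstrass_frob[of 1 E] by simp
  have \<pi>n_closed: "(?\<pi> ^^ n) R \<in> X.pts" if "R \<in> X.pts" for R n
    using that by (induction n) (simp_all add: \<pi>_closed)
  have \<pi>n_hom: "?\<pi> ^^ n \<in> hom ?G ?G" for n
  proof -
    have "(?\<pi> ^^ n) (ec_add (base_change E) R R') = ec_add (base_change E) ((?\<pi> ^^ n) R) ((?\<pi> ^^ n) R')" for R R'
      by (induction n) (simp_all add: \<pi>_add)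
    then show ?thesis using \<pi>n_closed by (simp add: hom_def ec_group_def)
  qed
  have \<pi>n_\<phi>: "\<phi> ((?\<pi> ^^ n) R) = (?\<pi> ^^ n) (\<phi> R)" if "R \<in> X.pts" for n R
    using that by (induction n) (simp_all add: curve_morphism_frob[OF mor] \<pi>n_closed)
  have x_\<pi>n: "x_coord ((?\<pi> ^^ n) R) = map_option (frob ^^ n) (x_coord R)" for n R
    by (simp add: map_ec_point_funpow x_coord_map)
  \<comment> \<open>Fixing the abscissa of a point means fixing the point up to sign.\<close>
  have twice: "(?\<pi> ^^ (2 * n)) R = R" if R: "R \<in> X.pts" and "x_coord ((?\<pi> ^^ n) R) = x_coord R" for n R
  proof -
    interpret h: group_hom ?G ?G "?\<pi> ^^ n"
      by unfold_locales (rule \<pi>n_hom)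
    have neg: "(?\<pi> ^^ n) (X.ec_neg R) = X.ec_neg ((?\<pi> ^^ n) R)"
      using h.hom_inv[of R] X.inv_eq_ec_neg R \<pi>n_closed[OF R] by (simp add: ec_group_def)
    have "(?\<pi> ^^ n) R = R \<or> (?\<pi> ^^ n) R = X.ec_neg R"
      using that \<pi>n_closed[OF R] by (intro X.same_x_coord) simp_all
    then have "(?\<pi> ^^ n) ((?\<pi> ^^ n) R) = R" using neg by auto
    then show ?thesis by (simp add: mult_2 funpow_add)
  qed
  define \<sigma> where "\<sigma> = ?\<pi> ^^ (2 * e)"
  have \<sigma>_pow: "\<sigma> ^^ j = ?\<pi> ^^ (2 * e * j)" for j by (simp add: \<sigma>_def funpow_mult)
  have \<sigma>P: "\<sigma> (Q 0) = Q 0"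
    unfolding \<sigma>_def by (rule twice[OF Qpts]) (simp add: x_\<pi>n x x0 e(2))

  have group2: "subgroup (kernel ?G ?G (\<phi> \<circ> \<phi>)) ?G"
  proof -
    interpret h: group_hom ?G ?G "\<phi> \<circ> \<phi>"
      by unfold_locales (rule Group.hom_compose[OF hom hom])
    show ?thesis by (rule h.subgroup_kernel)
  qed
  interpret K: group "?G\<lparr>carrier := kernel ?G ?G (\<phi> \<circ> \<phi>)\<rparr>"
    by (rule subgroup.subgroup_is_group[OF group2]) (rule X.G.group_axioms)
  let ?K = "kernel ?G ?G (\<phi> \<circ> \<phi>)"
  obtain g where g: "g \<in> ?K" and gen: "?K = range (\<lambda>i::int. g [^]\<^bsub>?G\<lparr>carrier := ?K\<rparr>\<^esub> i)"
    using assms(6) unfolding K.cyclic_group by auto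
  interpret tower: cyclic_tower ?G \<phi> m g
  proof unfold_locales
    show "\<phi> \<in> hom ?G ?G" "card (kernel ?G ?G \<phi>) = m" "m > 0" by (fact hom card m)+
    show "g \<in> carrier ?G" "\<phi> (\<phi> g) = \<one>\<^bsub>?G\<^esub>" using g by (simp_all add: kernel_def)
    show "\<exists>i::int. R = g [^]\<^bsub>?G\<^esub> i" if "R \<in> carrier ?G" "\<phi> (\<phi> R) = \<one>\<^bsub>?G\<^esub>" for R
    proof -
      have "R \<in> ?K" using that by (simp add: kernel_def)
      then obtain i :: int where "R = g [^]\<^bsub>?G\<lparr>carrier := ?K\<rparr>\<^esub> i" using gen by blast
      then show ?thesis using X.G.int_pow_consistent[OF group2 g] by auto
    qed
  qed
  have orbits: "m ^ n dvd j" if "(\<sigma> ^^ j) (Q n) = Q n" for n j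
  proof (rule tower.tower_orbits[where \<sigma> = \<sigma> and Q = Q])
    show "(\<sigma> ^^ j) (Q n) = Q n" by (rule that)
    show "\<sigma> \<in> hom ?G ?G" unfolding \<sigma>_def by (rule \<pi>n_hom)
    show "\<phi> (\<sigma> R) = \<sigma> (\<phi> R)" if "R \<in> carrier ?G" for R
      using that by (simp add: \<sigma>_def \<pi>n_\<phi>)
    show "\<sigma> R = R" if "R \<in> carrier ?G" "\<phi> (\<phi> R) = \<one>\<^bsub>?G\<^esub>" for R
    proof -
      have "R \<in> kernel ?G ?G (\<phi> \<circ> \<phi>)" using that by (simp add: kernel_def)
      then have sub: "field_of_definition R \<subseteq> field_of_definition (Affine x\<^sub>P y\<^sub>P)" using assms(7) by blast
      have "(frob ^^ (2 * e)) x\<^sub>P = x\<^sub>P" "(frob ^^ (2 * e)) y\<^sub>P = y\<^sub>P"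
        using \<sigma>P unfolding \<sigma>_def map_ec_point_funpow Q0 by simp_all
      then show ?thesis
        unfolding \<sigma>_def map_ec_point_funpow by (rule fixed_points_field_of_definition[OF sub])
    qed
    show "Q n \<in> carrier ?G" "\<phi> (Q (Suc n)) = Q n" for n using Qpts Q\<phi> by simp_all
    show "\<sigma> (Q 0) = Q 0" by (rule \<sigma>P)
    \<comment> \<open>Irreducibility of the first transform gives the base of the tower.\<close>
    show "m dvd d" if d: "d > 0" "(\<sigma> ^^ d) (Q 1) = Q 1" for d
    proof -
      have "Some ((frob ^^ (2 * e * d)) (x 1)) = Some (x 1)"
        using arg_cong[OF d(2), of x_coord] unfolding \<sigma>_pow x_\<pi>n x by simp
      then have fx: "(frob ^^ (2 * e * d)) (x 1) = x 1" by simp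
      have "2 * e * d > 0" using e(1) d(1) by simp
      from period_dvd_iff[OF this fx] fx have "period frob (x 1) dvd 2 * e * d" by blast
      moreover have "period frob (x 1) = m * e" using irr1(1) deg[of 1] by simp
      ultimately have "m * e dvd (2 * d) * e" by (simp add: mult_ac)
      then have "m dvd 2 * d" using e(1) by simp
      moreover have "coprime m 2" using \<open>odd m\<close> by simp
      ultimately show ?thesis by (simp add: coprime_dvd_mult_right_iff)
    qed
  qed

  fix n
  let ?g = "(?T ^^ n) f"
  let ?p = "period frob (x n)"
  have g0: "degree ?g > 0" unfolding deg using m e(1) by simp
  then have "?g \<noteq> 0" by auto
  obtain i' where i': "i' > 0" "(frob ^^ i') (x n) = x n"
    by (rule frob_orbit_finite[OF \<open>?g \<noteq> 0\<close> root])
  note p = period[OF i']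
  \<comment> \<open>S has coefficients in k, so that Frobenius powers fixing x n also fix the abscissa of P.\<close>
  have down: "(frob ^^ ?p) (x 0) = x 0"
  proof -
    interpret h: field_embedding "(frob :: 'a alg_closure \<Rightarrow> 'a alg_closure) ^^ ?p"
      by (rule frob_funpow_embedding)
    have step: "(frob ^^ ?p) (x k) = x k" if "(frob ^^ ?p) (x (Suc k)) = x (Suc k)" for k
    proof -
      have "x k = poly X.nA (x (Suc k)) / poly X.nB (x (Suc k))"
        using Sx[of k] by (auto split: if_splits)
      then show ?thesis using that by (simp add: h.hom_divide flip: poly_frob_funpow)
    qed
    have "(frob ^^ ?p) (x (n - k)) = x (n - k)" if "k \<le> n" for k
      using that
    proof (induction k)
      case (Suc k)
      then show ?case using step[of "n - Suc k"] by (simp add: Suc_diff_Suc)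
    qed (simp add: p(2))
    from this[of n] show ?thesis by simp
  qed
  have "e dvd ?p"
    unfolding e_def using period_dvd_iff[OF i, of ?p] down x0 by simp
  then obtain b where b: "?p = e * b" by (rule dvdE)
  have "(?\<pi> ^^ (2 * ?p)) (Q n) = Q n"
    by (rule twice[OF Qpts]) (simp add: x_\<pi>n x p(2))
  then have "(\<sigma> ^^ b) (Q n) = Q n" unfolding \<sigma>_pow b by (simp add: mult.assoc)
  then have "m ^ n dvd b" by (rule orbits)
  then have "m ^ n * e dvd ?p" unfolding b by (simp add: mult.commute mult_dvd_mono)
  then have "degree ?g \<le> ?p" unfolding deg using p(1) by (rule dvd_imp_le)
  then show "irreducible ?g" by (rule irreducibleI_period[OF g0 root])
qed

end
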